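(* Let $n\ge 2$, $G=GL(n)$, $p$ a prime and $k\ge 1$ an integer, and fix a sign $\pm$. Let $Z_+$ be the group of scalar matrices in $G(\mathbb{R})$ with positive entries and let $f_\infty\in C_c^\infty(Z_+\backslash G(\mathbb{R}))$ be such that its orbital integrals are compactly supported. For $(x_1,\ldots,x_{n-1})\in\mathbb{R}^{n-1}$ let $\gamma=\gamma(x_1,\ldots,x_{n-1})\in G(\mathbb{R})$ be an element with characteristic polynomial $X^n-x_1X^{n-1}+\cdots+(-1)^{n-1}x_{n-1}X+(-1)^n(\pm p^k)$, let $D(x_1,\ldots,x_{n-1})=D_\gamma=\prod_{i<j}(\gamma_i-\gamma_j)^2$ be its discriminant ($\gamma_i$ the eigenvalues of $\gamma$), and define $$\theta^{\pm}_\infty(x_1,\ldots,x_{n-1})=|D_\gamma|^{1/2}\int_{G_\gamma(\mathbb{R})\backslash G(\mathbb{R})} f_\infty(g^{-1}\gamma g)\,dg,$$ where $G_\gamma$ is the centralizer of $\gamma$ in $G$. Let $\phi$ be any Schwartz function on $\mathbb{R}$ and $\alpha>0$. Then the function $$f(x_1,\ldots,x_{n-1})=\theta^{\pm}_\infty(x_1,\ldots,x_{n-1})\,\phi\big(|D(x_1,\ldots,x_{n-1})|^{-\alpha}\big)$$ is smooth on $\mathbb{R}^{n-1}$.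
   Context: The function $\theta^\pm_\infty$ depends only on the conjugacy class of $\gamma$, hence is regarded as a function on $\mathbb{R}^{n-1}$ of the characteristic polynomial coefficients $(x_1,\ldots,x_{n-1})$ (with constant term determined by $\det\gamma=\pm p^k$). It is smooth on the set of regular elements, i.e. where $D\neq 0$; at points where $D=0$ (where $|D|^{-\alpha}$ is undefined) the function $f$ is understood via its limiting value. Haar measures on $G(\mathbb{R})$ and $G_\gamma(\mathbb{R})$ are arbitrary fixed choices. *)

theory Defs
  imports "HOL-Analysis.Analysis" "HOL-Computational_Algebra.Polynomial"
    "HOL-Computational_Algebra.Primes"
begin

section \<open>Smooth functions and Schwartz functions\<close>

text \<open>Intended for open \<open>S\<close> in a finite-dimensional space, where it is the usual notion:
  all iterated directional derivatives up to order \<open>k\<close> exist and are continuous.\<close>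

primrec Ck_on :: "nat \<Rightarrow> 'a::real_normed_vector set \<Rightarrow> ('a \<Rightarrow> 'b::real_normed_vector) \<Rightarrow> bool" where
  "Ck_on 0 S f \<longleftrightarrow> continuous_on S f"
| "Ck_on (Suc k) S f \<longleftrightarrow> (\<forall>x\<in>S. f differentiable (at x)) \<and>
     (\<forall>v. Ck_on k S (\<lambda>x. frechet_derivative f (at x) v))"

definition smooth_on :: "'a::real_normed_vector set \<Rightarrow> ('a \<Rightarrow> 'b::real_normed_vector) \<Rightarrow> bool" where
  "smooth_on S f \<longleftrightarrow> (\<forall>k. Ck_on k S f)"

definition schwartz :: "(real \<Rightarrow> complex) \<Rightarrow> bool" where
  "schwartz \<phi> \<longleftrightarrow> smooth_on UNIV \<phi> \<and>
     (\<forall>m k. \<exists>C. \<forall>t.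
        \<bar>t\<bar> ^ m * norm (((\<lambda>\<psi> s. vector_derivative \<psi> (at s)) ^^ k) \<phi> t) \<le> C)"

definition extend_by_limits :: "'a::t2_space set \<Rightarrow> ('a \<Rightarrow> 'b::t2_space) \<Rightarrow> 'a \<Rightarrow> 'b" where
  "extend_by_limits R F x = (if x \<in> R then F x else Lim (at x within R) F)"

section \<open>Characteristic polynomial and discriminant\<close>

definition charpoly :: "'a::comm_ring_1^'n^'n \<Rightarrow> 'a poly" where
  "charpoly A = det (mat [:0, 1:] - (\<chi> i j. [:A $ i $ j:]))"

text \<open>The complex eigenvalues, repeated according to algebraic multiplicity, in some order.\<close>

definition eigenvalue_list :: "real^'n^'n \<Rightarrow> complex list" where
  "eigenvalue_list A =
     (SOME es. map_poly complex_of_real (charpoly A) = (\<Prod>e\<leftarrow>es. [:- e, 1:]))"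

definition discriminant :: "real^'n^'n \<Rightarrow> complex" where
  "discriminant A = (let es = eigenvalue_list A in
     \<Prod>j<length es. \<Prod>i<j. (es ! i - es ! j)\<^sup>2)"

text \<open>The polynomial \<open>X^n - x\<^sub>1 X^(n-1) + \<dots> + (-1)^(n-1) x\<^sub>n\<^sub>-\<^sub>1 X + (-1)^n d\<close>,
  where the coordinate of \<open>x\<close> called \<open>x\<^sub>i\<close> is the one at the index \<open>j\<close> with \<open>e j = i\<close>.\<close>

definition coeff_poly :: "nat \<Rightarrow> ('m::finite \<Rightarrow> nat) \<Rightarrow> real \<Rightarrow> real^'m \<Rightarrow> real poly" where
  "coeff_poly n e d x = monom 1 n
     + (\<Sum>j\<in>UNIV. monom ((-1) ^ e j * x $ j) (n - e j))
     + [:(-1) ^ n * d:]"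

section \<open>The group \<open>GL(n,\<real>)\<close> and its invariant measures\<close>

definition GL :: "(real^'n^'n) set" where
  "GL = {g. invertible g}"

definition regular :: "real^'n^'n \<Rightarrow> bool" where
  "regular \<gamma> \<longleftrightarrow> \<gamma> \<in> GL \<and> discriminant \<gamma> \<noteq> 0"

definition centralizer :: "real^'n^'n \<Rightarrow> (real^'n^'n) set" where
  "centralizer \<gamma> = {g \<in> GL. g ** \<gamma> = \<gamma> ** g}"

definition conjugate :: "real^'n^'n \<Rightarrow> real^'n^'n \<Rightarrow> real^'n^'n" where
  "conjugate g \<gamma> = matrix_inv g ** \<gamma> ** g"

text \<open>Haar measure on a closed subgroup \<open>H\<close> of \<open>GL\<close>; regularity is automatic, \<open>H\<close> being
  locally compact and second countable.\<close>

definition haar_measure_on :: "(real^'n^'n) set \<Rightarrow> (real^'n^'n) measure \<Rightarrow> bool" where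
  "haar_measure_on H \<mu> \<longleftrightarrow>
     sets \<mu> = sets (restrict_space borel H) \<and>
     (\<forall>h\<in>H. distr \<mu> \<mu> (\<lambda>x. h ** x) = \<mu>) \<and>
     (\<forall>K. K \<subseteq> H \<and> compact K \<longrightarrow> emeasure \<mu> K < \<infinity>) \<and>
     emeasure \<mu> H \<noteq> 0"

text \<open>A choice of Haar measure on the centralizers of regular elements (the maximal tori). The
  measure depends only on the torus, and conjugate tori carry corresponding measures: this is
  what makes orbital integrals functions of the conjugacy class. It is not required for other
  centralizers, on which elements of the normalizer may rescale the Haar measure.\<close>

definition torus_haar_measures :: "((real^'n^'n) set \<Rightarrow> (real^'n^'n) measure) \<Rightarrow> bool" where
  "torus_haar_measures \<tau> \<longleftrightarrow> (\<forall>\<gamma>. regular \<gamma> \<longrightarrow>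
     haar_measure_on (centralizer \<gamma>) (\<tau> (centralizer \<gamma>)) \<and>
     (\<forall>g\<in>GL. \<tau> (centralizer (conjugate g \<gamma>)) =
        distr (\<tau> (centralizer \<gamma>)) (restrict_space borel (centralizer (conjugate g \<gamma>)))
          (conjugate g)))"

definition cosets :: "(real^'n^'n) set \<Rightarrow> (real^'n^'n) set set" where
  "cosets H = {(\<lambda>h. h ** g) ` H |g. g \<in> GL}"

definition coset_rep :: "(real^'n^'n) set \<Rightarrow> real^'n^'n" where
  "coset_rep c = (SOME g. g \<in> c)"

text \<open>\<open>Q\<close> is the measure on \<open>H \ GL\<close> that is the quotient of the Haar measures \<open>\<mu>\<close> on \<open>GL\<close> and
  \<open>\<nu>\<close> on \<open>H\<close>: a Borel measure for the quotient topology (a set \<open>U\<close> of cosets is open iff its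
  preimage, which is its union, is open) with
  \<open>\<integral>\<^sub>G h(g) dg = \<integral>\<^sub>H\<^sub>\<setminus>\<^sub>G \<integral>\<^sub>H h(t g) dt dg\<close> for all nonnegative continuous compactly supported \<open>h\<close>.
  For unimodular \<open>H\<close> there is exactly one such \<open>Q\<close>.\<close>

definition quotient_measure ::
  "(real^'n^'n) measure \<Rightarrow> (real^'n^'n) measure \<Rightarrow> (real^'n^'n) set \<Rightarrow>
    (real^'n^'n) set measure \<Rightarrow> bool" where
  "quotient_measure \<mu> \<nu> H Q \<longleftrightarrow>
     space Q = cosets H \<and>
     sets Q = sigma_sets (cosets H) {U. U \<subseteq> cosets H \<and> open (\<Union>U)} \<and>
     (\<forall>h :: real^'n^'n \<Rightarrow> real.
        continuous_on GL h \<and> (\<forall>g\<in>GL. 0 \<le> h g) \<and>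
        (\<exists>K. compact K \<and> K \<subseteq> GL \<and> (\<forall>g\<in>GL - K. h g = 0)) \<longrightarrow>
        (\<integral>\<^sup>+ g. ennreal (h g) \<partial>\<mu>) =
        (\<integral>\<^sup>+ c. (\<integral>\<^sup>+ t. ennreal (h (t ** coset_rep c)) \<partial>\<nu>) \<partial>Q))"

section \<open>Orbital integrals\<close>

text \<open>Smooth functions on \<open>GL\<close> that are invariant under the positive scalar matrices and
  compactly supported modulo them.\<close>

definition test_function :: "(real^'n^'n \<Rightarrow> complex) \<Rightarrow> bool" where
  "test_function f \<longleftrightarrow>
     smooth_on GL f \<and>
     (\<forall>g\<in>GL. \<forall>c>0. f (c *\<^sub>R g) = f g) \<and>
     (\<exists>K. compact K \<and> K \<subseteq> GL \<and> (\<forall>g\<in>GL. f g \<noteq> 0 \<longrightarrow> (\<exists>c>0. c *\<^sub>R g \<in> K)))"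

text \<open>\<open>Q H\<close> is the measure used on \<open>H \ GL\<close>. The integrand does not depend on the
  representative of the coset.\<close>

definition orbital_integral ::
  "((real^'n^'n) set \<Rightarrow> (real^'n^'n) set measure) \<Rightarrow> (real^'n^'n \<Rightarrow> complex) \<Rightarrow>
    real^'n^'n \<Rightarrow> complex" where
  "orbital_integral Q f \<gamma> =
     (\<integral>c. f (conjugate (coset_rep c) \<gamma>) \<partial>(Q (centralizer \<gamma>)))"

definition normalized_orbital_integral ::
  "((real^'n^'n) set \<Rightarrow> (real^'n^'n) set measure) \<Rightarrow> (real^'n^'n \<Rightarrow> complex) \<Rightarrow>
    real^'n^'n \<Rightarrow> complex" where
  "normalized_orbital_integral Q f \<gamma> =
     complex_of_real (cmod (discriminant \<gamma>) powr (1/2)) * orbital_integral Q f \<gamma>"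

text \<open>As a function on the regular conjugacy classes modulo positive scalars, the orbital
  integral vanishes off a compact set, i.e. off the classes that meet a fixed compact subset
  of \<open>GL\<close> up to a positive scalar.\<close>

definition compactly_supported_orbital_integrals ::
  "((real^'n^'n) set \<Rightarrow> (real^'n^'n) set measure) \<Rightarrow> (real^'n^'n \<Rightarrow> complex) \<Rightarrow> bool" where
  "compactly_supported_orbital_integrals Q f \<longleftrightarrow>
     (\<exists>K. compact K \<and> K \<subseteq> GL \<and>
        (\<forall>\<gamma>. regular \<gamma> \<and> orbital_integral Q f \<gamma> \<noteq> 0 \<longrightarrow>
           (\<exists>c>0. \<exists>g\<in>GL. c *\<^sub>R conjugate g \<gamma> \<in> K)))"

end

theory Submission
  imports Defs "HOL-Computational_Algebra.Fundamental_Theorem_Algebra"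
begin

text \<open>The orbital integral of \<open>F\<close> is a function \<open>\<theta>\<^sub>F(x)\<close> of the coefficients of the characteristic polynomial.
  Moving \<open>\<gamma>\<close> inside its torus along the powers \<open>\<gamma>^k\<close> shows that a derivative of \<open>\<theta>\<^sub>F\<close> is a
  combination of orbital integrals of the functions \<open>A \<mapsto> DF(A)[A^k]\<close>, with coefficients \<open>a\<^sub>k(x) / D(x)\<close>, where
  \<open>a\<^sub>k\<close> is a polynomial; the \<open>a\<^sub>k\<close> solve the linear system of multiplication by \<open>q'\<close> on \<open>\<real>[X] / (q)\<close>, whose
  determinant is the discriminant \<open>D\<close> up to sign. Each orbital integral is bounded by a power of \<open>1 / |D|\<close>: if
  \<open>g\<inverse>\<gamma>g\<close> is bounded, then rescaling the eigenvectors shows that \<open>g\<close> is, modulo the torus, in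
  a compact set of size polynomial in \<open>1 / |D|\<close>, and Haar measure grows polynomially. Hence every derivative of
  \<open>\<theta>\<^sub>f\<close> is \<open>O(|D|^(-N))\<close> locally, which the rapid decay of \<open>\<phi>(|D|^(-\<alpha>))\<close> beats, and the
  extension by zero to \<open>D = 0\<close> is smooth.\<close>

section \<open>Calculus of smooth functions\<close>

text \<open>At a simple root \<open>\<xi>\<close> of \<open>q\<close>, implicit differentiation
  gives the velocity \<open>- \<delta>q(\<xi>) / q'(\<xi>)\<close>. If \<open>r\<close> has degree
  below \<open>n\<close> and \<open>r * q' = - \<delta>q\<close> modulo \<open>q\<close>, then
  \<open>r\<close> takes exactly these values at the roots, so \<open>\<gamma>\<close> may be moved
  with velocity \<open>r(\<gamma>)\<close>; this is why powers of \<open>\<gamma>\<close> suffice as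
  directions. Two obstacles shape the proof. The representatives \<open>\<gamma> x\<close> need not
  depend continuously on \<open>x\<close>, and the quotient measures are known only through an
  integration formula for continuous compactly supported functions. So the orbital integral must
  first be shown to depend on the characteristic polynomial alone; then \<open>\<gamma> x\<close>
  can be replaced near a regular point by a differentiable family in one torus. The bounds must hold
  for all \<open>x\<close> at once. Conjugation permutes the \<open>n\<close> eigenvalue indices in
  finitely many ways, so finitely many tori suffice. The support condition
  \<open>norm A ^ n \<le> R * \<bar>det A\<bar>\<close> is invariant under scaling, passes to
  derivatives with the same \<open>R\<close>, and bounds \<open>A\<close> because the determinant is
  fixed up to sign by the constant term.\<close>

lemma Ck_on_cong_open:
  fixes f g :: "'a::real_normed_vector \<Rightarrow> 'b::real_normed_vector"
  assumes "open S" "\<And>x. x \<in> S \<Longrightarrow> f x = g x"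
  shows "Ck_on k S f \<longleftrightarrow> Ck_on k S g"
  using assms(2)
proof (induction k arbitrary: f g)
  case 0
  then show ?case by (simp cong: continuous_on_cong)
next
  case (Suc k)
  have "Ck_on (Suc k) S g" if "Ck_on (Suc k) S f" and fg: "\<And>x. x \<in> S \<Longrightarrow> f x = g x" for f g :: "'a \<Rightarrow> 'b"
  proof -
    have df: "f differentiable (at x)" if "x \<in> S" for x
      using \<open>Ck_on (Suc k) S f\<close> that by simp
    have dg: "g differentiable (at x)" if "x \<in> S" for x
      using has_derivative_transform_within_open[OF _ assms(1) that] df[OF that] fg
      unfolding differentiable_def by metis
    have "Ck_on k S (\<lambda>x. frechet_derivative g (at x) v)" for v
    proof -
      have fd: "frechet_derivative f (at x) v = frechet_derivative g (at x) v" if "x \<in> S" for x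
        using frechet_derivative_transform_within_open[OF df[OF that] assms(1) that fg] by simp
      have "Ck_on k S (\<lambda>x. frechet_derivative f (at x) v) =
          Ck_on k S (\<lambda>x. frechet_derivative g (at x) v)"
        by (rule Suc.IH) (rule fd)
      with \<open>Ck_on (Suc k) S f\<close> show ?thesis by simp
    qed
    with dg show ?thesis by simp
  qed
  from this[of f g] this[of g f] Suc.prems show ?case by metis
qed

lemma Ck_on_Suc_imp: "Ck_on (Suc k) S f \<Longrightarrow> Ck_on k S f"
proof (induction k arbitrary: f)
  case 0
  then show ?case
    by (auto intro!: continuous_at_imp_continuous_on differentiable_imp_continuous_within)
next
  case (Suc k)
  then show ?case by simp
qed

text \<open>Derivatives are unique, so any known derivative field may stand in for the chosen
  \<open>frechet_derivative\<close>.\<close>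

lemma Ck_on_SucI:
  assumes "open S" "\<And>x. x \<in> S \<Longrightarrow> (f has_derivative f' x) (at x)"
    and "\<And>v. Ck_on k S (\<lambda>x. f' x v)"
  shows "Ck_on (Suc k) S f"
proof -
  have "Ck_on k S (\<lambda>x. frechet_derivative f (at x) v)" for v
    using Ck_on_cong_open[OF assms(1), of "\<lambda>x. frechet_derivative f (at x) v" "\<lambda>x. f' x v" k]
      assms(2,3) by (metis frechet_derivative_at)
  then show ?thesis using assms(2) by (auto simp: differentiable_def)
qed

lemma Ck_on_SucD:
  assumes "Ck_on (Suc k) S f" "x \<in> S"
  shows "(f has_derivative frechet_derivative f (at x)) (at x)"
  using assms by (simp add: frechet_derivative_works[symmetric])

lemma Ck_on_add:
  assumes "open S"
  shows "Ck_on k S f \<Longrightarrow> Ck_on k S g \<Longrightarrow> Ck_on k S (\<lambda>x. f x + g x)"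
proof (induction k arbitrary: f g)
  case 0
  then show ?case by (simp add: continuous_on_add)
next
  case (Suc k)
  show ?case
    by (rule Ck_on_SucI[OF assms has_derivative_add[OF Ck_on_SucD Ck_on_SucD]])
      (use Suc in auto)
qed

lemma Ck_on_const: "open S \<Longrightarrow> Ck_on k S (\<lambda>x. c)"
proof (induction k arbitrary: c)
  case 0
  then show ?case by simp
next
  case (Suc k)
  show ?case
    by (rule Ck_on_SucI[OF Suc.prems has_derivative_const]) (use Suc in auto)
qed

lemma Ck_on_sum:
  assumes "open S" "\<And>i. i \<in> I \<Longrightarrow> Ck_on k S (f i)"
  shows "Ck_on k S (\<lambda>x. \<Sum>i\<in>I. f i x)"
  using assms(2)
proof (induction I rule: infinite_finite_induct)
  case (insert i I)
  then show ?case by (simp add: Ck_on_add[OF assms(1)])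
qed (simp_all add: Ck_on_const assms(1))

text \<open>The directional derivatives are again polynomial in the base point; this keeps the class
  of damped terms closed under differentiation.\<close>

lemma real_polynomial_function_has_derivative:
  assumes "real_polynomial_function p"
  shows "\<exists>p'. (\<forall>x. (p has_derivative (\<lambda>v. p' v x)) (at x)) \<and>
           (\<forall>v. real_polynomial_function (p' v))"
  using assms
proof (induction p rule: real_polynomial_function.induct)
  case (linear f)
  then show ?case
    by (intro exI[of _ "\<lambda>v x. f v"]) (auto intro: bounded_linear_imp_has_derivative)
next
  case (const c)
  show ?case by (intro exI[of _ "\<lambda>v x. 0"]) auto
next
  case (add f g)
  then obtain f' g' where
    f': "\<And>x. (f has_derivative (\<lambda>v. f' v x)) (at x)" "\<And>v. real_polynomial_function (f' v)" and
    g': "\<And>x. (g has_derivative (\<lambda>v. g' v x)) (at x)" "\<And>v. real_polynomial_function (g' v)"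
    by blast
  show ?case
    by (intro exI[of _ "\<lambda>v x. f' v x + g' v x"] conjI allI has_derivative_add f' g'
        real_polynomial_function.intros(3))
next
  case (mult f g)
  then obtain f' g' where
    f': "\<And>x. (f has_derivative (\<lambda>v. f' v x)) (at x)" "\<And>v. real_polynomial_function (f' v)" and
    g': "\<And>x. (g has_derivative (\<lambda>v. g' v x)) (at x)" "\<And>v. real_polynomial_function (g' v)"
    by blast
  show ?case
    by (intro exI[of _ "\<lambda>v x. f x * g' v x + f' v x * g x"] conjI allI has_derivative_mult f' g'
        real_polynomial_function.intros(3) real_polynomial_function.intros(4) mult)
qed

lemma Ck_on_polynomial_scaleR:
  fixes f :: "'a::real_normed_vector \<Rightarrow> 'b::real_normed_vector"
  assumes "open S"
  shows "real_polynomial_function p \<Longrightarrow> Ck_on k S f \<Longrightarrow> Ck_on k S (\<lambda>x. p x *\<^sub>R f x)"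
proof (induction k arbitrary: f p)
  case 0
  have "continuous_on S p"
    using real_polynomial_function_has_derivative[OF 0(1)]
    by (meson has_derivative_continuous continuous_at_imp_continuous_on)
  then show ?case using 0(2) by (simp add: continuous_on_scaleR)
next
  case (Suc k)
  obtain p' where p': "\<And>x. (p has_derivative (\<lambda>v. p' v x)) (at x)"
    "\<And>v. real_polynomial_function (p' v)"
    using real_polynomial_function_has_derivative[OF Suc.prems(1)] by blast
  have f: "Ck_on k S f" "\<And>v. Ck_on k S (\<lambda>x. frechet_derivative f (at x) v)"
    using Suc.prems(2) Ck_on_Suc_imp by auto
  show ?case
    by (rule Ck_on_SucI[OF assms has_derivative_scaleR[OF p'(1) Ck_on_SucD[OF Suc.prems(2)]]],
        assumption)
      (intro Ck_on_add[OF assms] Suc.IH Suc.prems p'(2) f)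
qed

lemma smooth_onD_continuous: "smooth_on S f \<Longrightarrow> continuous_on S f"
  unfolding smooth_on_def using Ck_on.simps(1) by blast

lemma smooth_onD_has_derivative:
  "smooth_on S f \<Longrightarrow> x \<in> S \<Longrightarrow> (f has_derivative frechet_derivative f (at x)) (at x)"
  unfolding smooth_on_def using Ck_on_SucD by blast

lemma smooth_on_frechet_derivative:
  "smooth_on S f \<Longrightarrow> smooth_on S (\<lambda>x. frechet_derivative f (at x) v)"
  unfolding smooth_on_def using Ck_on.simps(2) by blast

lemma has_derivative_inner_Basis_expansion:
  fixes v :: "'a::euclidean_space"
  assumes "(f has_derivative f') F"
  shows "f' v = (\<Sum>b\<in>Basis. (v \<bullet> b) *\<^sub>R f' b)"
proof -
  interpret bounded_linear f' using assms by (rule has_derivative_bounded_linear)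
  have "f' v = f' (\<Sum>b\<in>Basis. (v \<bullet> b) *\<^sub>R b)" by (simp add: euclidean_representation)
  then show ?thesis by (simp add: sum scaleR)
qed

text \<open>The direction \<open>M x\<close> varies with the point. Expanding it in the basis leaves
  fixed directions with polynomial coefficients. The fields of interest are
  \<open>A \<mapsto> A^k\<close>.\<close>

lemma smooth_on_polynomial_field_derivative:
  fixes f :: "'a::euclidean_space \<Rightarrow> 'b::real_normed_vector"
  assumes "open S" "smooth_on S f" "\<And>b. b \<in> Basis \<Longrightarrow> real_polynomial_function (\<lambda>x. M x \<bullet> b)"
  shows "smooth_on S (\<lambda>x. frechet_derivative f (at x) (M x))"
proof -
  have "Ck_on k S (\<lambda>x. \<Sum>b\<in>Basis. (M x \<bullet> b) *\<^sub>R frechet_derivative f (at x) b)" for k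
    using smooth_on_frechet_derivative[OF assms(2)] assms(3)
    by (intro Ck_on_sum Ck_on_polynomial_scaleR) (auto simp: smooth_on_def assms(1))
  then show ?thesis
    unfolding smooth_on_def
    using Ck_on_cong_open[OF assms(1), of "\<lambda>x. frechet_derivative f (at x) (M x)"
        "\<lambda>x. \<Sum>b\<in>Basis. (M x \<bullet> b) *\<^sub>R frechet_derivative f (at x) b"]
      has_derivative_inner_Basis_expansion[OF smooth_onD_has_derivative[OF assms(2)]] by metis
qed

section \<open>Damping by a Schwartz function\<close>

abbreviation iter_deriv :: "nat \<Rightarrow> (real \<Rightarrow> complex) \<Rightarrow> real \<Rightarrow> complex" where
  "iter_deriv j \<phi> \<equiv> ((\<lambda>\<psi> s. vector_derivative \<psi> (at s)) ^^ j) \<phi>"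

lemma smooth_iter_deriv:
  assumes "smooth_on UNIV \<phi>"
  shows "smooth_on UNIV (iter_deriv j \<phi>)"
    and "(iter_deriv j \<phi> has_vector_derivative iter_deriv (Suc j) \<phi> t) (at t)"
proof -
  have vd: "(\<psi> has_vector_derivative vector_derivative \<psi> (at s)) (at s)"
    if "smooth_on UNIV \<psi>" for \<psi> :: "real \<Rightarrow> complex" and s
    using differentiableI[OF smooth_onD_has_derivative[OF that UNIV_I]]
    by (simp add: vector_derivative_works)
  show sm: "smooth_on UNIV (iter_deriv j \<phi>)" for j
  proof (induction j)
    case (Suc j)
    have "vector_derivative (iter_deriv j \<phi>) (at s) = frechet_derivative (iter_deriv j \<phi>) (at s) 1" for s
      using fun_cong[OF frechet_derivative_at[OF vd[OF Suc, of s, unfolded has_vector_derivative_def]], of 1]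
      by simp
    with smooth_on_frechet_derivative[OF Suc, of 1] show ?case by simp
  qed (simp add: assms)
  show "(iter_deriv j \<phi> has_vector_derivative iter_deriv (Suc j) \<phi> t) (at t)"
    using vd[OF sm] by simp
qed

text \<open>Writing \<open>\<bar>g\<bar>^b\<close> as a power of the positive number
  \<open>g^2\<close> treats both signs of \<open>g\<close> at once.\<close>

lemma has_derivative_abs_powr:
  fixes g :: "'a::real_normed_vector \<Rightarrow> real"
  assumes "(g has_derivative g') (at x)" "g x \<noteq> 0"
  shows "((\<lambda>y. \<bar>g y\<bar> powr b) has_derivative (\<lambda>v. b * (\<bar>g x\<bar> powr (b - 2)) * g x * g' v)) (at x)"
proof -
  have e: "\<bar>y\<bar> powr b = (y\<^sup>2) powr (b / 2)" for y :: real
  proof (cases "y = 0")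
    case False
    then have "(y\<^sup>2) powr (b/2) = (\<bar>y\<bar> powr 2) powr (b/2)" by simp
    then show ?thesis by (simp only: powr_powr) simp
  qed simp
  have "((\<lambda>t. t powr (b/2)) has_real_derivative (b/2) * ((g x)\<^sup>2) powr (b/2 - 1)) (at ((g x)\<^sup>2))"
    using assms(2) by (intro has_real_derivative_powr) auto
  moreover have "((\<lambda>y. (g y)\<^sup>2) has_derivative (\<lambda>v. 2 * g x * g' v)) (at x)"
    using has_derivative_power[OF assms(1), of 2] by (simp add: mult_ac)
  ultimately have "((\<lambda>y. (g y)\<^sup>2 powr (b/2)) has_derivative
      (\<lambda>v. (b/2) * ((g x)\<^sup>2) powr (b/2 - 1) * (2 * g x * g' v))) (at x)"
    unfolding has_field_derivative_def
    by (rule has_derivative_compose[rotated, where f="\<lambda>y. (g y)\<^sup>2", unfolded o_def])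
  moreover have "((g x)\<^sup>2) powr (b/2 - 1) = \<bar>g x\<bar> powr (b - 2)"
  proof -
    have "((g x)\<^sup>2) powr (b/2 - 1) = (\<bar>g x\<bar> powr 2) powr (b/2-1)" using assms(2) by simp
    then show ?thesis by (simp only: powr_powr) (simp add: algebra_simps)
  qed
  ultimately show ?thesis by (simp add: e mult_ac)
qed

text \<open>\<open>Th F\<close> stands for an orbital integral as a function of the characteristic polynomial and \<open>nx F k\<close>
  for the derivative of the test function \<open>F\<close> along the matrix field \<open>A \<mapsto> A^k\<close>.\<close>

locale damped_family =
  fixes \<Delta> :: "'a::euclidean_space \<Rightarrow> real" and Th :: "'i \<Rightarrow> 'a \<Rightarrow> complex" and I :: "'i set"
    and nx :: "'i \<Rightarrow> 'k::finite \<Rightarrow> 'i" and a :: "'k \<Rightarrow> 'a \<Rightarrow> 'a \<Rightarrow> real"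
    and \<phi> :: "real \<Rightarrow> complex" and \<alpha> :: real
  assumes poly_\<Delta>: "real_polynomial_function \<Delta>"
    and poly_a: "\<And>k v. real_polynomial_function (a k v)"
    and nx_in: "\<And>F k. F \<in> I \<Longrightarrow> nx F k \<in> I"
    and Th_deriv: "\<And>F x. F \<in> I \<Longrightarrow> \<Delta> x \<noteq> 0 \<Longrightarrow>
      (Th F has_derivative (\<lambda>v. \<Sum>k\<in>UNIV. (a k v x / \<Delta> x) *\<^sub>R Th (nx F k) x)) (at x)"
    and Th_bound: "\<And>F. F \<in> I \<Longrightarrow>
      \<exists>C N. \<forall>x. \<Delta> x \<noteq> 0 \<longrightarrow> norm (Th F x) \<le> C * (1 + 1 / \<bar>\<Delta> x\<bar>) ^ N"
    and schwartz: "schwartz \<phi>" and \<alpha>_pos: "\<alpha> > 0"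
begin

text \<open>The value 0 on the zero set of \<open>\<Delta>\<close> is the limit from outside. The
  exponent \<open>b\<close> is real because it starts at 1/2 and, under differentiation, stays or
  drops by 2 or by \<open>\<alpha> + 2\<close>; \<open>P\<close> collects the derivatives of
  \<open>\<Delta>\<close> and the coefficients \<open>a\<close>.\<close>

definition damped_term :: "('a \<Rightarrow> real) \<Rightarrow> real \<Rightarrow> 'i \<Rightarrow> nat \<Rightarrow> 'a \<Rightarrow> complex" where
  "damped_term P b F j x = (if \<Delta> x = 0 then 0 else
     (P x * \<bar>\<Delta> x\<bar> powr b) *\<^sub>R (Th F x * iter_deriv j \<phi> (\<bar>\<Delta> x\<bar> powr (- \<alpha>))))"

lemma polynomial_locally_bounded:
  fixes P :: "'a \<Rightarrow> real"
  assumes "real_polynomial_function P"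
  shows "\<exists>C\<ge>1. \<forall>y\<in>cball x 1. \<bar>P y\<bar> \<le> C"
proof -
  have "continuous_on (cball x 1) P"
    using real_polynomial_function_has_derivative[OF assms]
    by (meson has_derivative_continuous continuous_at_imp_continuous_on)
  then have "compact (P ` cball x 1)" by (rule compact_continuous_image) simp
  then obtain B where "\<And>y. y \<in> P ` cball x 1 \<Longrightarrow> \<bar>y\<bar> \<le> B"
    using compact_imp_bounded bounded_real by metis
  then show ?thesis by (intro exI[of _ "max 1 B"]) (auto simp: le_max_iff_disj)
qed

text \<open>A quadratic bound is what differentiability on the zero set asks for, since the square
  of \<open>\<Delta>\<close> has derivative zero there. Schwartz decay at the argument
  \<open>\<bar>\<Delta>\<bar>^(-\<alpha>)\<close> supplies any power of
  \<open>\<bar>\<Delta>\<bar>\<close>; \<open>P\<close> is bounded only locally, hence the unit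
  ball.\<close>

lemma damped_term_bound:
  assumes "real_polynomial_function P" "F \<in> I"
  shows "\<exists>C. \<forall>y\<in>cball x 1. norm (damped_term P b F j y) \<le> C * (\<Delta> y)\<^sup>2"
proof -
  obtain p where p: "p \<ge> 1" "\<And>y. y \<in> cball x 1 \<Longrightarrow> \<bar>P y\<bar> \<le> p"
    using polynomial_locally_bounded[OF assms(1)] by metis
  obtain \<delta> where \<delta>: "\<delta> \<ge> 1" "\<And>y. y \<in> cball x 1 \<Longrightarrow> \<bar>\<Delta> y\<bar> \<le> \<delta>"
    using polynomial_locally_bounded[OF poly_\<Delta>] by metis
  obtain C0 N where CN0: "\<And>x. \<Delta> x \<noteq> 0 \<Longrightarrow> norm (Th F x) \<le> C0 * (1 + 1 / \<bar>\<Delta> x\<bar>) ^ N"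
    using Th_bound[OF assms(2)] by metis
  define C where "C = \<bar>C0\<bar>"
  have CN: "norm (Th F x) \<le> C * (1 + 1 / \<bar>\<Delta> x\<bar>) ^ N" "C \<ge> 0" if "\<Delta> x \<noteq> 0" for x
    using order_trans[OF CN0[OF that] mult_right_mono[of C0 C]] by (auto simp: C_def)
  \<comment> \<open>The three factors contribute the exponent \<open>b - N + \<alpha> * m\<close> of
    \<open>D\<close> in total; this \<open>m\<close> pushes it beyond 2.\<close>
  obtain m :: nat where m: "real m > (real N - b + 2) / \<alpha>"
    using reals_Archimedean2 by blast
  define \<epsilon> where "\<epsilon> = b - real N + \<alpha> * real m - 2"
  have \<epsilon>: "\<epsilon> \<ge> 0"
    using m \<alpha>_pos by (simp add: \<epsilon>_def pos_divide_less_eq mult.commute)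
  obtain B0 where B0: "\<And>t. \<bar>t\<bar> ^ m * norm (iter_deriv j \<phi> t) \<le> B0"
    using schwartz unfolding schwartz_def by metis
  define B where "B = max B0 0"
  have B: "\<bar>t\<bar> ^ m * norm (iter_deriv j \<phi> t) \<le> B" "B \<ge> 0" for t
    using B0[of t] by (auto simp: B_def)
  have "norm (damped_term P b F j y) \<le> (p * C * (\<delta> + 1) ^ N * B * \<delta> powr \<epsilon>) * (\<Delta> y)\<^sup>2"
    if y: "y \<in> cball x 1" for y
  proof (cases "\<Delta> y = 0")
    case True
    then show ?thesis by (simp add: damped_term_def)
  next
    case False
    define D where "D = \<bar>\<Delta> y\<bar>"
    have D: "D > 0" "D \<le> \<delta>" using False \<delta>(2)[OF y] by (auto simp: D_def)
    have 1: "norm (Th F y) \<le> C * (\<delta> + 1) ^ N * D powr (- real N)"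
    proof -
      have "(1 + 1 / D) ^ N = (D + 1) ^ N * D powr (- real N)"
        using D(1) by (simp add: powr_minus powr_realpow power_divide[symmetric] add_divide_distrib
            divide_inverse[symmetric])
      also have "\<dots> \<le> (\<delta> + 1) ^ N * D powr (- real N)"
        using D by (intro mult_right_mono power_mono) auto
      finally show ?thesis
        using CN[OF False] unfolding D_def[symmetric]
        by (meson mult_left_mono order_trans mult.assoc[THEN eq_refl] order.refl
            mult.assoc[symmetric, THEN eq_refl])
    qed
    have 2: "norm (iter_deriv j \<phi> (D powr (- \<alpha>))) \<le> B * D powr (\<alpha> * real m)"
    proof -
      have "(D powr (-\<alpha>)) ^ m = D powr (- (\<alpha> * real m))"
        using D(1) by (simp add: powr_powr powr_realpow[symmetric])
      with B(1)[of "D powr (-\<alpha>)"] D(1)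
      show ?thesis by (simp add: powr_minus field_simps)
    qed
    have "norm (damped_term P b F j y) = \<bar>P y\<bar> * D powr b * (norm (Th F y) * norm (iter_deriv j \<phi> (D powr (- \<alpha>))))"
      using False by (simp add: damped_term_def D_def norm_mult abs_mult)
    also have "\<dots> \<le> p * D powr b * ((C * (\<delta> + 1) ^ N * D powr (- real N)) * (B * D powr (\<alpha> * real m)))"
      by (intro mult_mono p(2)[OF y] 1 2 order.refl mult_nonneg_nonneg)
         (use p(1) \<delta>(1) CN(2)[OF False] B(2) in auto)
    also have "\<dots> = p * C * (\<delta> + 1) ^ N * B * (D powr b * D powr (- real N) * D powr (\<alpha> * real m))"
      by simp
    also have "D powr b * D powr (- real N) * D powr (\<alpha> * real m) = D powr (\<epsilon> + 2)"
      by (simp add: powr_add[symmetric] \<epsilon>_def)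
    also have "\<dots> = D powr \<epsilon> * D\<^sup>2" using D(1) by (simp add: powr_add)
    also have "p * C * (\<delta> + 1) ^ N * B * (D powr \<epsilon> * D\<^sup>2) \<le> p * C * (\<delta> + 1) ^ N * B * (\<delta> powr \<epsilon> * D\<^sup>2)"
      using D \<epsilon> p(1) \<delta>(1) CN(2)[OF False] B(2)
      by (intro mult_left_mono mult_right_mono powr_mono2) auto
    finally show ?thesis by (simp add: D_def mult_ac)
  qed
  then show ?thesis by blast
qed

lemma damped_term_tendsto:
  assumes "real_polynomial_function P" "F \<in> I" "\<Delta> x = 0"
  shows "(damped_term P b F j has_derivative (\<lambda>v. 0)) (at x)"
    and "damped_term P b F j \<midarrow>x\<rightarrow> 0"
proof -
  obtain C0 where C0: "\<And>y. y\<in>cball x 1 \<Longrightarrow> norm (damped_term P b F j y) \<le> C0 * (\<Delta> y)\<^sup>2"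
    using damped_term_bound[OF assms(1,2)] by metis
  define C where "C = \<bar>C0\<bar>"
  have C: "norm (damped_term P b F j y) \<le> C * (\<Delta> y)\<^sup>2" if "y\<in>cball x 1" for y
    using order_trans[OF C0[OF that] mult_right_mono[of C0 C]] by (auto simp: C_def)
  obtain \<Delta>' where \<Delta>': "\<And>x. (\<Delta> has_derivative (\<lambda>v. \<Delta>' v x)) (at x)"
    using real_polynomial_function_has_derivative[OF poly_\<Delta>] by metis
  have z: "damped_term P b F j x = 0" using assms(3) by (simp add: damped_term_def)
  have sq: "((\<lambda>y. (\<Delta> y)\<^sup>2) has_derivative (\<lambda>v. 0)) (at x)"
    using has_derivative_power[OF \<Delta>'[of x], of 2] assms(3) by simp
  have lim: "((\<lambda>y. C * ((\<Delta> y)\<^sup>2 / norm (y - x))) \<longlongrightarrow> 0) (at x)"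
    using has_derivative_iff_norm[THEN iffD1, OF sq] assms(3)
    by (intro tendsto_mult_right_zero) (simp add: assms(3))
  have "((\<lambda>y. norm (damped_term P b F j y - damped_term P b F j x - 0) / norm (y - x)) \<longlongrightarrow> 0) (at x)"
  proof (rule Lim_null_comparison[OF _ lim])
    have "\<forall>\<^sub>F y in at x. y \<in> cball x 1"
      using eventually_at_ball[of 1 x UNIV] by (auto elim: eventually_mono)
    then show "\<forall>\<^sub>F y in at x. norm (norm (damped_term P b F j y - damped_term P b F j x - 0) / norm (y - x))
         \<le> C * ((\<Delta> y)\<^sup>2 / norm (y - x))"
      by (rule eventually_mono) (use C z in \<open>auto simp: divide_right_mono\<close>)
  qed
  then show "(damped_term P b F j has_derivative (\<lambda>v. 0)) (at x)"
    unfolding has_derivative_iff_norm by simp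
  from has_derivative_continuous[OF this] show "damped_term P b F j \<midarrow>x\<rightarrow> 0"
    by (simp add: continuous_within z)
qed

text \<open>The smallest class that contains the terms and is stable under differentiation:
  smoothness then follows by induction on the order, without a formula for the higher
  derivatives.\<close>

inductive damped_sum :: "('a \<Rightarrow> complex) \<Rightarrow> bool" where
  damped_termI: "real_polynomial_function P \<Longrightarrow> F \<in> I \<Longrightarrow> damped_sum (damped_term P b F j)"
| damped_addI: "damped_sum f \<Longrightarrow> damped_sum g \<Longrightarrow> damped_sum (\<lambda>x. f x + g x)"

lemma damped_sumI:
  "finite A \<Longrightarrow> A \<noteq> {} \<Longrightarrow> (\<And>i. i \<in> A \<Longrightarrow> damped_sum (f i)) \<Longrightarrow> damped_sum (\<lambda>x. \<Sum>i\<in>A. f i x)"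
  by (induction A rule: finite_ne_induct) (auto intro: damped_addI)

lemma damped_sum_has_derivative:
  "damped_sum f \<Longrightarrow> \<exists>f'. (\<forall>x. (f has_derivative (\<lambda>v. f' v x)) (at x)) \<and> (\<forall>v. damped_sum (f' v))"
proof (induction f rule: damped_sum.induct)
  case (damped_termI P F b j)
  obtain P' where P': "\<And>x. (P has_derivative (\<lambda>v. P' v x)) (at x)"
    "\<And>v. real_polynomial_function (P' v)"
    using real_polynomial_function_has_derivative[OF damped_termI(1)] by metis
  obtain \<Delta>' where \<Delta>': "\<And>x. (\<Delta> has_derivative (\<lambda>v. \<Delta>' v x)) (at x)"
    "\<And>v. real_polynomial_function (\<Delta>' v)"
    using real_polynomial_function_has_derivative[OF poly_\<Delta>] by metis
  \<comment> \<open>One summand for each factor in the product rule. A division by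
    \<open>\<Delta>\<close> is written as multiplication by
    \<open>\<Delta> * \<bar>\<Delta>\<bar>^(-2)\<close>, which explains the extra factor
    \<open>\<Delta>\<close> and the exponents lowered by 2.\<close>
  define f' where "f' v x = damped_term (P' v) b F j x
      + damped_term (\<lambda>x. b * P x * \<Delta> x * \<Delta>' v x) (b - 2) F j x
      + (\<Sum>k\<in>UNIV. damped_term (\<lambda>x. P x * \<Delta> x * a k v x) (b - 2) (nx F k) j x)
      + damped_term (\<lambda>x. - \<alpha> * P x * \<Delta> x * \<Delta>' v x) (b - \<alpha> - 2) F (Suc j) x" for v x
  have sums: "damped_sum (f' v)" for v
    unfolding f'_def[abs_def]
    by (rule damped_addI damped_sumI damped_sum.damped_termI nx_in finite UNIV_not_empty P'(2) \<Delta>'(2)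
        damped_termI poly_\<Delta> poly_a real_polynomial_function.intros(2-))+
  have der: "(damped_term P b F j has_derivative (\<lambda>v. f' v x)) (at x)" for x
  proof (cases "\<Delta> x = 0")
    case True
    then have "f' v x = 0" for v by (simp add: f'_def damped_term_def)
    then show ?thesis using damped_term_tendsto(1)[OF damped_termI True] by simp
  next
    case False
    have dphi: "((\<lambda>y. iter_deriv j \<phi> (\<bar>\<Delta> y\<bar> powr (- \<alpha>))) has_derivative
       (\<lambda>v. (- \<alpha> * (\<bar>\<Delta> x\<bar> powr (- \<alpha> - 2)) * \<Delta> x * \<Delta>' v x) *\<^sub>R iter_deriv (Suc j) \<phi> (\<bar>\<Delta> x\<bar> powr (-\<alpha>)))) (at x)"
      by (rule has_derivative_compose[OF has_derivative_abs_powr[OF \<Delta>'(1) False]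
         smooth_iter_deriv(2)[OF schwartz[unfolded schwartz_def, THEN conjunct1], unfolded has_vector_derivative_def]])
    have powr1: "\<bar>\<Delta> x\<bar> powr b * r / \<Delta> x = \<bar>\<Delta> x\<bar> powr (b - 2) * \<Delta> x * r" for r
    proof -
      have "\<bar>\<Delta> x\<bar> powr b = \<bar>\<Delta> x\<bar> powr (b - 2) * (\<Delta> x)\<^sup>2"
        using powr_add[of "\<bar>\<Delta> x\<bar>" "b - 2" 2] False by simp
      then show ?thesis using False by (simp add: power2_eq_square)
    qed
    have powr2: "\<bar>\<Delta> x\<bar> powr b * \<bar>\<Delta> x\<bar> powr (- \<alpha> - 2) = \<bar>\<Delta> x\<bar> powr (b - \<alpha> - 2)"
      by (simp add: powr_add[symmetric] algebra_simps)
    let ?p = "iter_deriv j \<phi> (\<bar>\<Delta> x\<bar> powr (- \<alpha>))"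
    let ?q = "iter_deriv (Suc j) \<phi> (\<bar>\<Delta> x\<bar> powr (- \<alpha>))"
    have D: "((\<lambda>y. (P y * \<bar>\<Delta> y\<bar> powr b) *\<^sub>R (Th F y * iter_deriv j \<phi> (\<bar>\<Delta> y\<bar> powr (- \<alpha>)))) has_derivative
      (\<lambda>v. (P x * \<bar>\<Delta> x\<bar> powr b) *\<^sub>R
         (Th F x * ((- \<alpha> * (\<bar>\<Delta> x\<bar> powr (- \<alpha> - 2)) * \<Delta> x * \<Delta>' v x) *\<^sub>R ?q)
           + (\<Sum>k\<in>UNIV. (a k v x / \<Delta> x) *\<^sub>R Th (nx F k) x) * ?p)
        + (P x * (b * (\<bar>\<Delta> x\<bar> powr (b - 2)) * \<Delta> x * \<Delta>' v x) + P' v x * \<bar>\<Delta> x\<bar> powr b) *\<^sub>R (Th F x * ?p)))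
      (at x)" (is "(_ has_derivative ?D) _")
      by (rule has_derivative_scaleR[OF has_derivative_mult[OF P'(1) has_derivative_abs_powr[OF \<Delta>'(1) False]]
          has_derivative_mult[OF Th_deriv[OF damped_termI(2) False] dphi]])
    have Deq: "?D v = f' v x" for v
    proof -
      have s: "(\<Sum>k\<in>UNIV. damped_term (\<lambda>x. P x * \<Delta> x * a k v x) (b - 2) (nx F k) j x)
          = (P x * \<bar>\<Delta> x\<bar> powr b) *\<^sub>R ((\<Sum>k\<in>UNIV. (a k v x / \<Delta> x) *\<^sub>R Th (nx F k) x) * ?p)"
        unfolding sum_distrib_right scaleR_sum_right
      proof (rule sum.cong[OF refl])
        fix k
        have "P x * \<Delta> x * a k v x * \<bar>\<Delta> x\<bar> powr (b - 2) = P x * \<bar>\<Delta> x\<bar> powr b * (a k v x / \<Delta> x)"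
          using powr1[of "P x * a k v x"] by (simp add: mult_ac)
        then show "damped_term (\<lambda>x. P x * \<Delta> x * a k v x) (b - 2) (nx F k) j x =
          (P x * \<bar>\<Delta> x\<bar> powr b) *\<^sub>R ((a k v x / \<Delta> x) *\<^sub>R Th (nx F k) x * ?p)"
          using False by (simp add: damped_term_def)
      qed
      have t: "damped_term (\<lambda>x. - \<alpha> * P x * \<Delta> x * \<Delta>' v x) (b - \<alpha> - 2) F (Suc j) x
        = (P x * \<bar>\<Delta> x\<bar> powr b) *\<^sub>R (Th F x * ((- \<alpha> * (\<bar>\<Delta> x\<bar> powr (- \<alpha> - 2)) * \<Delta> x * \<Delta>' v x) *\<^sub>R ?q))"
        using False unfolding damped_term_def powr2[symmetric] by (simp add: mult_ac)
      have r: "damped_term (P' v) b F j x = (P' v x * \<bar>\<Delta> x\<bar> powr b) *\<^sub>R (Th F x * ?p)"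
        "damped_term (\<lambda>x. b * P x * \<Delta> x * \<Delta>' v x) (b - 2) F j x =
          (P x * (b * (\<bar>\<Delta> x\<bar> powr (b - 2)) * \<Delta> x * \<Delta>' v x)) *\<^sub>R (Th F x * ?p)"
        using False by (simp_all add: damped_term_def mult_ac)
      show ?thesis
        unfolding f'_def s t r by (simp only: scaleR_add_right scaleR_add_left add_ac)
    qed
    have op: "open {y. \<Delta> y \<noteq> 0}"
      using has_derivative_continuous[OF \<Delta>'(1)]
      by (intro open_Collect_neq continuous_intros) (auto intro!: continuous_at_imp_continuous_on)
    show ?thesis
      by (rule has_derivative_transform_within_open[OF D[unfolded Deq] op])
        (use False in \<open>simp_all add: damped_term_def\<close>)
  qed
  show ?case using der sums by blast
next
  case (damped_addI f g)
  then obtain f' g' where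
    f': "\<And>x. (f has_derivative (\<lambda>v. f' v x)) (at x)" "\<And>v. damped_sum (f' v)" and
    g': "\<And>x. (g has_derivative (\<lambda>v. g' v x)) (at x)" "\<And>v. damped_sum (g' v)"
    by metis
  show ?case
    by (intro exI[of _ "\<lambda>v x. f' v x + g' v x"] conjI allI has_derivative_add f' g'
        damped_sum.damped_addI)
qed

lemma damped_sum_smooth: "damped_sum f \<Longrightarrow> smooth_on UNIV f"
proof -
  have "damped_sum f \<Longrightarrow> Ck_on k UNIV f" for k f
  proof (induction k arbitrary: f)
    case 0
    then show ?case
      using damped_sum_has_derivative[OF 0]
      by (auto intro!: continuous_at_imp_continuous_on dest: has_derivative_continuous)
  next
    case (Suc k)
    obtain f' where f': "\<And>x. (f has_derivative (\<lambda>v. f' v x)) (at x)" "\<And>v. damped_sum (f' v)"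
      using damped_sum_has_derivative[OF Suc.prems] by metis
    show ?case by (rule Ck_on_SucI[OF open_UNIV f'(1) Suc.IH[OF f'(2)]])
  qed
  then show "damped_sum f \<Longrightarrow> smooth_on UNIV f" by (simp add: smooth_on_def)
qed

end

section \<open>Real matrices as complex matrices\<close>

abbreviation cmat :: "real^'n^'m \<Rightarrow> complex^'n^'m" where
  "cmat \<equiv> map_matrix complex_of_real"

definition diagm :: "('n::finite \<Rightarrow> 'a::zero) \<Rightarrow> 'a^'n^'n" where
  "diagm d = (\<chi> i j. if i = j then d i else 0)"

lemma cmat_mult: "cmat (A ** B) = cmat A ** cmat B"
  by (simp add: vec_eq_iff matrix_matrix_mult_def)

lemma cmat_one: "cmat (mat 1) = mat 1"
  by (simp add: vec_eq_iff mat_def)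

lemma cmat_inject: "cmat A = cmat B \<longleftrightarrow> A = B"
  by (auto simp: vec_eq_iff)

lemma det_cmat: "det (cmat (A :: real^'n^'n)) = complex_of_real (det A)"
  by (simp add: det_def)

lemma norm_cmat: "norm (cmat A) = norm A"
  by (simp add: norm_vec_def L2_set_def)

lemma invertible_cmat: "invertible (cmat (A :: real^'n^'n)) \<longleftrightarrow> invertible A"
  by (simp add: invertible_det_nz det_cmat)

lemma mult_diagm_nth: "(P ** diagm d) $ r $ i = P $ r $ i * (d i :: 'a::semiring_1)"
  by (simp add: matrix_matrix_mult_def diagm_def if_distrib cong: if_cong)

lemma diagm_mult_nth: "(diagm d ** P) $ i $ r = (d i :: 'a::semiring_1) * P $ i $ r"
  by (simp add: matrix_matrix_mult_def diagm_def if_distrib if_distribR cong: if_cong)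

lemma diagm_mult: "diagm c ** diagm d = diagm (\<lambda>i. c i * d i :: 'a::semiring_1)"
  by (simp add: vec_eq_iff mult_diagm_nth) (simp add: diagm_def)

lemma det_diagm: "det (diagm d) = prod d UNIV"
  by (subst det_diagonal) (auto simp: diagm_def)

lemma matrix_inv_eq:
  fixes A :: "'a::field^'n^'n"
  assumes "invertible A"
  shows "A ** matrix_inv A = mat 1" "matrix_inv A ** A = mat 1"
  using assms unfolding invertible_def matrix_inv_def by (metis (mono_tags, lifting) someI_ex)+

lemma matrix_inv_unique:
  fixes A :: "'a::field^'n^'n"
  assumes "A ** B = mat 1"
  shows "invertible A" "matrix_inv A = B" "invertible B" "matrix_inv B = A"
proof -
  have *: "B ** A = mat 1" using assms matrix_left_right_inverse by blast
  show i: "invertible A" "invertible B" using assms * by (auto simp: invertible_def)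
  show "matrix_inv A = B"
    using matrix_inv_eq(2)[OF i(1)] assms
    by (metis matrix_mul_assoc matrix_mul_lid matrix_mul_rid)
  show "matrix_inv B = A"
    using matrix_inv_eq(2)[OF i(2)] *
    by (metis matrix_mul_assoc matrix_mul_lid matrix_mul_rid)
qed

lemma matrix_mult_right_cancel:
  fixes A B P :: "'a::field^'n^'n"
  assumes "invertible P" "A ** P = B ** P"
  shows "A = B"
  using assms by (metis matrix_inv_eq(1) matrix_mul_assoc matrix_mul_rid)

lemma matrix_mult_left_cancel:
  fixes A B P :: "'a::field^'n^'n"
  assumes "invertible P" "P ** A = P ** B"
  shows "A = B"
  using assms by (metis matrix_inv_eq(2) matrix_mul_assoc matrix_mul_lid)

lemma bounded_bilinear_matrix_mult:
  "bounded_bilinear ((**) :: 'a::{euclidean_space,real_normed_field}^'n^'m \<Rightarrow> 'a^'k^'n \<Rightarrow> 'a^'k^'m)"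
  unfolding bilinear_conv_bounded_bilinear[symmetric] bilinear_def
  by (auto intro!: linearI simp: vec_eq_iff matrix_matrix_mult_def sum.distrib
      distrib_left distrib_right scaleR_sum_right)

lemma bounded_bilinear_matrix_vector_mult:
  "bounded_bilinear ((*v) :: 'a::{euclidean_space,real_normed_field}^'n^'m \<Rightarrow> 'a^'n \<Rightarrow> 'a^'m)"
  unfolding bilinear_conv_bounded_bilinear[symmetric] bilinear_def
  by (auto intro!: linearI simp: vec_eq_iff matrix_vector_mult_def sum.distrib
      distrib_left distrib_right scaleR_sum_right)

lemma norm_vec_le_sum: "norm x \<le> (\<Sum>i\<in>UNIV. norm (x $ i))"
  by (simp add: norm_vec_def L2_set_le_sum)

text \<open>A basis of eigenvectors of a real matrix is indexed so that complex conjugation acts on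
  it through an involution \<open>\<sigma>\<close> of the indices. Such bases detect real matrices.\<close>

definition conj_sym :: "('n \<Rightarrow> 'n) \<Rightarrow> complex^'n^'m \<Rightarrow> bool" where
  "conj_sym \<sigma> P \<longleftrightarrow> (\<forall>r i. cnj (P $ r $ i) = P $ r $ \<sigma> i)"

text \<open>Let \<open>M\<close> carry \<open>P\<close> to \<open>P'\<close>. Its entrywise
  conjugate does the same, because conjugation permutes the columns of both matrices alike; hence
  \<open>M\<close> is real.\<close>

lemma conj_sym_real_matrix:
  assumes "conj_sym \<sigma> P" "conj_sym \<sigma> P'" "invertible P"
  obtains B :: "real^'n^'n" where "cmat B ** P = (P' :: complex^'n^'n)"
proof -
  define M where "M = P' ** matrix_inv P"
  define N where "N = (\<chi> i j. cnj (M $ i $ j))"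
  have M: "M ** P = P'"
    by (simp add: M_def matrix_mul_assoc[symmetric] matrix_inv_eq assms)
  \<comment> \<open>\<open>\<sigma>\<close> is not assumed to be an involution; conjugating twice
    shows that it acts as one on the columns.\<close>
  have ss: "R $ r $ \<sigma> (\<sigma> i) = R $ r $ i" if "conj_sym \<sigma> R" for R :: "complex^'n^'n" and r i
    using that unfolding conj_sym_def by (metis complex_cnj_cnj)
  have "(N ** P) $ r $ i = P' $ r $ i" for r i
  proof -
    have "(N ** P) $ r $ i = (\<Sum>k\<in>UNIV. cnj (M $ r $ k * P $ k $ \<sigma> i))"
    proof -
      have "P $ k $ i = cnj (P $ k $ \<sigma> i)" for k
        using assms(1) ss[OF assms(1)] unfolding conj_sym_def by simp
      then show ?thesis by (simp add: matrix_matrix_mult_def N_def)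
    qed
    also have "\<dots> = cnj ((M ** P) $ r $ \<sigma> i)" by (simp add: matrix_matrix_mult_def)
    also have "\<dots> = P' $ r $ i"
      using assms(2) ss[OF assms(2)] unfolding M conj_sym_def by simp
    finally show ?thesis .
  qed
  then have "N ** P = M ** P" by (simp add: vec_eq_iff M)
  then have "N = M" by (rule matrix_mult_right_cancel[OF assms(3)])
  then have "cnj (M $ i $ j) = M $ i $ j" for i j
    by (auto simp: N_def vec_eq_iff)
  then have "cmat (\<chi> i j. Re (M $ i $ j)) = M"
    by (simp add: vec_eq_iff complex_eq_iff)
  then show ?thesis using M by (intro that[of "\<chi> i j. Re (M $ i $ j)"]) simp
qed

section \<open>Eigenvector bases\<close>

text \<open>For \<open>J = -{i}\<close> only the \<open>i\<close>-th eigenvector survives on the left, so that single coefficients of a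
  combination of eigenvectors are bounded.\<close>

lemma eigenvector_combination_bound:
  fixes A :: "complex^'n^'n" and w :: "'k::finite \<Rightarrow> complex^'n"
  assumes "finite J" "\<And>l. A *v w l = \<xi> l *s w l"
    and K: "\<And>j v. j \<in> J \<Longrightarrow> norm (A *v v - \<xi> j *s v) \<le> K * norm v"
  shows "norm (\<Sum>l\<in>UNIV. (a l * (\<Prod>j\<in>J. \<xi> l - \<xi> j)) *s w l)
    \<le> K ^ card J * norm (\<Sum>l\<in>UNIV. a l *s w l)"
  using assms(1) K
proof (induction J rule: finite_induct)
  case (insert j J)
  have K0: "K \<ge> 0"
  proof -
    define u where "u = ((\<chi> i. 1) :: complex^'n)"
    have "u \<noteq> 0" by (simp add: u_def vec_eq_iff)
    moreover have "0 \<le> K * norm u"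
      by (rule order_trans[OF norm_ge_zero insert.prems[of j u]]) simp
    ultimately show ?thesis by (simp add: zero_le_mult_iff)
  qed
  define v where "v = (\<Sum>l\<in>UNIV. (a l * (\<Prod>j\<in>J. \<xi> l - \<xi> j)) *s w l)"
  \<comment> \<open>\<open>A - \<xi> j\<close> scales the \<open>l\<close>-th eigenvector by
    \<open>\<xi> l - \<xi> j\<close>, so the operators for \<open>j \<in> J\<close> build up the
    product one factor at a time.\<close>
  have "A *v v - \<xi> j *s v = (\<Sum>l\<in>UNIV. (a l * (\<Prod>j\<in>insert j J. \<xi> l - \<xi> j)) *s w l)"
  proof -
    have "A *v v = (\<Sum>l\<in>UNIV. (a l * (\<Prod>j\<in>J. \<xi> l - \<xi> j)) *s (\<xi> l *s w l))"
      unfolding v_def bounded_bilinear.sum_right[OF bounded_bilinear_matrix_vector_mult]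
        vector_scalar_commute assms(2) ..
    then have "A *v v - \<xi> j *s v = (\<Sum>l\<in>UNIV. (a l * (\<Prod>j\<in>J. \<xi> l - \<xi> j)) *s (\<xi> l *s w l)
        - \<xi> j *s ((a l * (\<Prod>j\<in>J. \<xi> l - \<xi> j)) *s w l))"
      unfolding v_def vec.scale_sum_right by (simp only: sum_subtractf)
    also have "\<dots> = (\<Sum>l\<in>UNIV. (a l * (\<Prod>j\<in>insert j J. \<xi> l - \<xi> j)) *s w l)"
      by (rule sum.cong[OF refl]) (simp add: vec_eq_iff insert.hyps algebra_simps)
    finally show ?thesis .
  qed
  then have "norm (\<Sum>l\<in>UNIV. (a l * (\<Prod>j\<in>insert j J. \<xi> l - \<xi> j)) *s w l) \<le> K * norm v"
    using insert.prems[of j v] by simp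
  also have "\<dots> \<le> K * (K ^ card J * norm (\<Sum>l\<in>UNIV. a l *s w l))"
    unfolding v_def using insert K0 by (intro mult_left_mono) auto
  finally show ?case using insert.hyps by simp
qed simp

lemma eigenvector_exists:
  fixes A :: "'a::field^'n^'n"
  assumes "det (mat z - A) = 0"
  shows "\<exists>v. v \<noteq> 0 \<and> A *v v = z *s v"
proof -
  have "\<not> invertible (mat z - A)" using assms by (simp add: invertible_det_nz)
  then obtain v where "(mat z - A) *v v = 0" "v \<noteq> 0"
    unfolding invertible_left_inverse matrix_left_invertible_ker by blast
  moreover have "mat z *v v = z *s v"
    by (simp add: vec_eq_iff matrix_vector_mult_def mat_def if_distrib if_distribR cong: if_cong)
  ultimately show ?thesis by (auto simp: matrix_vector_mult_diff_rdistrib)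
qed

lemma matrix_vector_sub_bound:
  fixes A :: "complex^'n^'n"
  shows "\<exists>K. \<forall>v. norm (A *v v - z *s v) \<le> K * norm v"
proof -
  have "bounded_linear (\<lambda>v. A *v v - z *s v)"
    by (intro bounded_linear_sub bounded_bilinear.bounded_linear_right[OF bounded_bilinear_matrix_vector_mult]
        linear_conv_bounded_linear[THEN iffD1]) (auto intro!: linearI simp: vec_eq_iff algebra_simps)
  from bounded_linear.bounded[OF this] show ?thesis by (simp add: mult.commute)
qed

text \<open>For a vanishing combination the previous bound with \<open>J = -{i}\<close> leaves only
  the \<open>i\<close>-th term, and there the coefficient is multiplied by a nonzero product of
  differences.\<close>

lemma eigenvectors_invertible:
  fixes A :: "complex^'n^'n" and \<xi> :: "'n \<Rightarrow> complex"
  assumes "inj \<xi>" "\<And>l. A *v w l = \<xi> l *s w l" "\<And>l. w l \<noteq> 0"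
  shows "invertible (\<chi> r i. w i $ r)"
proof -
  have "a = 0" if a: "(\<chi> r i. w i $ r) *v a = 0" for a :: "complex^'n"
  proof -
    have s: "(\<Sum>l\<in>UNIV. a $ l *s w l) = 0"
      using a by (simp add: vec_eq_iff matrix_vector_mult_def mult.commute)
    have "a $ i = 0" for i
    proof -
      have "\<forall>j. \<exists>K. \<forall>v. norm (A *v v - \<xi> j *s v) \<le> K * norm v"
        using matrix_vector_sub_bound by blast
      from choice[OF this] obtain K where K: "\<And>j v. norm (A *v v - \<xi> j *s v) \<le> K j * norm v"
        by blast
      have K': "norm (A *v v - \<xi> j *s v) \<le> (\<Sum>j\<in>UNIV. \<bar>K j\<bar>) * norm v" for j v
      proof -
        have "K j \<le> (\<Sum>j\<in>UNIV. \<bar>K j\<bar>)"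
          using member_le_sum[of j UNIV "\<lambda>j. \<bar>K j\<bar>"] by simp
        then show ?thesis using K[where j=j and v=v] mult_right_mono[OF _ norm_ge_zero] order_trans by blast
      qed
      have "norm (\<Sum>l\<in>UNIV. (a $ l * (\<Prod>j\<in>-{i}. \<xi> l - \<xi> j)) *s w l) \<le> 0"
        using eigenvector_combination_bound[where J="-{i}" and \<xi>=\<xi> and w=w and a="\<lambda>l. a $ l", OF finite assms(2) K'] s by simp
      moreover have "(\<Sum>l\<in>UNIV. (a $ l * (\<Prod>j\<in>-{i}. \<xi> l - \<xi> j)) *s w l)
          = (a $ i * (\<Prod>j\<in>-{i}. \<xi> i - \<xi> j)) *s w i"
      proof (rule trans[OF sum.mono_neutral_right[of UNIV "{i}"]])
        show "\<forall>l\<in>UNIV - {i}. (a $ l * (\<Prod>j\<in>-{i}. \<xi> l - \<xi> j)) *s w l = 0"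
        proof
          fix l assume "l \<in> UNIV - {i}"
          then have "(\<Prod>j\<in>-{i}. \<xi> l - \<xi> j) = 0" by (intro prod_zero) auto
          then show "(a $ l * (\<Prod>j\<in>-{i}. \<xi> l - \<xi> j)) *s w l = 0" by simp
        qed
      qed auto
      ultimately have "a $ i * (\<Prod>j\<in>-{i}. \<xi> i - \<xi> j) = 0"
        using assms(3) by simp
      moreover have "(\<Prod>j\<in>-{i}. \<xi> i - \<xi> j) \<noteq> 0"
        using assms(1) by (auto simp: inj_eq)
      ultimately show ?thesis by simp
    qed
    then show ?thesis by (simp add: vec_eq_iff)
  qed
  then show ?thesis unfolding invertible_left_inverse matrix_left_invertible_ker by blast
qed

lemma mult_diagm_column:
  "A ** P = P ** diagm d \<longleftrightarrow> (\<forall>i. A *v column i P = d i *s column i (P :: 'a::field^'n^'n))"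
  by (simp add: vec_eq_iff mult_diagm_nth matrix_matrix_mult_def[of A] matrix_vector_mult_def column_def
      mult.commute) metis

section \<open>The spectrum of a real matrix\<close>

text \<open>Indexing the eigenvalues by the coordinates themselves lets \<open>\<xi>\<close> serve
  as a diagonal matrix, and turns regularity of an invertible matrix into injectivity of
  \<open>\<xi>\<close>.\<close>

definition spectrum :: "real^'n^'n \<Rightarrow> ('n \<Rightarrow> complex) \<Rightarrow> bool" where
  "spectrum A \<xi> \<longleftrightarrow> map_poly complex_of_real (charpoly A) = (\<Prod>i\<in>UNIV. [:- \<xi> i, 1:])"

lemma poly_charpoly: "poly (charpoly A) z = det (mat z - A)"
  by (simp add: charpoly_def det_def poly_sum poly_prod mat_def of_int_poly if_distrib
      cong: if_cong) (intro sum.cong refl arg_cong2[where f="(*)"] prod.cong; simp add: sign_def)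

lemma poly_map_of_real: "poly (map_poly complex_of_real p) (of_real r) = of_real (poly p r)"
  by (induction p) (simp_all add: map_poly_pCons)

lemma poly_eq_on_reals:
  fixes p q :: "complex poly"
  assumes "\<And>r::real. poly p (of_real r) = poly q (of_real r)"
  shows "p = q"
proof (rule ccontr)
  assume "p \<noteq> q"
  then have "finite {z. poly (p - q) z = 0}" by (intro poly_roots_finite) simp
  moreover have "range complex_of_real \<subseteq> {z. poly (p - q) z = 0}" using assms by auto
  ultimately have "finite (range complex_of_real)" by (rule finite_subset[rotated])
  then show False
    using finite_imageD[of complex_of_real UNIV] infinite_UNIV_char_0[where 'a=real]
    by (auto simp: inj_on_def)
qed

lemma map_charpoly: "map_poly complex_of_real (charpoly A) = charpoly (cmat A)"
proof (rule poly_eq_on_reals)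
  fix r :: real
  have "mat (of_real r) - cmat A = cmat (mat r - A)"
    by (simp add: vec_eq_iff mat_def)
  then show "poly (map_poly complex_of_real (charpoly A)) (of_real r) = poly (charpoly (cmat A)) (of_real r)"
    by (simp add: poly_map_of_real poly_charpoly det_cmat)
qed

lemma spectrum_det: "spectrum A \<xi> \<Longrightarrow> det (mat z - cmat A) = (\<Prod>i\<in>UNIV. z - \<xi> i)"
  unfolding spectrum_def map_charpoly using poly_charpoly[of "cmat A" z]
  by (simp add: poly_prod)

lemma charpoly_cong_spectrum:
  "charpoly A = charpoly B \<Longrightarrow> spectrum A \<xi> \<longleftrightarrow> spectrum B \<xi>"
  by (simp add: spectrum_def)

lemma spectrum_charpoly_eq:
  assumes "spectrum A \<xi>" "map_poly complex_of_real p = (\<Prod>i\<in>UNIV. [:- \<xi> i, 1:])"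
  shows "charpoly A = p"
proof -
  have "map_poly complex_of_real (charpoly A) = map_poly complex_of_real p"
    using assms by (simp add: spectrum_def)
  then have "coeff (map_poly complex_of_real (charpoly A)) i = coeff (map_poly complex_of_real p) i" for i
    by simp
  then show ?thesis by (simp add: coeff_map_poly poly_eq_iff)
qed

lemma diagonalized_spectrum:
  assumes "invertible P" "cmat A ** P = P ** diagm \<xi>"
  shows "spectrum A \<xi>"
  unfolding spectrum_def map_charpoly
proof (rule poly_eq_on_reals)
  fix r :: real
  let ?z = "complex_of_real r"
  have "(mat ?z - cmat A) ** P = P ** diagm (\<lambda>i. ?z - \<xi> i)"
  proof -
    have "mat ?z ** P = P ** diagm (\<lambda>i. ?z)"
      by (simp add: vec_eq_iff mult_diagm_nth)
         (simp add: matrix_matrix_mult_def mat_def if_distrib if_distribR mult.commute cong: if_cong)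
    then have "(mat ?z - cmat A) ** P = P ** diagm (\<lambda>i. ?z) - P ** diagm \<xi>"
      by (simp add: assms(2) bounded_bilinear.diff_left[OF bounded_bilinear_matrix_mult])
    then show ?thesis by (simp add: vec_eq_iff mult_diagm_nth algebra_simps)
  qed
  then have "det (mat ?z - cmat A) * det P = det P * (\<Prod>i\<in>UNIV. ?z - \<xi> i)"
    by (metis det_mul det_diagm)
  then have "det (mat ?z - cmat A) = (\<Prod>i\<in>UNIV. ?z - \<xi> i)"
    using assms(1) by (simp add: invertible_det_nz)
  then show "poly (charpoly (cmat A)) ?z = poly (\<Prod>i\<in>UNIV. [:- \<xi> i, 1:]) ?z"
    by (simp add: poly_charpoly poly_prod)
qed

text \<open>The coefficients are real, so conjugation preserves the roots. For injective
  \<open>\<xi>\<close> the map \<open>\<sigma>\<close> is forced to be the induced involution of the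
  indices.\<close>

lemma spectrum_conj_index:
  assumes "spectrum A \<xi>"
  shows "\<exists>\<sigma>. \<forall>i. cnj (\<xi> i) = \<xi> (\<sigma> i)"
proof -
  have "\<exists>j. cnj (\<xi> i) = \<xi> j" for i
  proof -
    have "map_poly cnj (map_poly complex_of_real (charpoly A)) = map_poly complex_of_real (charpoly A)"
      by (simp add: map_poly_map_poly o_def)
    then have "poly (map_poly complex_of_real (charpoly A)) (cnj (\<xi> i))
        = cnj (poly (map_poly complex_of_real (charpoly A)) (\<xi> i))"
      by (metis poly_cnj)
    also have "poly (map_poly complex_of_real (charpoly A)) (\<xi> i) = 0"
      using assms unfolding spectrum_def by (auto simp: poly_prod)
    finally show ?thesis
      using assms unfolding spectrum_def by (auto simp: poly_prod)
  qed
  then show ?thesis by metis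
qed

text \<open>Arbitrary eigenvectors need not be permuted by conjugation. A real eigenvalue gets a
  real eigenvector, one in the upper half plane any eigenvector, and one in the lower half plane the
  conjugate of the vector chosen for its mirror image.\<close>

lemma eigenbasis_exists:
  assumes "spectrum A \<xi>" "inj \<xi>" "\<And>i. cnj (\<xi> i) = \<xi> (\<sigma> i)"
  obtains P where "invertible P" "conj_sym \<sigma> P" "cmat A ** P = P ** diagm \<xi>"
proof -
  define ev where "ev z = (SOME v. v \<noteq> 0 \<and> cmat A *v v = z *s v)" for z
  define rv where "rv r = (SOME v. v \<noteq> 0 \<and> A *v v = r *s v)" for r
  define w where "w z = (if Im z = 0 then (\<chi> k. complex_of_real (rv (Re z) $ k))
      else if Im z > 0 then ev z else (\<chi> k. cnj (ev (cnj z) $ k)))" for z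
  have root: "det (mat (\<xi> i) - cmat A) = 0" for i
    by (simp add: spectrum_det[OF assms(1)]) auto
  have ev: "ev (\<xi> i) \<noteq> 0 \<and> cmat A *v ev (\<xi> i) = \<xi> i *s ev (\<xi> i)" for i
    unfolding ev_def by (rule someI_ex[OF eigenvector_exists[OF root]])
  have w: "w (\<xi> i) \<noteq> 0 \<and> cmat A *v w (\<xi> i) = \<xi> i *s w (\<xi> i)" for i
  proof -
    consider "Im (\<xi> i) = 0" | "Im (\<xi> i) > 0" | "Im (\<xi> i) < 0" by linarith
    then show ?thesis
    proof cases
      case 1
      then have l: "\<xi> i = of_real (Re (\<xi> i))" by (simp add: complex_eq_iff)
      have "mat (\<xi> i) - cmat A = cmat (mat (Re (\<xi> i)) - A)"
        by (subst l) (simp add: vec_eq_iff mat_def)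
      with root[of i] have "det (mat (Re (\<xi> i)) - A) = 0" by (simp add: det_cmat)
      then have rv: "rv (Re (\<xi> i)) \<noteq> 0 \<and> A *v rv (Re (\<xi> i)) = Re (\<xi> i) *s rv (Re (\<xi> i))"
        unfolding rv_def by (intro someI_ex[OF eigenvector_exists])
      have "cmat A *v w (\<xi> i) = (\<chi> k. complex_of_real ((A *v rv (Re (\<xi> i))) $ k))"
        using 1 by (simp add: w_def vec_eq_iff matrix_vector_mult_def)
      also have "\<dots> = \<xi> i *s w (\<xi> i)"
        using 1 rv by (subst l) (simp add: w_def vec_eq_iff)
      finally show ?thesis using 1 rv by (auto simp: w_def vec_eq_iff)
    next
      case 2
      then show ?thesis using ev[of i] by (simp add: w_def)
    next
      case 3
      let ?u = "ev (\<xi> (\<sigma> i))"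
      have u: "w (\<xi> i) = (\<chi> k. cnj (?u $ k))"
        using 3 by (simp add: w_def assms(3))
      have "cmat A *v w (\<xi> i) = (\<chi> k. cnj ((cmat A *v ?u) $ k))"
        by (simp add: u vec_eq_iff matrix_vector_mult_def)
      also have "\<dots> = \<xi> i *s w (\<xi> i)"
        using ev[of "\<sigma> i"] assms(3)[of i, symmetric] by (simp add: u vec_eq_iff)
      finally show ?thesis using ev[of "\<sigma> i"] by (auto simp: u vec_eq_iff)
    qed
  qed
  define P where "P = (\<chi> r i. w (\<xi> i) $ r)"
  have "invertible P" unfolding P_def by (rule eigenvectors_invertible[OF assms(2)]) (use w in auto)
  moreover have "conj_sym \<sigma> P"
    unfolding conj_sym_def P_def by (simp add: w_def assms(3)[symmetric])
  moreover have "column i P = w (\<xi> i)" for i by (simp add: P_def column_def vec_eq_iff)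
  then have "cmat A ** P = P ** diagm \<xi>" using w by (simp add: mult_diagm_column)
  ultimately show ?thesis using that by blast
qed

text \<open>The matrix carrying one basis to the other is real because both obey the same symmetry;
  it is the conjugating element. This is why tori can be sorted by \<open>\<sigma>\<close>.\<close>

lemma eigenbasis_same_involution_conjugate:
  fixes P P' :: "complex^'n^'n"
  assumes "invertible P" "conj_sym \<sigma> P" "invertible P'" "conj_sym \<sigma> P'"
    and "cmat A ** P' = P' ** diagm \<xi>"
  obtains y where "y \<in> GL" "cmat (conjugate y A) ** P = P ** diagm \<xi>"
proof -
  obtain y where y: "cmat y ** P = P'" using conj_sym_real_matrix[OF assms(2,4,1)] by blast
  have "det (cmat y) \<noteq> 0" using y assms(3) by (metis det_mul invertible_det_nz mult_eq_0_iff)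
  then have iy: "invertible y" by (simp add: det_cmat invertible_det_nz)
  have "cmat y ** (cmat (conjugate y A) ** P) = cmat A ** (cmat y ** P)"
    unfolding conjugate_def matrix_mul_assoc cmat_mult[symmetric] by (simp add: matrix_inv_eq[OF iy])
  also have "\<dots> = cmat y ** (P ** diagm \<xi>)" by (simp add: y assms(5) matrix_mul_assoc)
  finally have "cmat (conjugate y A) ** P = P ** diagm \<xi>"
    using matrix_mult_left_cancel iy invertible_cmat by blast
  then show ?thesis using that iy by (simp add: GL_def)
qed

text \<open>The product runs over ordered pairs, so it is the discriminant up to a sign depending on
  \<open>n\<close>. In this form it is the product of the values \<open>q'(\<xi> i)\<close>.\<close>

definition vdisc :: "('n::finite \<Rightarrow> complex) \<Rightarrow> complex" where
  "vdisc \<xi> = (\<Prod>i\<in>UNIV. \<Prod>j\<in>-{i}. \<xi> i - \<xi> j)"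

lemma vdisc_eq_0_iff: "vdisc \<xi> = 0 \<longleftrightarrow> \<not> inj \<xi>"
  by (auto simp: vdisc_def inj_def)

lemma conj_sym_cmat_mult: "conj_sym \<sigma> P \<Longrightarrow> conj_sym \<sigma> (cmat h ** P)"
  by (simp add: conj_sym_def matrix_matrix_mult_def)

lemma matrix_vector_mult_axis:
  fixes A :: "'a::comm_semiring_1^'n^'m"
  shows "A *v axis i 1 = column i A"
  by (simp add: vec_eq_iff matrix_vector_mult_def column_def axis_def if_distrib cong: if_cong)

lemma norm_axis_complex: "norm (axis r 1 :: complex^'n) = 1"
proof -
  have "(\<Sum>i\<in>UNIV. (norm ((axis r 1 :: complex^'n) $ i))\<^sup>2) = (\<Sum>i\<in>UNIV. if i = r then 1 else 0)"
    by (rule sum.cong) (auto simp: axis_def)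
  then show ?thesis by (simp add: norm_vec_def L2_set_def)
qed

lemma norm_smult_complex: "norm (c *s v) = norm c * norm (v :: complex^'n)"
  by (simp add: norm_vec_def norm_mult L2_set_right_distrib)

lemma column_ne_0:
  fixes W :: "'a::field^'n^'n"
  assumes "invertible W"
  shows "column i W \<noteq> 0"
proof
  assume "column i W = 0"
  then have "W *v axis i 1 = 0" by (simp add: matrix_vector_mult_axis)
  then have "matrix_inv W *v (W *v axis i 1) = 0" by simp
  then show False
    by (simp add: matrix_vector_mul_assoc matrix_inv_eq[OF assms] axis_eq_0_iff)
qed

lemma norm_matrix_le:
  fixes M :: "complex^'n^'n"
  assumes "\<And>i j. norm (M $ i $ j) \<le> c"
  shows "norm M \<le> real CARD('n) * real CARD('n) * c"
proof -
  have "norm (M $ i) \<le> real CARD('n) * c" for i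
    using order_trans[OF norm_vec_le_sum[of "M $ i"] sum_bounded_above[of UNIV "\<lambda>j. norm (M $ i $ j)" c]] assms
    by simp
  then have "norm M \<le> real CARD('n) * (real CARD('n) * c)"
    using order_trans[OF norm_vec_le_sum[of M] sum_bounded_above[of UNIV "\<lambda>i. norm (M $ i)"]] by simp
  then show ?thesis by (simp add: mult.assoc)
qed

text \<open>Every matrix conjugating a torus element into a bounded set lies in the torus times a bounded
  set, with bounds polynomial in the inverse discriminant: rescale the eigenbasis carried by \<open>g\<close> to
  unit vectors.\<close>

lemma conjugating_matrix_mod_torus:
  fixes P :: "complex^'n^'n" and R :: real
  assumes P: "invertible P" "conj_sym \<sigma> P"
  shows "\<exists>C>0. \<forall>\<xi> B g. inj \<xi> \<longrightarrow> cmat B ** P = P ** diagm \<xi> \<longrightarrow> g \<in> GL \<longrightarrow>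
      norm (conjugate g B) \<le> R \<longrightarrow>
      (\<exists>t\<in>GL. \<exists>d. cmat t ** P = P ** diagm d \<and> norm (t ** g) \<le> C / norm (vdisc \<xi>) \<and>
         norm (matrix_inv (t ** g)) \<le> C)"
proof -
  have "\<exists>K>0. \<forall>(A :: complex^'n^'n) (B :: complex^'n^'n). norm (A ** B) \<le> norm A * norm B * K"
    by (rule bounded_bilinear.pos_bounded[OF bounded_bilinear_matrix_mult])
  then obtain Km where Km: "Km > 0" "\<And>(A :: complex^'n^'n) (B :: complex^'n^'n). norm (A ** B) \<le> norm A * norm B * Km"
    by auto
  have "\<exists>K>0. \<forall>(A :: complex^'n^'n) v. norm (A *v v) \<le> norm A * norm v * K"
    by (rule bounded_bilinear.pos_bounded[OF bounded_bilinear_matrix_vector_mult])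
  then obtain Kv where Kv: "Kv > 0" "\<And>(A :: complex^'n^'n) v. norm (A *v v) \<le> norm A * norm v * Kv"
    by auto
  define n where "n = CARD('n)"
  \<comment> \<open>Both \<open>A\<close> and its eigenvalues are bounded by
    \<open>Kv * \<bar>R\<bar>\<close>, so \<open>K\<close> bounds every \<open>A - \<xi> j\<close>;
    the added 1 makes powers of \<open>K\<close> increasing. In \<open>L\<close> the factor
    \<open>K ^ n\<close> comes from applying these operators, the other from the remaining factors
    of the discriminant.\<close>
  define K where "K = 2 * Kv * \<bar>R\<bar> + 1"
  have K1: "K \<ge> 1" using Kv(1) by (simp add: K_def)
  define L where "L = K ^ n * K ^ (n * n)"
  have L: "L > 0" using K1 by (simp add: L_def)
  define C where "C = max 1 (max (real n * real n * norm (matrix_inv P) * Km)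
    (norm P * (real n * real n * L) * Km))"
  have "\<exists>t\<in>GL. \<exists>d. cmat t ** P = P ** diagm d \<and> norm (t ** g) \<le> C / norm (vdisc \<xi>) \<and>
         norm (matrix_inv (t ** g)) \<le> C"
    if inj: "inj \<xi>" and BP: "cmat B ** P = P ** diagm \<xi>" and g: "g \<in> GL"
      and bd: "norm (conjugate g B) \<le> R" for \<xi> B and g :: "real^'n^'n"
  proof -
    have ig: "invertible g" using g by (simp add: GL_def)
    define A where "A = conjugate g B"
    define W where "W = cmat (matrix_inv g) ** P"
    have iW: "invertible W" unfolding W_def
      using P(1) invertible_mult invertible_cmat matrix_inv_unique(3)[OF matrix_inv_eq(1)[OF ig]] by blast
    have AW: "cmat A ** W = W ** diagm \<xi>"
    proof -
      have "A ** matrix_inv g = matrix_inv g ** B"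
        by (simp add: A_def conjugate_def matrix_mul_assoc[symmetric] matrix_inv_eq[OF ig])
      then have "cmat A ** cmat (matrix_inv g) = cmat (matrix_inv g) ** cmat B"
        by (metis cmat_mult)
      then show ?thesis unfolding W_def by (metis BP matrix_mul_assoc)
    qed
    have sW: "conj_sym \<sigma> W" unfolding W_def by (rule conj_sym_cmat_mult[OF P(2)])
    \<comment> \<open>The eigenvectors of \<open>A\<close> carried by \<open>g\<close> are
      normalised by their lengths. Conjugate eigenvectors have equal length, so the normalisation
      respects \<open>\<sigma>\<close> and is induced by a real matrix \<open>B'\<close>; its
      inverse is the torus element \<open>t\<close>.\<close>
    define m where "m i = norm (column i W)" for i
    have m: "m i > 0" for i using column_ne_0[OF iW] by (simp add: m_def)
    have ms: "m (\<sigma> i) = m i" for i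
    proof -
      have "norm (column (\<sigma> i) W $ r) = norm (column i W $ r)" for r
      proof -
        have "column (\<sigma> i) W $ r = cnj (column i W $ r)"
          using sW by (simp add: conj_sym_def column_def)
        then show ?thesis by simp
      qed
      then show ?thesis unfolding m_def norm_vec_def by simp
    qed
    define E where "E = diagm (\<lambda>i. complex_of_real (1 / m i))"
    define E' where "E' = diagm (\<lambda>i. complex_of_real (m i))"
    have EE: "E ** E' = mat 1" "E' ** E = mat 1"
    proof -
      have "diagm (\<lambda>i. 1) = (mat 1 :: complex^'n^'n)" by (simp add: diagm_def mat_def)
      then show "E ** E' = mat 1" "E' ** E = mat 1"
        using m[THEN less_imp_neq, symmetric] by (simp_all add: E_def E'_def diagm_mult)
    qed
    define W' where "W' = W ** E"
    have iW': "invertible W'"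
      unfolding W'_def by (intro invertible_mult iW matrix_inv_unique(1)[OF EE(1)])
    have colW': "column i W' = (1 / of_real (m i)) *s column i W" for i
      by (simp add: W'_def E_def column_def vec_eq_iff mult_diagm_nth)
    have nW': "norm (column i W') = 1" for i
    proof -
      show ?thesis using m[of i]
        by (simp add: colW' norm_smult_complex m_def[symmetric] norm_divide)
    qed
    have "conj_sym \<sigma> (P ** E)"
      using P(2) by (simp add: conj_sym_def E_def mult_diagm_nth ms)
    then obtain B' :: "real^'n^'n" where B': "cmat B' ** P = P ** E"
      using conj_sym_real_matrix[OF P(2) _ P(1)] by blast
    have "invertible (P ** E)" by (intro invertible_mult P matrix_inv_unique(1)[OF EE(1)])
    then have iB': "invertible B'"
      using B' unfolding invertible_det_nz by (metis det_cmat det_mul mult_eq_0_iff of_real_0)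
    define t where "t = matrix_inv B'"
    have tB: "t ** B' = mat 1" "B' ** t = mat 1" using matrix_inv_eq[OF iB'] by (auto simp: t_def)
    have it: "invertible t" using matrix_inv_unique(1)[OF tB(1)] .
    have tP: "cmat t ** P = P ** E'"
    proof -
      have "cmat t ** (cmat B' ** P) = P"
        by (simp add: matrix_mul_assoc cmat_mult[symmetric] tB cmat_one)
      then have "cmat t ** P ** E ** E' = P ** E'" unfolding B' by (simp add: matrix_mul_assoc)
      then show ?thesis by (simp add: matrix_mul_assoc[symmetric] EE)
    qed
    have inv: "(t ** g) ** (matrix_inv g ** B') = mat 1"
    proof -
      have "(t ** g) ** (matrix_inv g ** B') = t ** (g ** matrix_inv g) ** B'" by (simp only: matrix_mul_assoc)
      then show ?thesis by (simp add: matrix_inv_eq[OF ig] tB)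
    qed
    have inv': "matrix_inv (t ** g) = matrix_inv g ** B'"
      by (rule matrix_inv_unique(2)[OF inv])
    have W'P: "cmat (matrix_inv (t ** g)) ** P = W'"
      unfolding inv' W'_def W_def cmat_mult by (metis B' matrix_mul_assoc)
    have n1: "norm (matrix_inv (t ** g)) \<le> C"
    proof -
      have "cmat (matrix_inv (t ** g)) = W' ** matrix_inv P"
        by (metis W'P matrix_inv_eq(1)[OF P(1)] matrix_mul_assoc matrix_mul_rid)
      then have "norm (matrix_inv (t ** g)) \<le> norm W' * norm (matrix_inv P) * Km"
        using Km(2)[of W' "matrix_inv P"] by (metis norm_cmat)
      also have "norm W' \<le> real n * real n * 1"
        unfolding n_def
      proof (rule norm_matrix_le)
        fix r i
        have "norm (column i W' $ r) \<le> norm (column i W')"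
          by (rule Finite_Cartesian_Product.norm_nth_le)
        then show "norm (W' $ r $ i) \<le> 1" unfolding nW' by (simp add: column_def)
      qed
      finally show ?thesis using Km(1) unfolding C_def by (simp add: mult_right_mono)
    qed
    have n2: "norm (t ** g) \<le> C / norm (vdisc \<xi>)"
    proof -
      define V where "V = matrix_inv W'"
      have "cmat (t ** g) ** W' = P"
      proof -
        have "cmat (t ** g) ** W' = cmat ((t ** g) ** (matrix_inv g ** B')) ** P"
          unfolding W'P[symmetric] inv' cmat_mult by (simp only: matrix_mul_assoc)
        then show ?thesis by (simp add: inv cmat_one)
      qed
      then have tg: "cmat (t ** g) = P ** V"
        unfolding V_def by (metis iW' matrix_inv_eq(1) matrix_mul_assoc matrix_mul_rid)
      have AW': "cmat A *v column i W' = \<xi> i *s column i W'" for i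
      proof -
        have "cmat A ** W' = W' ** diagm \<xi>"
          unfolding W'_def matrix_mul_assoc AW
          by (simp add: matrix_mul_assoc[symmetric] E_def diagm_mult mult.commute)
        then show ?thesis by (simp add: mult_diagm_column)
      qed
      have nA: "norm (cmat A *v v) \<le> Kv * \<bar>R\<bar> * norm v" for v
      proof -
        have "norm (cmat A *v v) \<le> norm A * norm v * Kv" using Kv(2)[of "cmat A" v] by (simp add: norm_cmat)
        also have "\<dots> \<le> \<bar>R\<bar> * norm v * Kv"
          using bd Kv(1) by (intro mult_right_mono) (auto simp: A_def)
        finally show ?thesis by (simp add: mult_ac)
      qed
      have nxi: "norm (\<xi> i) \<le> Kv * \<bar>R\<bar>" for i
        using nA[of "column i W'"] nW'[of i] by (simp add: AW' norm_smult_complex)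
      have K: "norm (cmat A *v v - \<xi> j *s v) \<le> K * norm v" for j v
      proof -
        have "norm (cmat A *v v - \<xi> j *s v) \<le> norm (cmat A *v v) + norm (\<xi> j *s v)"
          by (rule norm_triangle_ineq4)
        also have "\<dots> \<le> Kv * \<bar>R\<bar> * norm v + Kv * \<bar>R\<bar> * norm v"
          unfolding norm_smult_complex by (intro add_mono nA mult_right_mono nxi) auto
        also have "\<dots> \<le> K * norm v" by (simp add: K_def algebra_simps)
        finally show ?thesis .
      qed
      have nd: "norm (\<xi> i - \<xi> j) \<le> K" for i j
        using norm_triangle_ineq4[of "\<xi> i" "\<xi> j"] nxi[of i] nxi[of j] by (simp add: K_def)
      define q where "q i = norm (\<Prod>j\<in>-{i}. \<xi> i - \<xi> j)" for i
      have q: "q i > 0" for i using inj by (auto simp: q_def inj_eq)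
      have qK: "q i \<le> K ^ n" for i
      proof -
        have "q i \<le> (\<Prod>j\<in>-{i}. K)"
          unfolding q_def prod_norm[symmetric] by (intro prod_mono) (auto simp: nd)
        also have "\<dots> \<le> K ^ n" using K1 by (simp add: n_def power_increasing card_mono)
        finally show ?thesis .
      qed
      \<comment> \<open>A lower bound for a single \<open>q i\<close> through the whole
        discriminant: each of the other factors is at most \<open>K ^ n\<close>.\<close>
      have pq: "norm (vdisc \<xi>) \<le> q i * K ^ (n * n)" for i
      proof -
        have "norm (vdisc \<xi>) = (\<Prod>i\<in>UNIV. q i)" by (simp add: vdisc_def q_def prod_norm)
        also have "\<dots> = q i * (\<Prod>i\<in>-{i}. q i)"
          by (simp add: prod.remove[of UNIV i] Compl_eq_Diff_UNIV)
        also have "(\<Prod>i\<in>-{i}. q i) \<le> (\<Prod>i\<in>-{i}. K ^ n)" using q qK by (intro prod_mono) (auto intro: less_imp_le)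
        also have "\<dots> \<le> (K ^ n) ^ n"
          unfolding prod_constant using K1 by (intro power_increasing) (auto simp: n_def card_mono one_le_power)
        finally show ?thesis using q[of i] by (simp add: power_mult)
      qed
      have vd: "norm (vdisc \<xi>) > 0" using inj by (simp add: vdisc_eq_0_iff)
      have nV: "norm (V $ i $ r) \<le> L / norm (vdisc \<xi>)" for i r
      proof -
        \<comment> \<open>Column \<open>r\<close> of the inverse holds the coordinates of the
          \<open>r\<close>-th unit vector in the basis of unit eigenvectors. The operators
          \<open>A - \<xi> j\<close> with \<open>j \<noteq> i\<close> isolate its
          \<open>i\<close>-th coordinate.\<close>
        define a where "a = V *v axis r 1"
        have ai: "a $ l = V $ l $ r" for l by (simp add: a_def matrix_vector_mult_axis column_def)
        have "W' *v a = axis r 1"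
          unfolding a_def V_def by (simp add: matrix_vector_mul_assoc matrix_inv_eq[OF iW'])
        then have comb: "(\<Sum>l\<in>UNIV. a $ l *s column l W') = axis r 1"
          by (simp add: matrix_mult_sum)
        have "norm (\<Sum>l\<in>UNIV. (a $ l * (\<Prod>j\<in>-{i}. \<xi> l - \<xi> j)) *s column l W') \<le> K ^ card (-{i}) * norm (axis r 1 :: complex^'n)"
          unfolding comb[symmetric] by (rule eigenvector_combination_bound[OF finite AW' K])
        also note norm_axis_complex
        also have "(\<Sum>l\<in>UNIV. (a $ l * (\<Prod>j\<in>-{i}. \<xi> l - \<xi> j)) *s column l W')
          = (a $ i * (\<Prod>j\<in>-{i}. \<xi> i - \<xi> j)) *s column i W'"
        proof (rule trans[OF sum.mono_neutral_right[of UNIV "{i}"]])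
          show "\<forall>l\<in>UNIV - {i}. (a $ l * (\<Prod>j\<in>-{i}. \<xi> l - \<xi> j)) *s column l W' = 0"
          proof
            fix l assume "l \<in> UNIV - {i}"
            then have "(\<Prod>j\<in>-{i}. \<xi> l - \<xi> j) = 0" by (intro prod_zero) auto
            then show "(a $ l * (\<Prod>j\<in>-{i}. \<xi> l - \<xi> j)) *s column l W' = 0" by simp
          qed
        qed auto
        finally have "norm (a $ i) * q i \<le> K ^ card (-{i})"
          using K1 by (simp add: norm_smult_complex nW' norm_mult q_def)
        also have "\<dots> \<le> K ^ n" using K1 by (simp add: n_def power_increasing card_mono)
        finally have 1: "norm (a $ i) * q i \<le> K ^ n" .
        have "norm (a $ i) * norm (vdisc \<xi>) \<le> norm (a $ i) * (q i * K ^ (n * n))"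
          by (intro mult_left_mono pq) auto
        also have "\<dots> = (norm (a $ i) * q i) * K ^ (n * n)" by simp
        also have "\<dots> \<le> L" unfolding L_def using K1 by (intro mult_right_mono 1) auto
        finally show ?thesis using vd by (simp add: ai pos_le_divide_eq)
      qed
      have "norm (t ** g) \<le> norm P * norm V * Km"
        using Km(2)[of P V] by (metis norm_cmat tg)
      also have "\<dots> \<le> norm P * (real n * real n * (L / norm (vdisc \<xi>))) * Km"
        using norm_matrix_le[OF nV] Km(1) by (intro mult_right_mono mult_left_mono) (auto simp: n_def)
      also have "\<dots> = (norm P * (real n * real n * L) * Km) / norm (vdisc \<xi>)" by simp
      also have "\<dots> \<le> C / norm (vdisc \<xi>)"
        by (intro divide_right_mono) (auto simp: C_def)
      finally show ?thesis .
    qed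
    show ?thesis using it tP n1 n2 unfolding E'_def GL_def by blast
  qed
  moreover have "C > 0" by (simp add: C_def)
  ultimately show ?thesis by blast
qed

section \<open>Comparison of the discriminant with the product over ordered pairs\<close>

lemma prod_pairs_symmetric:
  fixes g :: "nat \<Rightarrow> nat \<Rightarrow> 'a::comm_monoid_mult"
  shows "(\<Prod>j<n. \<Prod>i<j. g i j * g j i) = (\<Prod>j<n. \<Prod>i\<in>{..<n}-{j}. g i j)"
proof (induction n)
  case (Suc n)
  have "(\<Prod>j<Suc n. \<Prod>i\<in>{..<Suc n}-{j}. g i j)
      = (\<Prod>j<n. \<Prod>i\<in>{..<Suc n}-{j}. g i j) * (\<Prod>i<n. g i n)"
  proof -
    have "{..<Suc n} - {n} = {..<n}" by auto
    then show ?thesis by simp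
  qed
  also have "(\<Prod>j<n. \<Prod>i\<in>{..<Suc n}-{j}. g i j) = (\<Prod>j<n. g n j * (\<Prod>i\<in>{..<n}-{j}. g i j))"
  proof (rule prod.cong[OF refl])
    fix j assume "j \<in> {..<n}"
    then have "{..<Suc n} - {j} = insert n ({..<n} - {j})" by auto
    then show "(\<Prod>i\<in>{..<Suc n}-{j}. g i j) = g n j * (\<Prod>i\<in>{..<n}-{j}. g i j)" by simp
  qed
  finally show ?case using Suc by (simp add: prod.distrib mult_ac)
qed simp

text \<open>\<open>eigenvalue_list\<close> is an unspecified choice, but the multiset of roots fixes
  it up to order. For distinct roots the index pairs correspond; a repeated root makes both sides
  zero. The modulus removes the sign between \<open>(x - y)^2\<close> and
  \<open>(x - y) * (y - x)\<close>.\<close>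

lemma norm_discriminant:
  assumes "spectrum A \<xi>"
  shows "cmod (discriminant A) = cmod (vdisc \<xi>)"
proof -
  define es where "es = eigenvalue_list A"
  obtain xs :: "'a list" where xs: "set xs = UNIV" "distinct xs"
    using finite_distinct_list[OF finite[of "UNIV :: 'a set"]] by blast
  have "map_poly complex_of_real (charpoly A) = (\<Prod>e\<leftarrow>map \<xi> xs. [:- e, 1:])"
    using assms xs unfolding spectrum_def
    by (simp add: prod.distinct_set_conv_list[symmetric] o_def)
  then have "\<exists>es. map_poly complex_of_real (charpoly A) = (\<Prod>e\<leftarrow>es. [:- e, 1:])" by blast
  then have es: "map_poly complex_of_real (charpoly A) = (\<Prod>e\<leftarrow>es. [:- e, 1:])"
    unfolding es_def eigenvalue_list_def by (rule someI_ex)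
  have mset: "mset es = image_mset \<xi> (mset_set UNIV)"
  proof -
    have "proots (\<Prod>e\<leftarrow>es. [:- e, 1:]) = mset es"
    proof (induction es)
      case (Cons a es)
      have "(\<Prod>e\<leftarrow>es. [:- e, 1:]) \<noteq> 0" by (auto simp: prod_list_zero_iff)
      then show ?case using Cons proots_mult[of "[:- a, 1:]" "\<Prod>e\<leftarrow>es. [:- e, 1:]"]
        by (simp del: mult_pCons_left)
    qed simp
    moreover have "proots (\<Prod>i\<in>UNIV. [:- \<xi> i, 1:]) = image_mset \<xi> (mset_set UNIV)"
      by (subst proots_prod) (auto simp: sum_unfold_sum_mset image_mset.compositionality o_def)
    ultimately show ?thesis using es assms by (simp add: spectrum_def)
  qed
  then have len: "length es = CARD('a)" by (metis size_image_mset size_mset size_mset_set)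
  have set: "set es = range \<xi>" using mset by (metis finite_set_mset_mset_set finite set_image_mset set_mset_mset)
  have disc: "cmod (discriminant A) = (\<Prod>j<length es. \<Prod>i\<in>{..<length es}-{j}. cmod (es ! i - es ! j))"
    unfolding discriminant_def es_def[symmetric] Let_def prod_pairs_symmetric[symmetric]
    by (simp add: prod_norm[symmetric] norm_mult power2_eq_square norm_minus_commute)
  show ?thesis
  proof (cases "inj \<xi>")
    case True
    then have "card (set es) = length es" by (simp add: len set card_image)
    then have "distinct es" by (rule card_distinct)
    then have bij: "bij_betw ((!) es) {..<length es} (range \<xi>)"
      using bij_betw_nth set by blast
    have "(\<Prod>j<length es. \<Prod>i\<in>{..<length es}-{j}. cmod (es ! i - es ! j))
      = (\<Prod>j<length es. \<Prod>a\<in>range \<xi> - {es ! j}. cmod (a - es ! j))"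
    proof (rule prod.cong[OF refl])
      fix j assume j: "j \<in> {..<length es}"
      have "bij_betw ((!) es) ({..<length es}-{j}) (range \<xi> - {es ! j})"
        using bij_betw_DiffI[OF bij, of "{j}" "{es ! j}"] j bij_betwE[OF bij] by auto
      then show "(\<Prod>i\<in>{..<length es}-{j}. cmod (es ! i - es ! j)) = (\<Prod>a\<in>range \<xi> - {es ! j}. cmod (a - es ! j))"
        by (rule prod.reindex_bij_betw)
    qed
    also have "\<dots> = (\<Prod>b\<in>range \<xi>. \<Prod>a\<in>range \<xi> - {b}. cmod (a - b))"
      by (rule prod.reindex_bij_betw[OF bij])
    also have "\<dots> = (\<Prod>i\<in>UNIV. \<Prod>a\<in>range \<xi> - {\<xi> i}. cmod (a - \<xi> i))"
      using True by (subst prod.reindex) (auto simp: o_def)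
    also have "\<dots> = (\<Prod>i\<in>UNIV. \<Prod>j\<in>-{i}. cmod (\<xi> j - \<xi> i))"
    proof (rule prod.cong[OF refl])
      fix i
      have "range \<xi> - {\<xi> i} = \<xi> ` (- {i})" using True by (auto simp: inj_eq)
      then show "(\<Prod>a\<in>range \<xi> - {\<xi> i}. cmod (a - \<xi> i)) = (\<Prod>j\<in>-{i}. cmod (\<xi> j - \<xi> i))"
        by (simp add: prod.reindex[OF inj_on_subset[OF True subset_UNIV]] o_def)
    qed
    also have "\<dots> = cmod (vdisc \<xi>)" by (simp add: vdisc_def prod_norm[symmetric] norm_minus_commute)
    finally show ?thesis by (simp add: disc)
  next
    case False
    have "\<not> distinct es"
    proof
      assume "distinct es"
      then have "card (range \<xi>) = CARD('a)" using set len distinct_card by metis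
      then show False using False by (metis eq_card_imp_inj_on finite)
    qed
    then obtain i j where ij: "i < length es" "j < length es" "i \<noteq> j" "es ! i = es ! j"
      by (auto simp: distinct_conv_nth)
    then have "(\<Prod>i\<in>{..<length es}-{j}. cmod (es ! i - es ! j)) = 0" by (intro prod_zero) auto
    then have "cmod (discriminant A) = 0" unfolding disc using ij by (intro prod_zero) auto
    then show ?thesis using False by (simp add: vdisc_eq_0_iff)
  qed
qed

lemma spectrum_exists:
  fixes A :: "real^'n^'n"
  assumes "degree (charpoly A) = CARD('n)" "lead_coeff (charpoly A) = 1"
  shows "\<exists>\<xi>. spectrum A \<xi>"
proof -
  let ?p = "map_poly complex_of_real (charpoly A)"
  have d: "degree ?p = CARD('n)" using assms(1) by (simp add: degree_map_poly)
  have l: "lead_coeff ?p = 1" unfolding d using assms by (simp add: coeff_map_poly)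
  obtain root where root: "smult (lead_coeff ?p) (\<Prod>i<degree ?p. [:- root i, 1:]) = ?p"
    by (rule complex_poly_decompose')
  obtain h :: "'n \<Rightarrow> nat" where h: "bij_betw h UNIV {..<CARD('n)}"
    using ex_bij_betw_finite_nat[OF finite[of "UNIV :: 'n set"]] by (auto simp: atLeast0LessThan)
  have "?p = (\<Prod>i<CARD('n). [:- root i, 1:])" using root unfolding d l[unfolded d] by simp
  also have "\<dots> = (\<Prod>i\<in>UNIV. [:- root (h i), 1:])"
    by (rule prod.reindex_bij_betw[OF h, symmetric])
  finally show ?thesis unfolding spectrum_def by (intro exI[of _ "\<lambda>i. root (h i)"])
qed

section \<open>The discriminant as a polynomial in the coefficients\<close>

definition mpow :: "'a::semiring_1^'n^'n \<Rightarrow> nat \<Rightarrow> 'a^'n^'n" where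
  "mpow A k = (((**) A) ^^ k) (mat 1)"

lemma mpow_0 [simp]: "mpow A 0 = mat 1"
  and mpow_Suc [simp]: "mpow A (Suc k) = A ** mpow A k"
  by (simp_all add: mpow_def)

text \<open>Multiplication by \<open>X\<close> on \<open>\<real>[X] / (q)\<close> in the basis of the powers of \<open>X\<close>, numbered by \<open>h\<close>.\<close>

definition companion :: "('n::finite \<Rightarrow> nat) \<Rightarrow> real poly \<Rightarrow> real^'n^'n" where
  "companion h q = (\<chi> j k. if Suc (h k) < CARD('n) then (if h j = Suc (h k) then 1 else 0)
     else - coeff q (h j))"

text \<open>Multiplication by the derivative \<open>q'\<close> on \<open>\<real>[X] / (q)\<close>; its determinant is the discriminant
  of \<open>q\<close> up to sign.\<close>

definition deriv_mult :: "('n::finite \<Rightarrow> nat) \<Rightarrow> real poly \<Rightarrow> real^'n^'n" where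
  "deriv_mult h q = (\<Sum>l=1..CARD('n). (real l * coeff q l) *\<^sub>R mpow (companion h q) (l - 1))"

text \<open>A left eigenvector condition. With \<open>u\<close> the row of powers of a root
  \<open>z\<close>, it says that evaluation at \<open>z\<close>, as a functional on
  \<open>\<real>[X] / (q)\<close>, turns \<open>M\<close> into multiplication by a number.\<close>

definition row_eigen :: "('n::finite \<Rightarrow> complex) \<Rightarrow> complex \<Rightarrow> real^'n^'n \<Rightarrow> bool" where
  "row_eigen u z M \<longleftrightarrow> (\<forall>k. (\<Sum>j\<in>UNIV. u j * of_real (M $ j $ k)) = z * u k)"

lemma row_eigen_one: "row_eigen u 1 (mat 1)"
  by (simp add: row_eigen_def mat_def if_distrib cong: if_cong)

lemma row_eigen_mult:
  assumes "row_eigen u z M" "row_eigen u w N"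
  shows "row_eigen u (z * w) (M ** N)"
  unfolding row_eigen_def
proof
  fix k
  have "(\<Sum>j\<in>UNIV. u j * of_real ((M ** N) $ j $ k))
      = (\<Sum>j\<in>UNIV. \<Sum>i\<in>UNIV. u j * of_real (M $ j $ i) * of_real (N $ i $ k))"
    by (simp add: matrix_matrix_mult_def sum_distrib_left mult_ac)
  also have "\<dots> = (\<Sum>i\<in>UNIV. (\<Sum>j\<in>UNIV. u j * of_real (M $ j $ i)) * of_real (N $ i $ k))"
    by (subst sum.swap) (simp add: sum_distrib_right)
  also have "\<dots> = (\<Sum>i\<in>UNIV. z * u i * of_real (N $ i $ k))"
    using assms(1) by (simp add: row_eigen_def)
  also have "\<dots> = z * (\<Sum>i\<in>UNIV. u i * of_real (N $ i $ k))"
    by (simp add: sum_distrib_left mult_ac)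
  also have "\<dots> = z * w * u k" using assms(2) by (simp add: row_eigen_def)
  finally show "(\<Sum>j\<in>UNIV. u j * of_real ((M ** N) $ j $ k)) = z * w * u k" .
qed

lemma row_eigen_mpow: "row_eigen u z M \<Longrightarrow> row_eigen u (z ^ k) (mpow M k)"
  by (induction k) (auto intro: row_eigen_one row_eigen_mult)

lemma row_eigen_sum:
  assumes "\<And>l. l \<in> A \<Longrightarrow> row_eigen u (z l) (M l)"
  shows "row_eigen u (\<Sum>l\<in>A. of_real (c l) * z l) (\<Sum>l\<in>A. c l *\<^sub>R M l)"
  unfolding row_eigen_def
proof
  fix k
  have "(\<Sum>j\<in>UNIV. u j * of_real ((\<Sum>l\<in>A. c l *\<^sub>R M l) $ j $ k))
    = (\<Sum>l\<in>A. of_real (c l) * (\<Sum>j\<in>UNIV. u j * of_real (M l $ j $ k)))"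
    by (simp add: sum_distrib_left sum_component) (subst sum.swap, simp add: mult_ac)
  also have "\<dots> = (\<Sum>l\<in>A. of_real (c l) * z l) * u k"
    using assms by (simp add: row_eigen_def sum_distrib_left mult_ac)
  finally show "(\<Sum>j\<in>UNIV. u j * of_real ((\<Sum>l\<in>A. c l *\<^sub>R M l) $ j $ k))
    = (\<Sum>l\<in>A. of_real (c l) * z l) * u k" .
qed

lemma row_eigen_0_det:
  assumes "row_eigen u 0 M" "u k \<noteq> 0"
  shows "det M = 0"
proof -
  have "transpose (cmat M) *v (\<chi> j. u j) = 0"
    using assms(1) by (simp add: row_eigen_def vec_eq_iff matrix_vector_mult_def transpose_def mult.commute)
  moreover have "(\<chi> j. u j) \<noteq> 0" using assms(2) by (auto simp: vec_eq_iff)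
  ultimately have "\<not> invertible (transpose (cmat M))"
    unfolding invertible_left_inverse matrix_left_invertible_ker by blast
  then show ?thesis by (simp add: invertible_det_nz det_transpose det_cmat)
qed

lemma row_eigen_mult_vec:
  assumes "row_eigen u z M"
  shows "(\<Sum>j\<in>UNIV. u j * of_real ((M *v a) $ j)) = z * (\<Sum>k\<in>UNIV. u k * of_real (a $ k))"
proof -
  have "(\<Sum>j\<in>UNIV. u j * of_real ((M *v a) $ j))
      = (\<Sum>j\<in>UNIV. \<Sum>k\<in>UNIV. u j * of_real (M $ j $ k) * of_real (a $ k))"
    by (simp add: matrix_vector_mult_def sum_distrib_left mult_ac)
  also have "\<dots> = (\<Sum>k\<in>UNIV. (\<Sum>j\<in>UNIV. u j * of_real (M $ j $ k)) * of_real (a $ k))"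
    by (subst sum.swap) (simp add: sum_distrib_right)
  also have "\<dots> = (\<Sum>k\<in>UNIV. z * u k * of_real (a $ k))" using assms by (simp add: row_eigen_def)
  finally show ?thesis by (simp add: sum_distrib_left mult_ac)
qed

lemma poly_as_sum_upto: "degree p \<le> n \<Longrightarrow> poly p z = (\<Sum>l\<le>n. coeff p l * z ^ l)"
  for z :: "'a::comm_ring_1"
  unfolding poly_altdef by (intro sum.mono_neutral_left) (auto simp: coeff_eq_0)

text \<open>Evaluation at \<open>z\<close> is a ring homomorphism on
  \<open>\<real>[X] / (q)\<close>, so multiplication by \<open>X\<close> becomes multiplication by
  \<open>z\<close>. Only the column of the top power \<open>X^(n-1)\<close> uses
  \<open>q(z) = 0\<close>.\<close>

lemma row_eigen_companion:
  fixes h :: "'n::finite \<Rightarrow> nat"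
  assumes h: "bij_betw h UNIV {..<CARD('n)}"
    and q: "degree q = CARD('n)" "lead_coeff q = 1"
    and root: "poly (map_poly complex_of_real q) z = 0"
  shows "row_eigen (\<lambda>k. z ^ h k) z (companion h q)"
  unfolding row_eigen_def
proof
  fix k
  have hl: "h j < CARD('n)" for j using bij_betwE[OF h] by auto
  show "(\<Sum>j\<in>UNIV. z ^ h j * of_real (companion h q $ j $ k)) = z * z ^ h k"
  proof (cases "Suc (h k) < CARD('n)")
    case True
    then obtain i where i: "h i = Suc (h k)" using h by (metis bij_betw_iff_bijections lessThan_iff)
    have "h j = Suc (h k) \<longleftrightarrow> j = i" for j
      using h i by (metis UNIV_I bij_betw_def inj_on_def)
    then have "(\<Sum>j\<in>UNIV. z ^ h j * of_real (companion h q $ j $ k)) = (\<Sum>j\<in>UNIV. if j = i then z ^ h j else 0)"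
      using True by (intro sum.cong) (auto simp: companion_def)
    then show ?thesis by (simp add: i)
  next
    case False
    then have k: "Suc (h k) = CARD('n)" using hl[of k] by simp
    have "0 = (\<Sum>l\<le>CARD('n). of_real (coeff q l) * z ^ l)"
      using root poly_as_sum_upto[of "map_poly complex_of_real q" "CARD('n)" z] q(1)
      by (simp add: degree_map_poly coeff_map_poly)
    also have "\<dots> = (\<Sum>l<CARD('n). of_real (coeff q l) * z ^ l) + z ^ CARD('n)"
      using q by (simp add: lessThan_Suc_atMost[symmetric])
    also have "(\<Sum>l<CARD('n). of_real (coeff q l) * z ^ l) = (\<Sum>j\<in>UNIV. of_real (coeff q (h j)) * z ^ h j)"
      by (rule sum.reindex_bij_betw[OF h, symmetric])
    finally have *: "z ^ CARD('n) = - (\<Sum>j\<in>UNIV. of_real (coeff q (h j)) * z ^ h j)"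
      by (simp add: eq_neg_iff_add_eq_0 add.commute)
    have "(\<Sum>j\<in>UNIV. z ^ h j * of_real (companion h q $ j $ k)) = z ^ CARD('n)"
      unfolding * using False by (simp add: companion_def sum_negf mult.commute)
    then show ?thesis by (simp add: k[symmetric])
  qed
qed

lemma poly_pderiv_prod_roots:
  fixes \<xi> :: "'n::finite \<Rightarrow> complex"
  shows "poly (pderiv (\<Prod>i\<in>UNIV. [:- \<xi> i, 1:])) (\<xi> i) = (\<Prod>j\<in>-{i}. \<xi> i - \<xi> j)"
proof -
  have "poly (pderiv (\<Prod>i\<in>UNIV. [:- \<xi> i, 1:])) (\<xi> i) = (\<Sum>k\<in>UNIV. \<Prod>j\<in>UNIV-{k}. \<xi> i - \<xi> j)"
    unfolding pderiv_prod by (simp add: poly_sum poly_prod pderiv_pCons)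
  also have "\<dots> = (\<Sum>k\<in>UNIV. if k = i then \<Prod>j\<in>UNIV-{k}. \<xi> i - \<xi> j else 0)"
    by (intro sum.cong refl) (auto intro!: prod_zero)
  finally show ?thesis by (simp add: Compl_eq_Diff_UNIV)
qed

text \<open>\<open>deriv_mult\<close> is \<open>q'\<close> applied to the companion matrix, so its
  eigenvalue is \<open>q'(\<xi> i)\<close>, the product of the differences to the other
  roots.\<close>

lemma row_eigen_deriv_mult:
  fixes h :: "'n::finite \<Rightarrow> nat" and \<xi> :: "'n \<Rightarrow> complex"
  assumes h: "bij_betw h UNIV {..<CARD('n)}"
    and q: "degree q = CARD('n)" "lead_coeff q = 1"
    and \<xi>: "map_poly complex_of_real q = (\<Prod>i\<in>UNIV. [:- \<xi> i, 1:])"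
  shows "row_eigen (\<lambda>k. \<xi> i ^ h k) (\<Prod>j\<in>-{i}. \<xi> i - \<xi> j) (deriv_mult h q)"
proof -
  let ?q = "map_poly complex_of_real q"
  obtain m where m: "CARD('n) = Suc m"
    using zero_less_card_finite[where 'a='n] by (metis gr0_implies_Suc)
  have root: "poly ?q (\<xi> i) = 0" unfolding \<xi> by (auto simp: poly_prod)
  have deg: "degree ?q = CARD('n)" using q by (simp add: degree_map_poly)
  have "(\<Prod>j\<in>-{i}. \<xi> i - \<xi> j) = poly (pderiv ?q) (\<xi> i)"
    unfolding \<xi> by (rule poly_pderiv_prod_roots[symmetric])
  also have "\<dots> = (\<Sum>l\<le>CARD('n) - 1. coeff (pderiv ?q) l * \<xi> i ^ l)"
    by (rule poly_as_sum_upto) (simp add: degree_pderiv deg)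
  also have "\<dots> = (\<Sum>l=1..CARD('n). of_real (real l * coeff q l) * \<xi> i ^ (l - 1))"
    by (rule sum.reindex_bij_witness[of _ "\<lambda>l. l - 1" Suc])
      (auto simp: coeff_pderiv coeff_map_poly m)
  finally have "(\<Prod>j\<in>-{i}. \<xi> i - \<xi> j) = \<dots>" .
  then show ?thesis
    unfolding deriv_mult_def
    using row_eigen_sum[of "{1..CARD('n)}" "\<lambda>k. \<xi> i ^ h k" "\<lambda>l. \<xi> i ^ (l - 1)" "\<lambda>l. mpow (companion h q) (l - 1)"
        "\<lambda>l. real l * coeff q l"] row_eigen_mpow[OF row_eigen_companion[OF h q root]] by simp
qed

text \<open>A kernel vector lists the coefficients of a polynomial of degree below \<open>n\<close>
  that has \<open>n\<close> distinct roots.\<close>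

lemma vandermonde_invertible:
  fixes h :: "'n::finite \<Rightarrow> nat" and \<xi> :: "'n \<Rightarrow> complex"
  assumes h: "bij_betw h UNIV {..<CARD('n)}" and "inj \<xi>"
  shows "invertible ((\<chi> i k. \<xi> i ^ h k) :: complex^'n^'n)"
proof -
  have "b = 0" if b: "(\<chi> i k. \<xi> i ^ h k) *v b = 0" for b :: "complex^'n"
  proof -
    define r where "r = (\<Sum>k\<in>UNIV. monom (b $ k) (h k))"
    have inj: "h i = h j \<longleftrightarrow> i = j" for i j using h by (metis UNIV_I bij_betw_def inj_on_def)
    have rt: "poly r (\<xi> i) = 0" for i
      using b by (simp add: r_def poly_sum poly_monom vec_eq_iff matrix_vector_mult_def mult.commute)
    have cf: "coeff r (h k) = b $ k" for k by (simp add: r_def coeff_sum inj)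
    have "degree r \<le> CARD('n) - 1"
      unfolding r_def
    proof (intro degree_sum_le)
      fix k :: 'n
      have "h k < CARD('n)" using bij_betwE[OF h] by auto
      then show "degree (monom (b $ k) (h k)) \<le> CARD('n) - 1"
        by (intro order_trans[OF degree_monom_le]) simp
    qed simp
    then have dr: "degree r < CARD('n)"
      using zero_less_card_finite[where 'a='n] by linarith
    have "r = 0"
    proof (rule ccontr)
      assume "r \<noteq> 0"
      have "CARD('n) = card (range \<xi>)" using assms(2) by (simp add: card_image)
      also have "\<dots> \<le> card {z. poly r z = 0}"
        using rt poly_roots_finite[OF \<open>r \<noteq> 0\<close>] by (intro card_mono) auto
      also have "\<dots> \<le> degree r" by (rule card_poly_roots_bound[OF \<open>r \<noteq> 0\<close>])
      finally show False using dr by simp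
    qed
    then show ?thesis using cf by (simp add: vec_eq_iff)
  qed
  then show ?thesis unfolding invertible_left_inverse matrix_left_invertible_ker by blast
qed

text \<open>For distinct roots the Vandermonde matrix diagonalises the operator. A repeated root
  gives a left eigenvector for 0, nonzero because its entry at the power 0 is 1.\<close>

lemma det_deriv_mult:
  fixes h :: "'n::finite \<Rightarrow> nat" and \<xi> :: "'n \<Rightarrow> complex"
  assumes h: "bij_betw h UNIV {..<CARD('n)}"
    and q: "degree q = CARD('n)" "lead_coeff q = 1"
    and \<xi>: "map_poly complex_of_real q = (\<Prod>i\<in>UNIV. [:- \<xi> i, 1:])"
  shows "complex_of_real (det (deriv_mult h q)) = vdisc \<xi>"
proof (cases "inj \<xi>")
  case True
  define V where "V = ((\<chi> i k. \<xi> i ^ h k) :: complex^'n^'n)"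
  have "V ** cmat (deriv_mult h q) = diagm (\<lambda>i. \<Prod>j\<in>-{i}. \<xi> i - \<xi> j) ** V"
    using row_eigen_deriv_mult[OF h q \<xi>]
    by (simp add: vec_eq_iff diagm_mult_nth V_def) (simp add: matrix_matrix_mult_def row_eigen_def)
  then have "det (V ** cmat (deriv_mult h q)) = det (diagm (\<lambda>i. \<Prod>j\<in>-{i}. \<xi> i - \<xi> j) ** V)"
    by simp
  then have "det V * complex_of_real (det (deriv_mult h q)) = vdisc \<xi> * det V"
    by (simp only: det_mul det_diagm det_cmat vdisc_def)
  then show ?thesis
    using vandermonde_invertible[OF h True] by (simp add: invertible_det_nz V_def)
next
  case False
  then obtain i j where ij: "i \<noteq> j" "\<xi> i = \<xi> j" by (auto simp: inj_def)
  obtain k where k: "h k = 0"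
    using h zero_less_card_finite[where 'a='n] by (metis bij_betw_iff_bijections lessThan_iff)
  have "(\<Prod>j\<in>-{i}. \<xi> i - \<xi> j) = 0" using ij by (intro prod_zero) auto
  then have "row_eigen (\<lambda>k. \<xi> i ^ h k) 0 (deriv_mult h q)"
    using row_eigen_deriv_mult[OF h q \<xi>, of i] by (simp only:)
  then have "det (deriv_mult h q) = 0" by (rule row_eigen_0_det[of _ _ k]) (simp add: k)
  then show ?thesis using False by (simp add: vdisc_eq_0_iff)
qed

section \<open>Polynomial dependence on matrix entries\<close>

lemma real_polynomial_function_det:
  fixes M :: "'b::real_normed_vector \<Rightarrow> real^'n^'n"
  assumes "\<And>i j. real_polynomial_function (\<lambda>x. M x $ i $ j)"
  shows "real_polynomial_function (\<lambda>x. det (M x))"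
  unfolding det_def
  by (intro real_polynomial_function_sum real_polynomial_function.intros(4) real_polynomial_function_prod
      real_polynomial_function.intros(2) assms finite_permutations finite)

lemma real_polynomial_function_mpow:
  fixes M :: "'b::real_normed_vector \<Rightarrow> real^'n^'n"
  assumes "\<And>i j. real_polynomial_function (\<lambda>x. M x $ i $ j)"
  shows "real_polynomial_function (\<lambda>x. mpow (M x) k $ i $ j)"
proof (induction k arbitrary: i j)
  case 0
  then show ?case by (simp add: real_polynomial_function.intros(2))
next
  case (Suc k)
  then show ?case
    by (simp add: matrix_matrix_mult_def)
      (intro real_polynomial_function_sum real_polynomial_function.intros(4) assms finite)
qed

lemma real_polynomial_function_deriv_mult:
  fixes q :: "'b::real_normed_vector \<Rightarrow> real poly" and h :: "'n::finite \<Rightarrow> nat"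
  assumes "\<And>l. real_polynomial_function (\<lambda>x. coeff (q x) l)"
  shows "real_polynomial_function (\<lambda>x. deriv_mult h (q x) $ i $ j)"
proof -
  have comp: "real_polynomial_function (\<lambda>x. companion h (q x) $ i $ j)" for i j
  proof (cases "Suc (h j) < CARD('n)")
    case True
    then show ?thesis by (simp add: companion_def real_polynomial_function.intros(2))
  next
    case False
    then show ?thesis using assms by (simp add: companion_def real_polynomial_function_minus)
  qed
  show ?thesis
    unfolding deriv_mult_def
    by (simp add: sum_component)
      (intro real_polynomial_function_sum real_polynomial_function.intros(4) real_polynomial_function.intros(2)
        assms comp real_polynomial_function_mpow finite_atLeastAtMost)
qed

section \<open>The general linear group\<close>

lemma real_polynomial_function_entry: "real_polynomial_function (\<lambda>A :: real^'n^'m. A $ i $ j)"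
  by (intro real_polynomial_function.intros(1) bounded_linear_compose[OF bounded_linear_vec_nth bounded_linear_vec_nth])

lemma continuous_on_det: "continuous_on S (\<lambda>A :: real^'n^'n. det A)"
  using real_polynomial_function_det[of "\<lambda>A :: real^'n^'n. A", OF real_polynomial_function_entry]
    real_polynomial_function_has_derivative has_derivative_continuous continuous_at_imp_continuous_on
  by (metis (no_types, lifting))

lemma GL_det: "GL = {A. det A \<noteq> 0}"
  by (simp add: GL_def invertible_det_nz)

lemma open_GL: "open (GL :: (real^'n^'n) set)"
  unfolding GL_det by (intro open_Collect_neq continuous_on_det continuous_on_const)

lemma mat1_in_GL: "mat 1 \<in> GL"
  by (simp add: GL_det)

lemma GL_mult: "g \<in> GL \<Longrightarrow> h \<in> GL \<Longrightarrow> g ** h \<in> GL"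
  by (simp add: GL_det det_mul)

lemma GL_inv:
  assumes "g \<in> GL"
  shows "matrix_inv g \<in> GL" "g ** matrix_inv g = mat 1" "matrix_inv g ** g = mat 1"
    "matrix_inv (matrix_inv g) = g"
  using matrix_inv_unique[OF matrix_inv_eq(1)] matrix_inv_eq assms by (auto simp: GL_def)

lemma matrix_inv_mult:
  assumes "g \<in> GL" "h \<in> GL"
  shows "matrix_inv (g ** h) = matrix_inv h ** matrix_inv g"
proof (rule matrix_inv_unique(2))
  have "g ** h ** (matrix_inv h ** matrix_inv g) = g ** (h ** matrix_inv h) ** matrix_inv g"
    by (simp only: matrix_mul_assoc)
  then show "g ** h ** (matrix_inv h ** matrix_inv g) = mat 1" by (simp add: GL_inv assms)
qed

lemma det_conjugate: "g \<in> GL \<Longrightarrow> det (conjugate g A) = det A"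
proof -
  assume g: "g \<in> GL"
  have "det (matrix_inv g) * det g = 1" by (metis GL_inv(3)[OF g] det_mul det_I)
  then show ?thesis by (simp add: conjugate_def det_mul)
qed

lemma conjugate_in_GL: "g \<in> GL \<Longrightarrow> A \<in> GL \<Longrightarrow> conjugate g A \<in> GL"
  by (simp add: conjugate_def GL_mult GL_inv)

lemma conjugate_mult: "g \<in> GL \<Longrightarrow> h \<in> GL \<Longrightarrow> conjugate (g ** h) A = conjugate h (conjugate g A)"
  by (simp add: conjugate_def matrix_inv_mult matrix_mul_assoc)

lemma conjugate_commute: "t \<in> GL \<Longrightarrow> t ** A = A ** t \<Longrightarrow> conjugate t A = A"
  unfolding conjugate_def by (metis GL_inv(3) matrix_mul_assoc matrix_mul_lid)

lemma continuous_on_matrix_mult [continuous_intros]: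
  fixes f :: "'c::topological_space \<Rightarrow> real^'n^'m" and g :: "'c \<Rightarrow> real^'k^'n"
  shows "continuous_on S f \<Longrightarrow> continuous_on S g \<Longrightarrow> continuous_on S (\<lambda>x. f x ** g x)"
  by (rule bounded_bilinear.continuous_on[OF bounded_bilinear_matrix_mult])

text \<open>Cramer's rule writes the entries of the inverse as polynomials divided by the
  determinant.\<close>

lemma continuous_on_matrix_inv: "continuous_on GL (matrix_inv :: real^'n^'n \<Rightarrow> _)"
proof -
  have e: "matrix_inv A $ i $ j = det (\<chi> r c. if c = i then axis j 1 $ r else A $ r $ c) / det A"
    if "A \<in> GL" for A :: "real^'n^'n" and i j
  proof -
    have "A *v column j (matrix_inv A) = axis j 1"
      by (simp add: matrix_vector_mult_axis[symmetric] matrix_vector_mul_assoc GL_inv[OF that])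
    then have "column j (matrix_inv A) = (\<chi> k. det (\<chi> r c. if c = k then axis j 1 $ r else A $ r $ c) / det A)"
      using cramer[of A] that by (simp add: GL_det)
    then show ?thesis by (simp add: column_def vec_eq_iff)
  qed
  have "continuous_on GL (\<lambda>A. det (\<chi> r c. if c = i then axis j 1 $ r else A $ r $ c) / det (A :: real^'n^'n))" for i j :: 'n
  proof (intro continuous_on_divide continuous_on_det)
    have "real_polynomial_function (\<lambda>A. (\<chi> r c. if c = i then axis j 1 $ r else A $ r $ c) $ r $ c)"
      for r c
      using real_polynomial_function_entry[of r c]
      by (cases "c = i") (auto intro: real_polynomial_function.intros(2))
    from real_polynomial_function_det[OF this]
    show "continuous_on GL (\<lambda>A :: real^'n^'n. det (\<chi> r c. if c = i then axis j 1 $ r else A $ r $ c))"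
      using real_polynomial_function_has_derivative has_derivative_continuous continuous_at_imp_continuous_on
      by (metis (no_types, lifting))
  qed (auto simp: GL_det)
  then have "continuous_on GL (\<lambda>A :: real^'n^'n. matrix_inv A $ i $ j)" for i j
    by (rule continuous_on_cong[THEN iffD1, rotated 2]) (auto simp: e)
  then have "continuous_on GL (\<lambda>A :: real^'n^'n. \<chi> i j. matrix_inv A $ i $ j)"
    by (intro continuous_on_vec_lambda)
  then show ?thesis by simp
qed

lemma continuous_on_matrix_inv' [continuous_intros]:
  "continuous_on S f \<Longrightarrow> f ` S \<subseteq> GL \<Longrightarrow> continuous_on S (\<lambda>x. matrix_inv (f x :: real^'n^'n))"
  by (rule continuous_on_compose2[OF continuous_on_matrix_inv])

text \<open>These sets exhaust \<open>GL\<close>. The two bounds are kept apart because later only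
  \<open>a\<close> grows with the inverse discriminant while \<open>b\<close> stays fixed.\<close>

definition Om :: "real \<Rightarrow> real \<Rightarrow> (real^'n^'n) set" where
  "Om a b = {g \<in> GL. norm g \<le> a \<and> norm (matrix_inv g) \<le> b}"

text \<open>\<open>GL\<close> is not closed, so the set is obtained as the projection of a closed
  bounded set of pairs of mutually inverse matrices.\<close>

lemma compact_Om: "compact (Om a b :: (real^'n^'n) set)"
proof -
  let ?S = "{p :: (real^'n^'n) \<times> (real^'n^'n). fst p ** snd p = mat 1} \<inter> (cball 0 a \<times> cball 0 b)"
  have "closed {p :: (real^'n^'n) \<times> (real^'n^'n). fst p ** snd p = mat 1}"
    by (intro closed_Collect_eq continuous_intros)
  then have "compact ?S"
    by (intro closed_Int_compact compact_Times) auto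
  then have "compact (fst ` ?S)" by (rule compact_continuous_image[OF continuous_on_fst[OF continuous_on_id]])
  moreover have "fst ` ?S = Om a b"
  proof (intro equalityI subsetI)
    fix g assume "g \<in> fst ` ?S"
    then obtain h where "g ** h = mat 1" "norm g \<le> a" "norm h \<le> b" by auto
    then show "g \<in> Om a b" using matrix_inv_unique[of g h] by (auto simp: Om_def GL_def)
  next
    fix g :: "real^'n^'n" assume g: "g \<in> Om a b"
    then have "(g, matrix_inv g) \<in> ?S" by (auto simp: Om_def GL_inv)
    then show "g \<in> fst ` ?S" by force
  qed
  ultimately show ?thesis by simp
qed

lemma Om_subset_GL: "Om a b \<subseteq> GL" by (auto simp: Om_def)

lemma cball_GL:
  obtains r where "r > 0" "cball (mat 1 :: real^'n^'n) r \<subseteq> GL"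
  using open_GL mat1_in_GL open_contains_cball by metis

lemma matrix_mult_norm_bound:
  obtains K where "K \<ge> 1" "\<And>(A :: real^'n^'n) (B :: real^'n^'n). norm (A ** B) \<le> K * norm A * norm B"
proof -
  have "\<exists>K>0. \<forall>(A :: real^'n^'n) (B :: real^'n^'n). norm (A ** B) \<le> norm A * norm B * K"
    by (rule bounded_bilinear.pos_bounded[OF bounded_bilinear_matrix_mult])
  then obtain K where K: "K > 0" "\<And>(A :: real^'n^'n) (B :: real^'n^'n). norm (A ** B) \<le> norm A * norm B * K"
    by auto
  have "norm (A ** B) \<le> (max 1 K) * norm A * norm B" for A B :: "real^'n^'n"
  proof -
    have "norm (A ** B) \<le> K * (norm A * norm B)" using K(2)[of A B] by (simp add: mult_ac)
    also have "\<dots> \<le> max 1 K * (norm A * norm B)" by (intro mult_right_mono) auto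
    finally show ?thesis by (simp add: mult_ac)
  qed
  then show ?thesis using that[of "max 1 K"] by simp
qed

section \<open>Haar measures\<close>

definition matrix_subgroup :: "(real^'n^'n) set \<Rightarrow> bool" where
  "matrix_subgroup H \<longleftrightarrow> H \<subseteq> GL \<and> mat 1 \<in> H \<and> (\<forall>g\<in>H. \<forall>h\<in>H. g ** h \<in> H) \<and> (\<forall>g\<in>H. matrix_inv g \<in> H)"

lemma matrix_subgroup_GL: "matrix_subgroup GL"
  by (simp add: matrix_subgroup_def mat1_in_GL GL_mult GL_inv)

lemma haar_space: "haar_measure_on H \<mu> \<Longrightarrow> space \<mu> = H"
  unfolding haar_measure_on_def using sets_eq_imp_space_eq[of \<mu> "restrict_space borel H"]
  by (simp add: space_restrict_space)

lemma haar_sets: "haar_measure_on H \<mu> \<Longrightarrow> A \<in> sets \<mu> \<longleftrightarrow> (\<exists>B\<in>sets borel. A = H \<inter> B)"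
  unfolding haar_measure_on_def by (auto simp: sets_restrict_space)

lemma haar_borel_sets: "haar_measure_on H \<mu> \<Longrightarrow> A \<in> sets borel \<Longrightarrow> A \<subseteq> H \<Longrightarrow> A \<in> sets \<mu>"
  using haar_sets by blast

lemma haar_measurable_continuous:
  assumes "haar_measure_on H \<mu>" "continuous_on H f"
  shows "f \<in> borel_measurable \<mu>"
proof -
  have "sets \<mu> = sets (restrict_space borel H)" using assms(1) by (simp add: haar_measure_on_def)
  then show ?thesis
    using borel_measurable_continuous_on_restrict[OF assms(2)] measurable_cong_sets[OF _ refl] by blast
qed

lemma haar_left_mult_measurable:
  assumes "haar_measure_on H \<mu>" "matrix_subgroup H" "h \<in> H"
  shows "(\<lambda>x. h ** x) \<in> measurable \<mu> \<mu>"
proof -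
  have s: "sets \<mu> = sets (restrict_space borel H)" using assms(1) by (simp add: haar_measure_on_def)
  have "(\<lambda>x. h ** x) \<in> borel_measurable borel"
    by (intro borel_measurable_continuous_onI continuous_intros)
  then have "(\<lambda>x. h ** x) \<in> measurable (restrict_space borel H) (restrict_space borel H)"
    by (rule measurable_restrict_space3) (use assms in \<open>auto simp: matrix_subgroup_def\<close>)
  then show ?thesis using measurable_cong_sets[OF s s] by blast
qed

lemma haar_nn_integral_left:
  assumes "haar_measure_on H \<mu>" "matrix_subgroup H" "h \<in> H" "f \<in> borel_measurable \<mu>"
  shows "(\<integral>\<^sup>+x. f (h ** x) \<partial>\<mu>) = (\<integral>\<^sup>+x. f x \<partial>\<mu>)"
proof -
  have "distr \<mu> \<mu> (\<lambda>x. h ** x) = \<mu>" using assms unfolding haar_measure_on_def by blast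
  then show ?thesis
    using nn_integral_distr[OF haar_left_mult_measurable[OF assms(1-3)], of f] assms(4) by simp
qed

lemma haar_emeasure_translate:
  assumes H: "haar_measure_on H \<mu>" "matrix_subgroup H" "h \<in> H" and A: "A \<in> sets \<mu>"
  shows "(\<lambda>x. h ** x) ` A \<in> sets \<mu>" "emeasure \<mu> ((\<lambda>x. h ** x) ` A) = emeasure \<mu> A"
proof -
  have AH: "A \<subseteq> H" using haar_space[OF H(1)] sets.sets_into_space[OF A] by simp
  have hG: "h \<in> GL" "matrix_inv h \<in> H" using H by (auto simp: matrix_subgroup_def)
  have eq: "(\<lambda>x. h ** x) ` A = (\<lambda>x. matrix_inv h ** x) -` A \<inter> space \<mu>"
  proof (intro equalityI subsetI)
    fix x assume "x \<in> (\<lambda>x. h ** x) ` A"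
    then show "x \<in> (\<lambda>x. matrix_inv h ** x) -` A \<inter> space \<mu>"
      using AH H by (auto simp: haar_space[OF H(1)] matrix_mul_assoc GL_inv[OF hG(1)] matrix_subgroup_def)
  next
    fix x assume "x \<in> (\<lambda>x. matrix_inv h ** x) -` A \<inter> space \<mu>"
    then show "x \<in> (\<lambda>x. h ** x) ` A"
      by (intro image_eqI[of _ _ "matrix_inv h ** x"]) (auto simp: matrix_mul_assoc GL_inv[OF hG(1)])
  qed
  have m: "(\<lambda>x. matrix_inv h ** x) \<in> measurable \<mu> \<mu>"
    by (rule haar_left_mult_measurable[OF H(1,2) hG(2)])
  show "(\<lambda>x. h ** x) ` A \<in> sets \<mu>" unfolding eq using m A by (rule measurable_sets)
  have "distr \<mu> \<mu> (\<lambda>x. matrix_inv h ** x) = \<mu>" using H hG unfolding haar_measure_on_def by blast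
  then show "emeasure \<mu> ((\<lambda>x. h ** x) ` A) = emeasure \<mu> A"
    unfolding eq using emeasure_distr[OF m A] by simp
qed

text \<open>The matrices of a cell of the grid of mesh \<open>\<epsilon>\<close> lie in one translate of a fixed neighbourhood
  of the identity, and there are polynomially many cells.\<close>

lemma haar_polynomial_growth:
  fixes \<mu> :: "(real^'n^'n) measure"
  assumes H: "haar_measure_on GL \<mu>"
  shows "\<exists>C\<ge>0. \<forall>a\<ge>1. emeasure \<mu> (Om a b) \<le> ennreal (C * a ^ (CARD('n) * CARD('n)))"
proof -
  define N where "N = CARD('n) * CARD('n)"
  obtain r where r: "r > 0" "cball (mat 1 :: real^'n^'n) r \<subseteq> GL" by (rule cball_GL)
  obtain K where K: "K \<ge> 1" "\<And>(A :: real^'n^'n) (B :: real^'n^'n). norm (A ** B) \<le> K * norm A * norm B"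
    using matrix_mult_norm_bound by blast
  define U where "U = cball (mat 1 :: real^'n^'n) r"
  have U: "U \<in> sets \<mu>" "emeasure \<mu> U < \<infinity>"
    using r H haar_borel_sets[OF H, of U] by (auto simp: U_def haar_measure_on_def)
  define m where "m = enn2real (emeasure \<mu> U)"
  have m: "emeasure \<mu> U = ennreal m" "m \<ge> 0" using U(2) by (auto simp: m_def)
  \<comment> \<open>Two matrices of one cell differ by at most \<open>N * \<epsilon>\<close> in
    norm, so this mesh gives \<open>K * (\<bar>b\<bar> + 1) * N * \<epsilon> = r\<close> as a bound
    for the distance of \<open>matrix_inv g0 ** g\<close> from the identity.\<close>
  define \<epsilon> where "\<epsilon> = r / (K * (\<bar>b\<bar> + 1) * real N)"
  have N: "real N > 0" by (simp add: N_def)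
  have \<epsilon>: "\<epsilon> > 0" using r K N by (simp add: \<epsilon>_def)
  define z where "z g = (\<lambda>(i, j). \<lfloor>g $ i $ j / \<epsilon>\<rfloor>)" for g :: "real^'n^'n"
  \<comment> \<open>An entry falls into at most \<open>2 * M + 1\<close> cells with
    \<open>M \<le> a / \<epsilon> + 2\<close>, and \<open>a \<ge> 1\<close> bounds
    \<open>2 * a / \<epsilon> + 5\<close> by \<open>(2 / \<epsilon> + 5) * a\<close>.\<close>
  define C where "C = (2 / \<epsilon> + 5) ^ N * m"
  have "emeasure \<mu> (Om a b) \<le> ennreal (C * a ^ N)" if a: "a \<ge> 1" for a
  proof -
    define M where "M = \<lceil>a / \<epsilon>\<rceil> + 1"
    have "a / \<epsilon> \<ge> 0" using a \<epsilon> by simp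
    then have M: "M \<ge> 0" unfolding M_def by linarith
    define Z where "Z = z ` (Om a b :: (real^'n^'n) set)"
    have Zsub: "Z \<subseteq> PiE UNIV (\<lambda>_. {-M..M})"
    proof
      fix f assume "f \<in> Z"
      then obtain g where g: "g \<in> Om a b" "f = z g" by (auto simp: Z_def)
      have "\<bar>g $ i $ j\<bar> \<le> a" for i j
        using component_le_norm_cart[of "g $ i" j] Finite_Cartesian_Product.norm_nth_le[of g i] g by (auto simp: Om_def)
      then have "\<bar>g $ i $ j / \<epsilon>\<bar> \<le> a / \<epsilon>" for i j
        using \<epsilon> by (simp add: abs_divide divide_right_mono)
      note y = this
      have "- M \<le> \<lfloor>g $ i $ j / \<epsilon>\<rfloor> \<and> \<lfloor>g $ i $ j / \<epsilon>\<rfloor> \<le> M" for i j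
      proof -
        have "\<bar>y\<bar> \<le> A \<Longrightarrow> - (\<lceil>A\<rceil> + 1) \<le> \<lfloor>y\<rfloor> \<and> \<lfloor>y\<rfloor> \<le> \<lceil>A\<rceil> + 1" for y A :: real
          by linarith
        then show ?thesis using y unfolding M_def by blast
      qed
      then show "f \<in> PiE UNIV (\<lambda>_. {-M..M})" by (auto simp: g(2) z_def split: prod.splits)
    qed
    have fin: "finite (PiE (UNIV :: ('n \<times> 'n) set) (\<lambda>_. {-M..M}))" by (intro finite_PiE) auto
    have finZ: "finite Z" using Zsub fin by (rule finite_subset)
    have "real (card Z) \<le> real (nat (2 * M + 1)) ^ N"
    proof -
      have "card Z \<le> card (PiE (UNIV :: ('n \<times> 'n) set) (\<lambda>_. {-M..M}))"
        using Zsub fin by (rule card_mono[rotated])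
      also have "\<dots> = nat (2 * M + 1) ^ N"
        by (simp add: card_PiE N_def card_cartesian_product UNIV_Times_UNIV[symmetric] del: UNIV_Times_UNIV)
      finally show ?thesis by (metis of_nat_le_iff of_nat_power)
    qed
    also have "\<dots> \<le> ((2 / \<epsilon> + 5) * a) ^ N"
    proof (rule power_mono)
      have "real (nat (2 * M + 1)) = 2 * of_int M + 1" using M by simp
      also have "of_int M \<le> a / \<epsilon> + 2" unfolding M_def by linarith
      also have "2 * (a / \<epsilon> + 2) + 1 \<le> (2 / \<epsilon> + 5) * a" using a by (simp add: algebra_simps)
      finally show "real (nat (2 * M + 1)) \<le> (2 / \<epsilon> + 5) * a" by simp
    qed simp
    finally have cardZ: "real (card Z) \<le> (2 / \<epsilon> + 5) ^ N * a ^ N" by (simp add: power_mult_distrib)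
    \<comment> \<open>Each occupied cell is represented by one of its members in
      \<open>Om a b\<close>, since the inverse of the representative must be bounded by
      \<open>b\<close>.\<close>
    define s where "s f = (SOME g :: real^'n^'n. g \<in> Om a b \<and> z g = f)" for f
    have s: "s f \<in> Om a b \<and> z (s f) = f" if "f \<in> Z" for f
    proof -
      from that have "\<exists>g :: real^'n^'n. g \<in> Om a b \<and> z g = f" by (auto simp: Z_def)
      then show ?thesis unfolding s_def by (rule someI_ex)
    qed
    have cov: "Om a b \<subseteq> (\<Union>f\<in>Z. (\<lambda>x. s f ** x) ` U)"
    proof
      fix g :: "real^'n^'n" assume g: "g \<in> Om a b"
      define g0 where "g0 = s (z g)"
      have zZ: "z g \<in> Z" using g by (auto simp: Z_def)
      have g0: "g0 \<in> Om a b" "z g0 = z g" using s[OF zZ] by (auto simp: g0_def)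
      have g0': "g0 \<in> GL" "norm (matrix_inv g0) \<le> \<bar>b\<bar> + 1" using g0 by (auto simp: Om_def)
      have "\<bar>(g - g0) $ i $ j\<bar> \<le> \<epsilon>" for i j
      proof -
        have "\<lfloor>g $ i $ j / \<epsilon>\<rfloor> = \<lfloor>g0 $ i $ j / \<epsilon>\<rfloor>" using fun_cong[OF g0(2), of "(i, j)"] by (simp add: z_def)
        then have "\<bar>g $ i $ j / \<epsilon> - g0 $ i $ j / \<epsilon>\<bar> \<le> 1" by linarith
        then have "\<bar>(g $ i $ j - g0 $ i $ j) / \<epsilon>\<bar> \<le> 1" by (simp add: diff_divide_distrib)
        then show ?thesis using \<epsilon> by (simp add: abs_divide)
      qed
      then have "norm (cmat (g - g0)) \<le> real CARD('n) * real CARD('n) * \<epsilon>"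
        by (intro norm_matrix_le) (simp flip: of_real_diff)
      then have d: "norm (g - g0) \<le> real N * \<epsilon>" by (simp add: norm_cmat N_def)
      have "matrix_inv g0 ** g - mat 1 = matrix_inv g0 ** (g - g0)"
        by (simp add: bounded_bilinear.diff_right[OF bounded_bilinear_matrix_mult] GL_inv[OF g0'(1)])
      then have "norm (matrix_inv g0 ** g - mat 1) \<le> K * norm (matrix_inv g0) * norm (g - g0)"
        using K(2) by metis
      also have "\<dots> \<le> K * (\<bar>b\<bar> + 1) * (real N * \<epsilon>)"
        using K(1) g0'(2) d by (intro mult_mono) auto
      also have "\<dots> = r" using K N by (simp add: \<epsilon>_def)
      finally have "matrix_inv g0 ** g \<in> U" by (simp add: U_def dist_norm norm_minus_commute)
      moreover have "g = g0 ** (matrix_inv g0 ** g)" by (simp add: matrix_mul_assoc GL_inv[OF g0'(1)])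
      ultimately show "g \<in> (\<Union>f\<in>Z. (\<lambda>x. s f ** x) ` U)" using zZ unfolding g0_def by blast
    qed
    have sU: "(\<lambda>x. s f ** x) ` U \<in> sets \<mu>" "emeasure \<mu> ((\<lambda>x. s f ** x) ` U) = ennreal m" if "f \<in> Z" for f
      using haar_emeasure_translate[OF H matrix_subgroup_GL _ U(1), of "s f"] s[OF that] m by (auto simp: Om_def)
    have "emeasure \<mu> (Om a b) \<le> emeasure \<mu> (\<Union>f\<in>Z. (\<lambda>x. s f ** x) ` U)"
      using cov sU finZ by (intro emeasure_mono) auto
    also have "\<dots> \<le> (\<Sum>f\<in>Z. emeasure \<mu> ((\<lambda>x. s f ** x) ` U))"
      using sU finZ by (intro emeasure_subadditive_finite) auto
    also have "\<dots> = ennreal (real (card Z) * m)"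
      using sU m(2) by (simp add: ennreal_mult ennreal_of_nat_eq_real_of_nat)
    also have "\<dots> \<le> ennreal (C * a ^ N)"
      unfolding C_def using mult_right_mono[OF cardZ m(2)] by (intro ennreal_leI) (simp add: mult_ac)
    finally show ?thesis .
  qed
  moreover have "C \<ge> 0" using \<epsilon> m(2) by (simp add: C_def)
  ultimately show ?thesis unfolding N_def by blast
qed

section \<open>Quotients by a torus\<close>

lemma coset_rep:
  assumes "matrix_subgroup H" "c \<in> cosets H"
  shows "coset_rep c \<in> c" "coset_rep c \<in> GL" "c = (\<lambda>h. h ** coset_rep c) ` H" "c \<subseteq> GL"
proof -
  obtain g where g: "g \<in> GL" "c = (\<lambda>h. h ** g) ` H" using assms(2) by (auto simp: cosets_def)
  have H: "H \<subseteq> GL" "mat 1 \<in> H" "\<And>a b. a \<in> H \<Longrightarrow> b \<in> H \<Longrightarrow> a ** b \<in> H" "\<And>a. a \<in> H \<Longrightarrow> matrix_inv a \<in> H"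
    using assms(1) by (auto simp: matrix_subgroup_def)
  have "mat 1 ** g \<in> c" unfolding g(2) using H(2) by (rule imageI)
  then show r: "coset_rep c \<in> c" unfolding coset_rep_def by (rule someI)
  show cG: "c \<subseteq> GL" using g H by (auto intro: GL_mult)
  then show "coset_rep c \<in> GL" using r by blast
  obtain s where s: "s \<in> H" "coset_rep c = s ** g" using r unfolding g(2) by blast
  have sG: "s \<in> GL" using s H by blast
  show "c = (\<lambda>h. h ** coset_rep c) ` H"
  proof (intro equalityI subsetI)
    fix x assume "x \<in> c"
    then obtain h where h: "h \<in> H" "x = h ** g" unfolding g(2) by blast
    have "x = (h ** matrix_inv s) ** coset_rep c"
    proof -
      have "(h ** matrix_inv s) ** coset_rep c = h ** (matrix_inv s ** s) ** g"
        unfolding s(2) by (simp only: matrix_mul_assoc)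
      then show ?thesis by (simp add: h GL_inv[OF sG])
    qed
    then show "x \<in> (\<lambda>h. h ** coset_rep c) ` H" using H h s by blast
  next
    fix x assume "x \<in> (\<lambda>h. h ** coset_rep c) ` H"
    then obtain h where "h \<in> H" "x = h ** coset_rep c" by blast
    then have "x = (h ** s) ** g" "h ** s \<in> H" using s H by (auto simp: matrix_mul_assoc)
    then show "x \<in> c" unfolding g(2) by blast
  qed
qed

lemma coset_in_cosets: "g \<in> GL \<Longrightarrow> (\<lambda>h. h ** g) ` H \<in> cosets H"
  by (auto simp: cosets_def)

lemma coset_rep_eq:
  assumes "matrix_subgroup H" "g \<in> GL"
  obtains t where "t \<in> H" "coset_rep ((\<lambda>h. h ** g) ` H) = t ** g"
  using coset_rep(1)[OF assms(1) coset_in_cosets[OF assms(2)]] by blast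

lemma quotient_space: "quotient_measure \<mu> \<nu> H Q \<Longrightarrow> space Q = cosets H"
  by (simp add: quotient_measure_def)

lemma quotient_sets: "quotient_measure \<mu> \<nu> H Q \<Longrightarrow> U \<subseteq> cosets H \<Longrightarrow> open (\<Union>U) \<Longrightarrow> U \<in> sets Q"
  by (simp add: quotient_measure_def sigma_sets.Basic)

lemma quotient_formula:
  assumes "quotient_measure \<mu> \<nu> H Q"
    and "continuous_on GL h \<and> (\<forall>g\<in>GL. 0 \<le> h g) \<and>
        (\<exists>K. compact K \<and> K \<subseteq> GL \<and> (\<forall>g\<in>GL - K. h g = 0))"
  shows "(\<integral>\<^sup>+ g. ennreal (h g) \<partial>\<mu>) = (\<integral>\<^sup>+ c. (\<integral>\<^sup>+ t. ennreal (h (t ** coset_rep c)) \<partial>\<nu>) \<partial>Q)"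
  using assms unfolding quotient_measure_def by blast

text \<open>By invariance, the cosets sent into an open set have an open union, hence form one of
  the sets generating the sigma-algebra of \<open>Q\<close>.\<close>

lemma quotient_measurable:
  fixes u :: "real^'n^'n \<Rightarrow> 'b::topological_space"
  assumes H: "matrix_subgroup H" and Q: "quotient_measure \<mu> \<nu> H Q"
    and u: "continuous_on GL u" "\<And>t g. t \<in> H \<Longrightarrow> g \<in> GL \<Longrightarrow> u (t ** g) = u g"
  shows "(\<lambda>c. u (coset_rep c)) \<in> borel_measurable Q"
proof (rule borel_measurableI)
  fix S :: "'b set" assume S: "open S"
  let ?U = "{c \<in> cosets H. u (coset_rep c) \<in> S}"
  have "\<Union>?U = GL \<inter> u -` S"
  proof (intro equalityI subsetI)
    fix g assume "g \<in> \<Union>?U"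
    then obtain c where c: "c \<in> cosets H" "u (coset_rep c) \<in> S" "g \<in> c" by blast
    then obtain h where "h \<in> H" "g = h ** coset_rep c" using coset_rep(3)[OF H c(1)] by blast
    then show "g \<in> GL \<inter> u -` S" using c u(2) coset_rep[OF H c(1)] by auto
  next
    fix g assume g: "g \<in> GL \<inter> u -` S"
    then have gG: "g \<in> GL" by simp
    let ?c = "(\<lambda>h. h ** g) ` H"
    obtain t where "t \<in> H" "coset_rep ?c = t ** g" by (rule coset_rep_eq[OF H gG])
    then have "u (coset_rep ?c) \<in> S" using u(2)[of t g] g by simp
    moreover have "mat 1 ** g \<in> ?c" using H unfolding matrix_subgroup_def by blast
    ultimately show "g \<in> \<Union>?U" using coset_in_cosets[OF gG] by auto
  qed
  moreover have "open (GL \<inter> u -` S)"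
    by (rule continuous_open_preimage[OF u(1) open_GL S])
  ultimately have "?U \<in> sets Q" by (intro quotient_sets[OF Q]) auto
  moreover have "(\<lambda>c. u (coset_rep c)) -` S \<inter> space Q = ?U" by (auto simp: quotient_space[OF Q])
  ultimately show "(\<lambda>c. u (coset_rep c)) -` S \<inter> space Q \<in> sets Q" by simp
qed

text \<open>A bump between \<open>Om a b\<close> and \<open>Om (2 * a) (2 * b)\<close>. It replaces
  the indicator because the quotient formula is given for continuous functions only.\<close>

definition cutoff :: "real \<Rightarrow> real \<Rightarrow> real^'n^'n \<Rightarrow> real" where
  "cutoff a b g = max 0 (min 1 (2 - norm g / a)) * max 0 (min 1 (2 - norm (matrix_inv g) / b))"

lemma cutoff_range: "0 \<le> cutoff a b g" "cutoff a b g \<le> 1"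
  by (auto simp: cutoff_def intro!: mult_le_one)

lemma cutoff_eq_1: "a > 0 \<Longrightarrow> b > 0 \<Longrightarrow> g \<in> Om a b \<Longrightarrow> cutoff a b g = 1"
  by (auto simp: cutoff_def Om_def min_def max_def field_simps)

lemma cutoff_eq_0: "a > 0 \<Longrightarrow> b > 0 \<Longrightarrow> g \<in> GL \<Longrightarrow> g \<notin> Om (2 * a) (2 * b) \<Longrightarrow> cutoff a b g = 0"
  by (auto simp: cutoff_def Om_def min_def max_def field_simps)

lemma continuous_on_cutoff: "a > 0 \<Longrightarrow> b > 0 \<Longrightarrow> continuous_on GL (cutoff a b :: real^'n^'n \<Rightarrow> real)"
  unfolding cutoff_def by (intro continuous_intros) auto

section \<open>Tori as diagonal matrices in an eigenbasis, and the growth of their quotients\<close>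

lemma diagonal_commute:
  fixes P :: "complex^'n^'n"
  assumes P_inv: "invertible P" and diag: "cmat g ** P = P ** diagm d" "cmat h ** P = P ** diagm d'"
  shows "g ** h = h ** g"
proof -
  have "cmat (g ** h) ** P = P ** (diagm d ** diagm d')"
    unfolding cmat_mult by (metis diag matrix_mul_assoc)
  also have "\<dots> = P ** (diagm d' ** diagm d)" by (simp add: diagm_mult mult.commute)
  also have "\<dots> = cmat (h ** g) ** P" unfolding cmat_mult by (metis diag matrix_mul_assoc)
  finally show ?thesis using matrix_mult_right_cancel[OF P_inv] cmat_inject by blast
qed

text \<open>In the eigenbasis, commuting with a diagonal matrix of distinct entries forces the
  off-diagonal entries to vanish. The right side depends on \<open>P\<close> alone, so all regular
  elements diagonalised by \<open>P\<close> share one torus.\<close>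

lemma centralizer_eq_diagonal:
  fixes P :: "complex^'n^'n"
  assumes P_inv: "invertible P" and diag: "cmat \<gamma> ** P = P ** diagm \<xi>" "inj \<xi>"
  shows "centralizer \<gamma> = {g \<in> GL. \<exists>d. cmat g ** P = P ** diagm d}" (is "_ = ?T")
proof (intro equalityI subsetI)
  fix g assume "g \<in> ?T"
  then show "g \<in> centralizer \<gamma>" using diagonal_commute[OF P_inv] diag(1) by (auto simp: centralizer_def)
next
  fix g assume g: "g \<in> centralizer \<gamma>"
  define M where "M = matrix_inv P ** cmat g ** P"
  have gM: "cmat g ** P = P ** M"
    by (simp add: M_def matrix_mul_assoc matrix_inv_eq[OF P_inv])
  have "P ** (diagm \<xi> ** M) = P ** (M ** diagm \<xi>)"
  proof -
    have "cmat \<gamma> ** cmat g = cmat g ** cmat \<gamma>"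
      using g by (simp add: centralizer_def cmat_mult[symmetric])
    then have "cmat \<gamma> ** (cmat g ** P) = cmat g ** (cmat \<gamma> ** P)" by (simp add: matrix_mul_assoc)
    then show ?thesis unfolding diag(1) gM by (metis diag(1) gM matrix_mul_assoc)
  qed
  then have "diagm \<xi> ** M = M ** diagm \<xi>" by (rule matrix_mult_left_cancel[OF P_inv])
  then have "\<xi> i * M $ i $ j = M $ i $ j * \<xi> j" for i j
    by (metis diagm_mult_nth mult_diagm_nth)
  then have "M $ i $ j = 0" if "i \<noteq> j" for i j
    using diag(2) that by (metis inj_eq mult.commute mult_right_cancel)
  then have "M = diagm (\<lambda>i. M $ i $ i)" by (simp add: vec_eq_iff diagm_def)
  then have "cmat g ** P = P ** diagm (\<lambda>i. M $ i $ i)" using gM by simp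
  then show "g \<in> ?T" using g by (auto simp: centralizer_def)
qed

text \<open>The torus is given by the basis \<open>P\<close> and not by an element, so that elements
  may move inside it while the quotient stays the same.\<close>

locale torus_quotient =
  fixes P :: "complex^'n^'n" and T :: "(real^'n^'n) set" and \<mu> \<nu> :: "(real^'n^'n) measure"
    and Q :: "(real^'n^'n) set measure"
  assumes P_inv: "invertible P"
    and T_eq: "T = {g \<in> GL. \<exists>d. cmat g ** P = P ** diagm d}"
    and haar_G: "haar_measure_on GL \<mu>"
    and haar_T: "haar_measure_on T \<nu>"
    and quot: "quotient_measure \<mu> \<nu> T Q"
begin

lemma T_subset: "T \<subseteq> GL" by (auto simp: T_eq)

lemma T_GL: "t \<in> T \<Longrightarrow> t \<in> GL" using T_subset by blast

lemma T_subgroup: "matrix_subgroup T"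
  unfolding matrix_subgroup_def
proof (intro conjI ballI T_subset)
  have "diagm (\<lambda>i. 1) = (mat 1 :: complex^'n^'n)" by (simp add: diagm_def mat_def)
  then have "cmat (mat 1) ** P = P ** diagm (\<lambda>i. 1)" by (simp add: cmat_one)
  then show "mat 1 \<in> T" using mat1_in_GL by (auto simp: T_eq)
next
  fix g h assume "g \<in> T" "h \<in> T"
  then obtain d d' where *: "g \<in> GL" "h \<in> GL" "cmat g ** P = P ** diagm d" "cmat h ** P = P ** diagm d'"
    by (auto simp: T_eq)
  have "cmat (g ** h) ** P = P ** diagm (\<lambda>i. d i * d' i)"
    unfolding cmat_mult diagm_mult[symmetric] by (metis "*"(3) "*"(4) matrix_mul_assoc)
  then show "g ** h \<in> T" using * by (auto simp: T_eq GL_mult)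
next
  fix g assume "g \<in> T"
  then obtain d where *: "g \<in> GL" "cmat g ** P = P ** diagm d" by (auto simp: T_eq)
  have "det (cmat g) \<noteq> 0" using *(1) by (simp add: GL_det det_cmat)
  then have "prod d UNIV \<noteq> 0"
    using arg_cong[OF *(2), of det] P_inv by (simp add: det_mul det_diagm invertible_det_nz)
  then have d: "d i \<noteq> 0" for i by auto
  have dd: "diagm d ** diagm (\<lambda>i. 1 / d i) = mat 1"
    using d by (simp add: diagm_mult) (simp add: diagm_def mat_def)
  have "cmat (matrix_inv g) ** P = P ** diagm (\<lambda>i. 1 / d i)"
  proof -
    have "P = cmat (matrix_inv g) ** (cmat g ** P)"
      by (simp add: matrix_mul_assoc cmat_mult[symmetric] GL_inv[OF *(1)] cmat_one)
    then have "P ** diagm (\<lambda>i. 1 / d i) = cmat (matrix_inv g) ** P ** (diagm d ** diagm (\<lambda>i. 1 / d i))"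
      unfolding *(2) by (metis matrix_mul_assoc)
    then show ?thesis by (simp add: dd)
  qed
  then show "matrix_inv g \<in> T" using * by (auto simp: T_eq GL_inv)
qed

lemma T_mult: "s \<in> T \<Longrightarrow> t \<in> T \<Longrightarrow> s ** t \<in> T"
  and T_inv: "s \<in> T \<Longrightarrow> matrix_inv s \<in> T"
  and T_one: "mat 1 \<in> T"
  using T_subgroup by (auto simp: matrix_subgroup_def)

lemma T_commute: "s \<in> T \<Longrightarrow> t \<in> T \<Longrightarrow> s ** t = t ** s"
  using diagonal_commute[OF P_inv] by (auto simp: T_eq)

text \<open>By the Lindelof property countably many translates of the neighbourhood cover the torus;
  were it a null set, the whole Haar measure would vanish.\<close>

lemma neighbourhood_of_one:
  obtains U c \<nu>0 where "U \<in> sets \<nu>" "c \<ge> 1" "\<nu>0 > 0" "ennreal \<nu>0 \<le> emeasure \<nu> U"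
    "\<And>u. u \<in> U \<Longrightarrow> u \<in> T \<and> norm u \<le> c \<and> norm (matrix_inv u) \<le> c"
proof -
  obtain r where r: "r > 0" "cball (mat 1 :: real^'n^'n) r \<subseteq> GL" by (rule cball_GL)
  define B where "B = cball (mat 1 :: real^'n^'n) r"
  have "compact (norm ` B)" "compact ((\<lambda>g. norm (matrix_inv g)) ` B)"
    using r unfolding B_def by (intro compact_continuous_image continuous_intros; auto)+
  then have "bounded (norm ` B)" "bounded ((\<lambda>g. norm (matrix_inv g)) ` B)"
    by (auto intro: compact_imp_bounded)
  then obtain c1 c2 where "\<forall>x\<in>norm ` B. norm x \<le> c1" "\<forall>x\<in>(\<lambda>g. norm (matrix_inv g)) ` B. norm x \<le> c2"
    unfolding bounded_iff by blast
  then have c12: "\<And>g. g \<in> B \<Longrightarrow> norm g \<le> c1" "\<And>g. g \<in> B \<Longrightarrow> norm (matrix_inv g) \<le> c2"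
    by auto
  define c where "c = max 1 (max c1 c2)"
  define U where "U = T \<inter> B"
  have U: "U \<in> sets \<nu>" unfolding haar_sets[OF haar_T] U_def B_def
    by (intro bexI[of _ "cball (mat 1) r"]) auto
  have Uc: "u \<in> T \<and> norm u \<le> c \<and> norm (matrix_inv u) \<le> c" if "u \<in> U" for u
  proof -
    have "u \<in> T" "u \<in> B" using that by (auto simp: U_def)
    moreover have "c1 \<le> c" "c2 \<le> c" by (auto simp: c_def)
    ultimately show ?thesis using c12(1)[of u] c12(2)[of u] by linarith
  qed
  have "emeasure \<nu> U \<noteq> 0"
  proof
    assume 0: "emeasure \<nu> U = 0"
    define O' where "O' h = (\<lambda>g. matrix_inv h ** g) -` ball (mat 1) r" for h :: "real^'n^'n"
    have op: "open (O' h)" for h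
      unfolding O'_def by (intro open_vimage continuous_intros open_ball)
    obtain F where F: "F \<subseteq> O' ` T" "countable F" "\<Union>F = \<Union>(O' ` T)"
      using Lindelof[of "O' ` T"] op by auto
    obtain C where C: "C \<subseteq> T" "countable C" "F = O' ` C"
      using countable_subset_image[of F O' T] F by blast
    have hU: "(\<lambda>x. h ** x) ` U \<in> null_sets \<nu>" if "h \<in> C" for h
      using haar_emeasure_translate[OF haar_T T_subgroup _ U, of h] that C 0 by (auto simp: null_sets_def)
    have "T \<subseteq> (\<Union>h\<in>C. (\<lambda>x. h ** x) ` U)"
    proof
      fix t assume t: "t \<in> T"
      then have "t \<in> O' t" using r T_GL by (simp add: O'_def GL_inv)
      then obtain h where h: "h \<in> C" "t \<in> O' h" using t F(3) C(3) by blast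
      have hT: "h \<in> T" using h C by blast
      have "matrix_inv h ** t \<in> U"
        using h t hT by (auto simp: U_def B_def O'_def T_mult T_inv)
      moreover have "t = h ** (matrix_inv h ** t)" by (simp add: matrix_mul_assoc GL_inv[OF T_GL[OF hT]])
      ultimately show "t \<in> (\<Union>h\<in>C. (\<lambda>x. h ** x) ` U)" using h by blast
    qed
    moreover have "(\<Union>h\<in>C. (\<lambda>x. h ** x) ` U) \<in> null_sets \<nu>"
      by (rule null_sets_UN'[OF C(2) hU])
    ultimately have "emeasure \<nu> T = 0"
      using emeasure_mono[of T "\<Union>h\<in>C. (\<lambda>x. h ** x) ` U" \<nu>] by (auto simp: null_sets_def)
    then show False using haar_T by (simp add: haar_measure_on_def)
  qed
  \<comment> \<open>Only a positive real lower bound is kept, which avoids computing with a possibly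
    infinite value.\<close>
  then obtain \<nu>0 where "ennreal \<nu>0 \<le> emeasure \<nu> U" "\<nu>0 > 0"
  proof (cases "emeasure \<nu> U")
    case (real x)
    then show ?thesis using that[of x] \<open>emeasure \<nu> U \<noteq> 0\<close> by (cases "x = 0") auto
  next
    case top
    then show ?thesis using that[of 1] by simp
  qed
  then show ?thesis using that[of U c \<nu>0] U Uc by (auto simp: c_def)
qed

text \<open>Whether the coset of \<open>g\<close> enters the region of \<open>Om a b\<close>. The
  inequalities are strict so that these cosets form an open, hence measurable, set.\<close>

definition meets :: "real \<Rightarrow> real \<Rightarrow> (real^'n^'n) \<Rightarrow> bool" where
  "meets a b g \<longleftrightarrow> (\<exists>t\<in>T. norm (t ** g) < a \<and> norm (matrix_inv (t ** g)) < b)"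

lemma meets_translate:
  assumes "s \<in> T" "g \<in> GL"
  shows "meets a b (s ** g) \<longleftrightarrow> meets a b g"
proof
  assume "meets a b (s ** g)"
  then obtain t where "t \<in> T" "norm (t ** s ** g) < a" "norm (matrix_inv (t ** s ** g)) < b"
    by (auto simp: meets_def matrix_mul_assoc)
  then show "meets a b g" unfolding meets_def using T_mult assms by blast
next
  assume "meets a b g"
  then obtain t where t: "t \<in> T" "norm (t ** g) < a" "norm (matrix_inv (t ** g)) < b"
    by (auto simp: meets_def)
  have "(t ** matrix_inv s) ** (s ** g) = t ** (matrix_inv s ** s) ** g" by (simp only: matrix_mul_assoc)
  then have "(t ** matrix_inv s) ** (s ** g) = t ** g" by (simp add: GL_inv T_GL assms)
  then show "meets a b (s ** g)" unfolding meets_def using t T_mult T_inv assms by metis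
qed

lemma open_meets: "open {g \<in> GL. meets a b g}"
proof -
  have "{g \<in> GL. meets a b g} = (\<Union>t\<in>T. (GL \<inter> (\<lambda>g. (norm (t ** g), norm (matrix_inv (t ** g)))) -` ({..<a} \<times> {..<b})))"
    by (auto simp: meets_def)
  moreover have "open (GL \<inter> (\<lambda>g. (norm (t ** g), norm (matrix_inv (t ** g)))) -` ({..<a} \<times> {..<b}))"
    if "t \<in> T" for t
    using that by (intro continuous_open_preimage open_GL open_Times continuous_intros) (auto intro: GL_mult T_GL)
  ultimately show ?thesis by (simp only:) (intro open_UN ballI)
qed

lemma meets_sets: "{c \<in> cosets T. meets a b (coset_rep c)} \<in> sets Q"
proof (rule quotient_sets[OF quot])
  have "\<Union>{c \<in> cosets T. meets a b (coset_rep c)} = {g \<in> GL. meets a b g}"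
  proof (intro equalityI subsetI)
    fix g assume "g \<in> \<Union>{c \<in> cosets T. meets a b (coset_rep c)}"
    then obtain c where c: "c \<in> cosets T" "meets a b (coset_rep c)" "g \<in> c" by blast
    then obtain h where "h \<in> T" "g = h ** coset_rep c" using coset_rep(3)[OF T_subgroup c(1)] by blast
    then show "g \<in> {g \<in> GL. meets a b g}"
      using c coset_rep[OF T_subgroup c(1)] meets_translate by auto
  next
    fix g assume g: "g \<in> {g \<in> GL. meets a b g}"
    then have gG: "g \<in> GL" by simp
    let ?c = "(\<lambda>h. h ** g) ` T"
    obtain t where "t \<in> T" "coset_rep ?c = t ** g" by (rule coset_rep_eq[OF T_subgroup gG])
    then have "meets a b (coset_rep ?c)" using meets_translate g by simp
    moreover have "mat 1 ** g \<in> ?c" using T_one by blast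
    ultimately show "g \<in> \<Union>{c \<in> cosets T. meets a b (coset_rep c)}" using coset_in_cosets[OF gG] by auto
  qed
  then show "open (\<Union>{c \<in> cosets T. meets a b (coset_rep c)})" using open_meets by simp
qed auto

text \<open>If \<open>s ** g\<close> lies in the small region, then so does
  \<open>s ** u ** g\<close>, up to a factor, for every \<open>u\<close> in a fixed neighbourhood of
  the identity, because the torus is commutative and \<open>u\<close> can be moved to the left. The
  factor \<open>\<kappa>\<close> absorbs the norms of these \<open>u\<close>, and the translate by
  \<open>s\<close> keeps their measure.\<close>

lemma cutoff_fibre_bound:
  obtains \<kappa> \<nu>0 where "\<kappa> \<ge> 1" "\<nu>0 > 0"
    "\<And>a b g. a > 0 \<Longrightarrow> b > 0 \<Longrightarrow> g \<in> GL \<Longrightarrow> meets a b g \<Longrightarrow>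
        ennreal \<nu>0 \<le> (\<integral>\<^sup>+t. ennreal (cutoff (\<kappa> * a) (\<kappa> * b) (t ** g)) \<partial>\<nu>)"
proof -
  obtain U c \<nu>0 where U: "U \<in> sets \<nu>" "c \<ge> 1" "\<nu>0 > 0" "ennreal \<nu>0 \<le> emeasure \<nu> U"
    "\<And>u. u \<in> U \<Longrightarrow> u \<in> T \<and> norm u \<le> c \<and> norm (matrix_inv u) \<le> c"
    by (rule neighbourhood_of_one) blast
  obtain K where K: "K \<ge> 1" "\<And>(A :: real^'n^'n) (B :: real^'n^'n). norm (A ** B) \<le> K * norm A * norm B"
    using matrix_mult_norm_bound by blast
  have "ennreal \<nu>0 \<le> (\<integral>\<^sup>+t. ennreal (cutoff (K * c * a) (K * c * b) (t ** g)) \<partial>\<nu>)"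
    if ab: "a > 0" "b > 0" and g: "g \<in> GL" "meets a b g" for a b g
  proof -
    obtain s where s: "s \<in> T" "norm (s ** g) < a" "norm (matrix_inv (s ** g)) < b"
      using g(2) by (auto simp: meets_def)
    let ?V = "(\<lambda>x. s ** x) ` U"
    have V: "?V \<in> sets \<nu>" "emeasure \<nu> ?V = emeasure \<nu> U"
      using haar_emeasure_translate[OF haar_T T_subgroup s(1) U(1)] by auto
    have "cutoff (K * c * a) (K * c * b) (s ** u ** g) = 1" if u: "u \<in> U" for u
    proof (rule cutoff_eq_1)
      have uT: "u \<in> T" "norm u \<le> c" "norm (matrix_inv u) \<le> c" using U(5)[OF u] by auto
      have e: "s ** u ** g = u ** (s ** g)" using T_commute[OF s(1) uT(1)] by (simp add: matrix_mul_assoc)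
      have sg: "s ** g \<in> GL" using s g by (simp add: GL_mult T_GL)
      have "norm (u ** (s ** g)) \<le> K * norm u * norm (s ** g)" by (rule K)
      also have "\<dots> \<le> K * c * a" using K(1) uT(2) s(2) U(2) by (intro mult_mono) auto
      finally have 1: "norm (u ** (s ** g)) \<le> K * c * a" .
      have "norm (matrix_inv (s ** g) ** matrix_inv u) \<le> K * norm (matrix_inv (s ** g)) * norm (matrix_inv u)" by (rule K)
      also have "\<dots> \<le> K * b * c" using K(1) uT(3) s(3) U(2) ab by (intro mult_mono) auto
      finally have 2: "norm (matrix_inv (u ** (s ** g))) \<le> K * c * b"
        using sg uT T_GL by (simp add: matrix_inv_mult mult_ac)
      show "s ** u ** g \<in> Om (K * c * a) (K * c * b)"
        unfolding e using 1 2 sg uT T_GL by (simp add: Om_def GL_mult)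
    qed (use K(1) U(2) ab in auto)
    then have "indicator ?V t \<le> ennreal (cutoff (K * c * a) (K * c * b) (t ** g))" for t
      by (auto simp: indicator_def)
    then have "(\<integral>\<^sup>+t. indicator ?V t \<partial>\<nu>) \<le> (\<integral>\<^sup>+t. ennreal (cutoff (K * c * a) (K * c * b) (t ** g)) \<partial>\<nu>)"
      by (intro nn_integral_mono)
    then have "emeasure \<nu> U \<le> (\<integral>\<^sup>+t. ennreal (cutoff (K * c * a) (K * c * b) (t ** g)) \<partial>\<nu>)"
      by (simp add: V)
    with U(4) show ?thesis by (rule order_trans)
  qed
  moreover have "K * c \<ge> 1" using K(1) U(2) mult_mono[of 1 K 1 c] by simp
  ultimately show ?thesis using that[of "K * c" \<nu>0] U(3) by blast
qed

lemma cutoff_admissible: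
  assumes "a > 0" "b > 0"
  shows "continuous_on GL (cutoff a b) \<and> (\<forall>g\<in>GL. 0 \<le> cutoff a b g) \<and>
    (\<exists>K. compact K \<and> K \<subseteq> GL \<and> (\<forall>g\<in>GL - K. cutoff a b (g :: real^'n^'n) = 0))"
  using continuous_on_cutoff[OF assms] cutoff_range cutoff_eq_0[OF assms]
  by (intro conjI exI[of _ "Om (2 * a) (2 * b)"] compact_Om Om_subset_GL) auto

text \<open>The fibre integrals of a cutoff are at least \<open>\<nu>0\<close> on the cosets in
  question. So \<open>\<nu>0\<close> times the measure of these cosets is at most the integral of
  the cutoff over the group, and that is at most the Haar measure of a larger \<open>Om\<close>
  whose second bound does not involve \<open>a\<close>.\<close>

lemma quotient_growth:
  "\<exists>C\<ge>0. \<exists>N. \<forall>a\<ge>1. emeasure Q {c \<in> cosets T. meets a b (coset_rep c)} \<le> ennreal (C * a ^ N)"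
proof -
  \<comment> \<open>\<open>b\<close> is arbitrary, while the cutoff needs a positive second bound;
    enlarging it only admits more cosets.\<close>
  define b' where "b' = max 1 b"
  obtain \<kappa> \<nu>0 where k: "\<kappa> \<ge> 1" "\<nu>0 > 0"
    "\<And>a b g. a > 0 \<Longrightarrow> b > 0 \<Longrightarrow> g \<in> GL \<Longrightarrow> meets a b g \<Longrightarrow>
        ennreal \<nu>0 \<le> (\<integral>\<^sup>+t. ennreal (cutoff (\<kappa> * a) (\<kappa> * b) (t ** g)) \<partial>\<nu>)"
    using cutoff_fibre_bound by blast
  define N where "N = CARD('n) * CARD('n)"
  obtain C where C: "C \<ge> 0" "\<And>a. a \<ge> 1 \<Longrightarrow> emeasure \<mu> (Om a (2 * (\<kappa> * b'))) \<le> ennreal (C * a ^ N)"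
    unfolding N_def using haar_polynomial_growth[OF haar_G] by blast
  define C' where "C' = C * (2 * \<kappa>) ^ N / \<nu>0"
  have "emeasure Q {c \<in> cosets T. meets a b (coset_rep c)} \<le> ennreal (C' * a ^ N)" if a: "a \<ge> 1" for a
  proof -
    let ?E = "{c \<in> cosets T. meets a b (coset_rep c)}"
    let ?h = "cutoff (\<kappa> * a) (\<kappa> * b') :: real^'n^'n \<Rightarrow> real"
    have pos: "\<kappa> * a > 0" "\<kappa> * b' > 0" using k(1) a by (auto simp: b'_def zero_less_mult_iff)
    have "ennreal \<nu>0 * emeasure Q ?E = (\<integral>\<^sup>+c. ennreal \<nu>0 * indicator ?E c \<partial>Q)"
      by (simp add: nn_integral_cmult_indicator[OF meets_sets])
    also have "\<dots> \<le> (\<integral>\<^sup>+c. (\<integral>\<^sup>+t. ennreal (?h (t ** coset_rep c)) \<partial>\<nu>) \<partial>Q)"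
    proof (rule nn_integral_mono)
      fix c assume "c \<in> space Q"
      then have c: "c \<in> cosets T" by (simp add: quotient_space[OF quot])
      show "ennreal \<nu>0 * indicator ?E c \<le> (\<integral>\<^sup>+t. ennreal (?h (t ** coset_rep c)) \<partial>\<nu>)"
      proof (cases "c \<in> ?E")
        case True
        have "meets a b' (coset_rep c)" using True unfolding meets_def b'_def by force
        then show ?thesis using k(3)[of a b' "coset_rep c"] True a coset_rep(2)[OF T_subgroup c]
          by (simp add: b'_def)
      qed simp
    qed
    also have "\<dots> = (\<integral>\<^sup>+g. ennreal (?h g) \<partial>\<mu>)"
      by (rule quotient_formula[OF quot cutoff_admissible[OF pos], symmetric])
    also have "\<dots> \<le> (\<integral>\<^sup>+g. indicator (Om (2 * (\<kappa> * a)) (2 * (\<kappa> * b'))) g \<partial>\<mu>)"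
    proof (rule nn_integral_mono)
      fix g assume "g \<in> space \<mu>"
      then have "g \<in> GL" by (simp add: haar_space[OF haar_G])
      then show "ennreal (?h g) \<le> indicator (Om (2 * (\<kappa> * a)) (2 * (\<kappa> * b'))) g"
        using cutoff_eq_0[OF pos, of g] cutoff_range(2)[of "\<kappa> * a" "\<kappa> * b'" g]
        by (auto simp: indicator_def ennreal_le_1)
    qed
    also have "\<dots> = emeasure \<mu> (Om (2 * (\<kappa> * a)) (2 * (\<kappa> * b')))"
      by (intro nn_integral_indicator haar_borel_sets[OF haar_G] Om_subset_GL borel_compact compact_Om)
    also have "\<dots> \<le> ennreal (C * (2 * (\<kappa> * a)) ^ N)"
      by (rule C(2)) (use k(1) a in \<open>simp add: mult_ge1_I\<close>)
    also have "C * (2 * (\<kappa> * a)) ^ N = \<nu>0 * (C' * a ^ N)"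
      using k(2) by (simp add: C'_def power_mult_distrib)
    also have "ennreal \<dots> = ennreal \<nu>0 * ennreal (C' * a ^ N)"
      using k(2) by (simp add: ennreal_mult')
    finally have "ennreal \<nu>0 * emeasure Q ?E \<le> ennreal \<nu>0 * ennreal (C' * a ^ N)" .
    then show ?thesis
      using k(2) by (subst (asm) ennreal_mult_le_mult_iff) auto
  qed
  moreover have "C' \<ge> 0" using C(1) k by (simp add: C'_def)
  ultimately show ?thesis by blast
qed

end

section \<open>Unfolding of invariant functions and transport to a conjugate torus\<close>

definition unfoldable :: "(real^'n^'n \<Rightarrow> real) \<Rightarrow> bool" where
  "unfoldable h \<longleftrightarrow> continuous_on GL h \<and> (\<forall>g\<in>GL. 0 \<le> h g) \<and>
    (\<exists>K. compact K \<and> K \<subseteq> GL \<and> (\<forall>g\<in>GL - K. h g = 0))"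

lemma matrix_subgroup_centralizer: "matrix_subgroup (centralizer \<gamma>)"
  unfolding matrix_subgroup_def
proof (intro conjI ballI)
  show "centralizer \<gamma> \<subseteq> GL" "mat 1 \<in> centralizer \<gamma>" by (auto simp: centralizer_def mat1_in_GL)
next
  fix g h assume "g \<in> centralizer \<gamma>" "h \<in> centralizer \<gamma>"
  then show "g ** h \<in> centralizer \<gamma>"
    unfolding centralizer_def by (auto simp: GL_mult) (metis matrix_mul_assoc)
next
  fix g assume "g \<in> centralizer \<gamma>"
  then have g: "g \<in> GL" "g ** \<gamma> = \<gamma> ** g" by (auto simp: centralizer_def)
  have "matrix_inv g ** (g ** \<gamma>) ** matrix_inv g = matrix_inv g ** (\<gamma> ** g) ** matrix_inv g"
    by (simp add: g)
  then have "\<gamma> ** matrix_inv g = matrix_inv g ** \<gamma>"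
    by (metis GL_inv(2,3)[OF g(1)] matrix_mul_assoc matrix_mul_lid matrix_mul_rid)
  then show "matrix_inv g \<in> centralizer \<gamma>" using g by (simp add: centralizer_def GL_inv)
qed

context torus_quotient
begin

text \<open>The torus is cut out by the vanishing of the off-diagonal entries in the eigenbasis. Its
  intersections with the sets \<open>Om\<close> are therefore compact and have finite Haar
  measure.\<close>

lemma T_closed_in_GL: "\<exists>C. closed C \<and> T = GL \<inter> C"
proof -
  define M where "M g = matrix_inv P ** cmat g ** P" for g :: "real^'n^'n"
  define C where "C = {g. \<forall>i j. i \<noteq> j \<longrightarrow> M g $ i $ j = 0}"
  have cont: "continuous_on UNIV (\<lambda>g. M g $ i $ j)" for i j
    unfolding M_def matrix_matrix_mult_def map_matrix_def by (simp, intro continuous_intros)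
  have "C = (\<Inter>i. \<Inter>j\<in>-{i}. {g. M g $ i $ j = 0})" by (auto simp: C_def)
  moreover have "closed {g. M g $ i $ j = 0}" for i j
    by (intro closed_Collect_eq cont continuous_on_const)
  ultimately have "closed C" by (auto intro!: closed_INT)
  moreover have "T = GL \<inter> C"
  proof -
    have "(\<exists>d. cmat g ** P = P ** diagm d) \<longleftrightarrow> g \<in> C" for g
    proof
      assume "\<exists>d. cmat g ** P = P ** diagm d"
      then obtain d where "cmat g ** P = P ** diagm d" by blast
      then have "M g = diagm d"
        by (simp add: M_def matrix_mul_assoc[symmetric]) (simp add: matrix_mul_assoc matrix_inv_eq[OF P_inv])
      then show "g \<in> C" by (simp add: C_def diagm_def)
    next
      assume "g \<in> C"
      then have "M g = diagm (\<lambda>i. M g $ i $ i)" by (auto simp: C_def diagm_def vec_eq_iff)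
      moreover have "cmat g ** P = P ** M g"
        by (simp add: M_def matrix_mul_assoc matrix_inv_eq[OF P_inv])
      ultimately show "\<exists>d. cmat g ** P = P ** diagm d" by metis
    qed
    then show ?thesis by (auto simp: T_eq)
  qed
  ultimately show ?thesis by blast
qed

lemma emeasure_T_Om: "T \<inter> Om a b \<in> sets \<nu>" "emeasure \<nu> (T \<inter> Om a b) < \<infinity>"
proof -
  obtain C where C: "closed C" "T = GL \<inter> C" using T_closed_in_GL by blast
  then have "T \<inter> Om a b = Om a b \<inter> C" using Om_subset_GL by blast
  then have "compact (T \<inter> Om a b)" using compact_Int_closed[OF compact_Om C(1)] by simp
  then show "T \<inter> Om a b \<in> sets \<nu>" "emeasure \<nu> (T \<inter> Om a b) < \<infinity>"
    using haar_borel_sets[OF haar_T borel_compact] haar_T unfolding haar_measure_on_def by auto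
qed

lemma continuous_on_T_translate:
  assumes "continuous_on GL h" "g \<in> GL" "S \<subseteq> GL"
  shows "continuous_on S (\<lambda>t. h (t ** g))"
  by (rule continuous_on_compose2[OF assms(1)])
    (use assms in \<open>auto intro!: continuous_intros GL_mult\<close>)

text \<open>The dominating indicator depends on \<open>g\<close> only through bounds for
  \<open>g\<close> and its inverse, as dominated convergence along a sequence of such
  \<open>g\<close> requires.\<close>

lemma cutoff_support:
  assumes "a > 0" "b > 0"
  obtains K where "K \<ge> 1" "\<And>t g m1 m2. t \<in> T \<Longrightarrow> g \<in> GL \<Longrightarrow> norm g \<le> m1 \<Longrightarrow> norm (matrix_inv g) \<le> m2 \<Longrightarrow>
    norm (cutoff a b (t ** g)) \<le> indicator (T \<inter> Om (K * (2 * a) * m2) (K * m1 * (2 * b))) t"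
proof -
  obtain K where K: "K \<ge> 1" "\<And>(A :: real^'n^'n) (B :: real^'n^'n). norm (A ** B) \<le> K * norm A * norm B"
    using matrix_mult_norm_bound by blast
  have "norm (cutoff a b (t ** g)) \<le> indicator (T \<inter> Om (K * (2 * a) * m2) (K * m1 * (2 * b))) t"
    if t: "t \<in> T" and g: "g \<in> GL" "norm g \<le> m1" "norm (matrix_inv g) \<le> m2" for t g m1 m2
  proof (cases "t ** g \<in> Om (2 * a) (2 * b)")
    case True
    then have tg: "norm (t ** g) \<le> 2 * a" "norm (matrix_inv (t ** g)) \<le> 2 * b" by (auto simp: Om_def)
    have tG: "t \<in> GL" using t T_GL by blast
    have 1: "t = (t ** g) ** matrix_inv g" by (simp add: matrix_mul_assoc[symmetric] GL_inv[OF g(1)])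
    have 2: "matrix_inv t = g ** matrix_inv (t ** g)"
      by (simp add: matrix_inv_mult[OF tG g(1)] matrix_mul_assoc GL_inv[OF g(1)])
    have "norm t \<le> K * norm (t ** g) * norm (matrix_inv g)" using K(2) 1 by metis
    also have "\<dots> \<le> K * (2 * a) * m2" using K(1) tg g assms by (intro mult_mono) auto
    finally have 3: "norm t \<le> K * (2 * a) * m2" .
    have "norm (matrix_inv t) \<le> K * norm g * norm (matrix_inv (t ** g))" using K(2) 2 by metis
    also have "\<dots> \<le> K * m1 * (2 * b)" using K(1) tg g order_trans[OF norm_ge_zero g(2)]
      by (intro mult_mono) auto
    finally have "t \<in> T \<inter> Om (K * (2 * a) * m2) (K * m1 * (2 * b))" using 3 t tG by (auto simp: Om_def)
    then show ?thesis using cutoff_range[of a b "t ** g"] by simp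
  next
    case False
    then have "cutoff a b (t ** g) = 0" using cutoff_eq_0[OF assms] t g T_GL GL_mult by blast
    then show ?thesis by simp
  qed
  then show ?thesis using that K(1) by blast
qed

lemma continuous_on_fibre_integral:
  assumes ab: "a > 0" "b > 0"
  shows "continuous_on GL (\<lambda>g. \<integral>t. cutoff a b (t ** g) \<partial>\<nu>)"
    and "g \<in> GL \<Longrightarrow> integrable \<nu> (\<lambda>t. cutoff a b (t ** g))"
proof -
  obtain K where K: "K \<ge> 1" "\<And>t g m1 m2. t \<in> T \<Longrightarrow> g \<in> GL \<Longrightarrow> norm g \<le> m1 \<Longrightarrow> norm (matrix_inv g) \<le> m2 \<Longrightarrow>
    norm (cutoff a b (t ** g)) \<le> indicator (T \<inter> Om (K * (2 * a) * m2) (K * m1 * (2 * b))) t"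
    using cutoff_support[OF ab] by blast
  have meas: "(\<lambda>t. cutoff a b (t ** g)) \<in> borel_measurable \<nu>" if "g \<in> GL" for g
    by (rule haar_measurable_continuous[OF haar_T continuous_on_T_translate[OF continuous_on_cutoff[OF ab] that T_subset]])
  have ind: "integrable \<nu> (indicator (T \<inter> Om p q) :: _ \<Rightarrow> real)" for p q
    using emeasure_T_Om by (simp add: integrable_indicator_iff)
  show "integrable \<nu> (\<lambda>t. cutoff a b (t ** g))" if g: "g \<in> GL"
  proof (rule Bochner_Integration.integrable_bound[OF ind meas[OF g]])
    show "AE t in \<nu>. norm (cutoff a b (t ** g)) \<le> norm (indicator (T \<inter> Om (K * (2 * a) * norm (matrix_inv g)) (K * norm g * (2 * b))) t :: real)"
      using K(2)[OF _ g order.refl order.refl] by (intro AE_I2) (simp add: haar_space[OF haar_T])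
  qed
  show "continuous_on GL (\<lambda>g. \<integral>t. cutoff a b (t ** g) \<partial>\<nu>)"
    unfolding continuous_on_sequentially
  proof (intro allI ballI impI)
    fix x :: "nat \<Rightarrow> real^'n^'n" and g
    assume g: "g \<in> GL" and "(\<forall>n. x n \<in> GL) \<and> x \<longlonglongrightarrow> g"
    then have x: "\<And>n. x n \<in> GL" "x \<longlonglongrightarrow> g" by auto
    \<comment> \<open>The sequence converges inside \<open>GL\<close>, so its inverses stay bounded
      as well and a single indicator dominates all fibres.\<close>
    have "(matrix_inv \<circ> x) \<longlonglongrightarrow> matrix_inv g"
      using continuous_on_matrix_inv x g unfolding continuous_on_sequentially by blast
    then have "Bseq (\<lambda>n. matrix_inv (x n))" "Bseq x"
      using x(2) convergentI[THEN convergent_imp_Bseq] by (auto simp: o_def)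
    then obtain m1 m2 where m: "\<And>n. norm (x n) \<le> m1" "\<And>n. norm (matrix_inv (x n)) \<le> m2"
      unfolding Bseq_def by blast
    show "((\<lambda>g. \<integral>t. cutoff a b (t ** g) \<partial>\<nu>) \<circ> x) \<longlonglongrightarrow> (\<integral>t. cutoff a b (t ** g) \<partial>\<nu>)"
      unfolding o_def
    proof (rule integral_dominated_convergence[OF meas[OF g] meas[OF x(1)] ind])
      show "AE t in \<nu>. (\<lambda>n. cutoff a b (t ** x n)) \<longlonglongrightarrow> cutoff a b (t ** g)"
      proof (rule AE_I2)
        fix t assume "t \<in> space \<nu>"
        then have t: "t \<in> GL" using T_GL by (simp add: haar_space[OF haar_T])
        have "continuous_on GL (\<lambda>g. cutoff a b (t ** g))"
          by (rule continuous_on_compose2[OF continuous_on_cutoff[OF ab]])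
            (use t in \<open>auto intro!: continuous_intros GL_mult\<close>)
        then show "(\<lambda>n. cutoff a b (t ** x n)) \<longlonglongrightarrow> cutoff a b (t ** g)"
          using x g unfolding continuous_on_sequentially o_def by blast
      qed
      show "AE t in \<nu>. norm (cutoff a b (t ** x n)) \<le> indicator (T \<inter> Om (K * (2 * a) * m2) (K * m1 * (2 * b))) t" for n
        using K(2)[OF _ x(1) m] by (intro AE_I2) (simp add: haar_space[OF haar_T])
    qed
  qed
qed

text \<open>An invariant function \<open>u\<close> is unfolded to a function on the whole group by a cutoff, normalised
  by its integral along the cosets. The maximum with a lower bound valid on the support of \<open>u\<close>
  keeps the denominator away from zero.\<close>

lemma unfolding_exists:
  assumes ab: "a > 0" "b > 0" and u: "continuous_on GL u" "\<And>g. g \<in> GL \<Longrightarrow> 0 \<le> u g"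
    "\<And>t g. t \<in> T \<Longrightarrow> g \<in> GL \<Longrightarrow> u (t ** g) = u g"
    "\<And>g. g \<in> GL \<Longrightarrow> u g \<noteq> 0 \<Longrightarrow> meets a b g"
  shows "\<exists>h. unfoldable h \<and> (\<forall>g\<in>GL. (\<integral>\<^sup>+t. ennreal (h (t ** g)) \<partial>\<nu>) = ennreal (u g))"
proof -
  obtain \<kappa> \<nu>0 where k: "\<kappa> \<ge> 1" "\<nu>0 > 0"
    "\<And>a b g. a > 0 \<Longrightarrow> b > 0 \<Longrightarrow> g \<in> GL \<Longrightarrow> meets a b g \<Longrightarrow>
        ennreal \<nu>0 \<le> (\<integral>\<^sup>+t. ennreal (cutoff (\<kappa> * a) (\<kappa> * b) (t ** g)) \<partial>\<nu>)"
    using cutoff_fibre_bound by blast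
  define \<beta> where "\<beta> = (cutoff (\<kappa> * a) (\<kappa> * b) :: real^'n^'n \<Rightarrow> real)"
  have pos: "\<kappa> * a > 0" "\<kappa> * b > 0" using k(1) ab by (auto simp: zero_less_mult_iff)
  define den where "den g = (\<integral>t. \<beta> (t ** g) \<partial>\<nu>)" for g
  have den_cont: "continuous_on GL den"
    unfolding den_def \<beta>_def by (rule continuous_on_fibre_integral[OF pos])
  have den: "(\<integral>\<^sup>+t. ennreal (\<beta> (t ** g)) \<partial>\<nu>) = ennreal (den g)" if "g \<in> GL" for g
    unfolding den_def \<beta>_def
    by (rule nn_integral_eq_integral[OF continuous_on_fibre_integral(2)[OF pos that]]) (simp add: cutoff_range)
  have den0: "den g \<ge> 0" for g unfolding den_def by (intro integral_nonneg_AE) (simp add: \<beta>_def cutoff_range)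
  \<comment> \<open>Replacing \<open>g\<close> by \<open>s ** g\<close> is a right translation along
    the fibre; commutativity turns it into a left translation, under which \<open>\<nu>\<close> is
    invariant.\<close>
  have den_inv: "den (s ** g) = den g" if "s \<in> T" "g \<in> GL" for s g
  proof -
    have "ennreal (den (s ** g)) = (\<integral>\<^sup>+t. ennreal (\<beta> (t ** (s ** g))) \<partial>\<nu>)"
      using den[OF GL_mult[OF T_GL[OF that(1)] that(2)]] by simp
    also have "\<dots> = (\<integral>\<^sup>+t. ennreal (\<beta> ((s ** t) ** g)) \<partial>\<nu>)"
      by (rule nn_integral_cong) (simp add: haar_space[OF haar_T] matrix_mul_assoc T_commute[OF that(1)])
    also have "\<dots> = (\<integral>\<^sup>+t. ennreal (\<beta> (t ** g)) \<partial>\<nu>)"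
      by (rule haar_nn_integral_left[OF haar_T T_subgroup that(1), where f="\<lambda>t. ennreal (\<beta> (t ** g))"])
        (unfold \<beta>_def, intro measurable_compose[OF haar_measurable_continuous[OF haar_T] measurable_ennreal]
          continuous_on_T_translate[OF continuous_on_cutoff[OF pos] that(2) T_subset])
    also have "\<dots> = ennreal (den g)" by (rule den[OF that(2)])
    finally show ?thesis using den0 by simp
  qed
  have den_low: "\<nu>0 \<le> den g" if "g \<in> GL" "u g \<noteq> 0" for g
  proof -
    have "ennreal \<nu>0 \<le> ennreal (den g)"
      using k(3)[OF ab that(1) u(4)[OF that]] den[OF that(1)] unfolding \<beta>_def by simp
    then show ?thesis using den0 k(2) by (simp add: ennreal_le_iff)
  qed
  define h where "h g = u g * \<beta> g / max (den g) \<nu>0" for g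
  have "unfoldable h"
    unfolding unfoldable_def
  proof (intro conjI)
    have "max (den g) \<nu>0 \<noteq> 0" for g using k(2) by (simp add: max_def)
    then show "continuous_on GL h"
      unfolding h_def \<beta>_def using u(1) den_cont continuous_on_cutoff[OF pos]
      by (intro continuous_on_divide continuous_on_mult continuous_on_max continuous_on_const) auto
    show "\<forall>g\<in>GL. 0 \<le> h g"
      using u(2) k(2) unfolding h_def \<beta>_def by (auto intro!: divide_nonneg_nonneg mult_nonneg_nonneg cutoff_range simp: le_max_iff_disj)
    show "\<exists>K. compact K \<and> K \<subseteq> GL \<and> (\<forall>g\<in>GL - K. h g = 0)"
      by (intro exI[of _ "Om (2 * (\<kappa> * a)) (2 * (\<kappa> * b))"] conjI compact_Om Om_subset_GL)
        (simp add: h_def \<beta>_def cutoff_eq_0[OF pos])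
  qed
  moreover have "(\<integral>\<^sup>+t. ennreal (h (t ** g)) \<partial>\<nu>) = ennreal (u g)" if g: "g \<in> GL" for g
  proof -
    have "(\<integral>\<^sup>+t. ennreal (h (t ** g)) \<partial>\<nu>) = (\<integral>\<^sup>+t. ennreal (u g / max (den g) \<nu>0) * ennreal (\<beta> (t ** g)) \<partial>\<nu>)"
    proof (rule nn_integral_cong)
      fix t assume "t \<in> space \<nu>"
      then have t: "t \<in> T" by (simp add: haar_space[OF haar_T])
      have "h (t ** g) = u g / max (den g) \<nu>0 * \<beta> (t ** g)"
        using t g by (simp add: h_def u(3) den_inv)
      then show "ennreal (h (t ** g)) = ennreal (u g / max (den g) \<nu>0) * ennreal (\<beta> (t ** g))"
        using u(2)[OF g] k(2) by (simp add: ennreal_mult' [symmetric] \<beta>_def cutoff_range ennreal_mult le_max_iff_disj)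
    qed
    also have "\<dots> = ennreal (u g / max (den g) \<nu>0) * ennreal (den g)"
      unfolding den[OF g, symmetric]
      by (rule nn_integral_cmult, unfold \<beta>_def, intro measurable_compose[OF haar_measurable_continuous[OF haar_T] measurable_ennreal]
          continuous_on_T_translate[OF continuous_on_cutoff[OF pos] g T_subset])
    also have "\<dots> = ennreal (u g)"
    proof (cases "u g = 0")
      case False
      then have "max (den g) \<nu>0 = den g" "den g > 0" using den_low[OF g] k(2) by auto
      then show ?thesis using u(2)[OF g] by (simp add: ennreal_mult[symmetric])
    qed simp
    finally show ?thesis .
  qed
  ultimately show ?thesis by blast
qed

text \<open>The two quotient measures are linked only through the group. The function
  \<open>u\<close> is unfolded to \<open>h\<close> on \<open>GL\<close>, \<open>h\<close> is
  translated by \<open>y\<close> using the invariance of \<open>\<mu>\<close>, and the translate is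
  folded along \<open>T'\<close>; its fibre integral is that of \<open>h\<close> along
  \<open>T\<close>, since \<open>\<nu>\<close> is transported by \<open>conjugate y\<close>.\<close>

lemma nn_integral_conjugate_quotient:
  assumes ab: "a > 0" "b > 0" and u: "continuous_on GL u" "\<And>g. g \<in> GL \<Longrightarrow> 0 \<le> u g"
    "\<And>t g. t \<in> T \<Longrightarrow> g \<in> GL \<Longrightarrow> u (t ** g) = u g"
    "\<And>g. g \<in> GL \<Longrightarrow> u g \<noteq> 0 \<Longrightarrow> meets a b g"
    and y: "y \<in> GL" and T': "matrix_subgroup T'" "T' = conjugate y ` T"
    and Q': "quotient_measure \<mu> (distr \<nu> (restrict_space borel T') (conjugate y)) T' Q'"
  shows "(\<integral>\<^sup>+c. ennreal (u (coset_rep c)) \<partial>Q) = (\<integral>\<^sup>+c. ennreal (u (y ** coset_rep c)) \<partial>Q')"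
proof -
  obtain h where h: "unfoldable h" "\<And>g. g \<in> GL \<Longrightarrow> (\<integral>\<^sup>+t. ennreal (h (t ** g)) \<partial>\<nu>) = ennreal (u g)"
    using unfolding_exists[OF ab u] by blast
  have hc: "continuous_on GL h" using h(1) by (simp add: unfoldable_def)
  define h' where "h' g = h (y ** g)" for g
  have "(\<integral>\<^sup>+c. ennreal (u (coset_rep c)) \<partial>Q) = (\<integral>\<^sup>+c. (\<integral>\<^sup>+t. ennreal (h (t ** coset_rep c)) \<partial>\<nu>) \<partial>Q)"
    by (rule nn_integral_cong) (simp add: quotient_space[OF quot] h(2) coset_rep[OF T_subgroup])
  also have "\<dots> = (\<integral>\<^sup>+g. ennreal (h g) \<partial>\<mu>)"
    by (rule quotient_formula[OF quot h(1)[unfolded unfoldable_def], symmetric])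
  also have "\<dots> = (\<integral>\<^sup>+g. ennreal (h' g) \<partial>\<mu>)"
    unfolding h'_def
    by (rule haar_nn_integral_left[OF haar_G matrix_subgroup_GL y, where f="\<lambda>g. ennreal (h g)", symmetric])
      (intro measurable_compose[OF haar_measurable_continuous[OF haar_G hc] measurable_ennreal])
  also have "\<dots> = (\<integral>\<^sup>+c. (\<integral>\<^sup>+t. ennreal (h' (t ** coset_rep c)) \<partial>distr \<nu> (restrict_space borel T') (conjugate y)) \<partial>Q')"
  proof (rule quotient_formula[OF Q'], intro conjI)
    show "continuous_on GL h'"
      unfolding h'_def
      by (rule continuous_on_compose2[OF hc]) (use y in \<open>auto intro!: continuous_intros GL_mult\<close>)
    show "\<forall>g\<in>GL. 0 \<le> h' g" using h(1) y by (auto simp: h'_def unfoldable_def GL_mult)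
    obtain K where K: "compact K" "K \<subseteq> GL" "\<And>g. g \<in> GL - K \<Longrightarrow> h g = 0"
      using h(1) unfolding unfoldable_def by blast
    have "compact ((\<lambda>g. matrix_inv y ** g) ` K)"
      by (intro compact_continuous_image continuous_intros K)
    moreover have "(\<lambda>g. matrix_inv y ** g) ` K \<subseteq> GL" using K y by (auto intro!: GL_mult GL_inv)
    moreover have "h' g = 0" if "g \<in> GL - (\<lambda>g. matrix_inv y ** g) ` K" for g
    proof -
      have "g = matrix_inv y ** (y ** g)" by (simp add: matrix_mul_assoc GL_inv[OF y])
      then have "y ** g \<notin> K" using that by blast
      then show ?thesis using K(3)[of "y ** g"] that y by (simp add: h'_def GL_mult)
    qed
    ultimately show "\<exists>K. compact K \<and> K \<subseteq> GL \<and> (\<forall>g\<in>GL - K. h' g = 0)" by blast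
  qed
  also have "\<dots> = (\<integral>\<^sup>+c. ennreal (u (y ** coset_rep c)) \<partial>Q')"
  proof (rule nn_integral_cong)
    fix c assume "c \<in> space Q'"
    then have r: "coset_rep c \<in> GL" using coset_rep(2)[OF T'(1)] by (simp add: quotient_space[OF Q'])
    have T'G: "T' \<subseteq> GL" using T'(1) by (simp add: matrix_subgroup_def)
    have cm: "conjugate y \<in> measurable \<nu> (restrict_space borel T')"
    proof -
      have "conjugate y \<in> borel_measurable borel"
        unfolding conjugate_def[abs_def] by (intro borel_measurable_continuous_onI continuous_intros)
      then have "conjugate y \<in> measurable (restrict_space borel T) (restrict_space borel T')"
        by (rule measurable_restrict_space3) (use T' in auto)
      then show ?thesis using haar_T measurable_cong_sets[OF _ refl] unfolding haar_measure_on_def by blast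
    qed
    have hm: "(\<lambda>t. ennreal (h' (t ** coset_rep c))) \<in> borel_measurable (restrict_space borel T')"
      unfolding h'_def matrix_mul_assoc
      by (intro measurable_compose[OF borel_measurable_continuous_on_restrict measurable_ennreal]
          continuous_on_compose2[OF hc] continuous_intros)
        (use T'G y r in \<open>auto intro!: GL_mult\<close>)
    have "(\<integral>\<^sup>+t. ennreal (h' (t ** coset_rep c)) \<partial>distr \<nu> (restrict_space borel T') (conjugate y))
        = (\<integral>\<^sup>+t. ennreal (h' (conjugate y t ** coset_rep c)) \<partial>\<nu>)"
      by (rule nn_integral_distr[OF cm]) (simp add: hm)
    also have "\<dots> = (\<integral>\<^sup>+t. ennreal (h (t ** (y ** coset_rep c))) \<partial>\<nu>)"
    proof (rule nn_integral_cong)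
      fix t
      have "y ** (conjugate y t ** coset_rep c) = (y ** matrix_inv y) ** t ** (y ** coset_rep c)"
        unfolding conjugate_def by (simp only: matrix_mul_assoc)
      then show "ennreal (h' (conjugate y t ** coset_rep c)) = ennreal (h (t ** (y ** coset_rep c)))"
        by (simp add: h'_def GL_inv[OF y])
    qed
    also have "\<dots> = ennreal (u (y ** coset_rep c))" by (rule h(2)) (simp add: GL_mult y r)
    finally show "(\<integral>\<^sup>+t. ennreal (h' (t ** coset_rep c)) \<partial>distr \<nu> (restrict_space borel T') (conjugate y))
      = ennreal (u (y ** coset_rep c))" .
  qed
  finally show ?thesis .
qed

lemma quotient_integrable:
  fixes v :: "real^'n^'n \<Rightarrow> 'b::{banach,second_countable_topology}"
  assumes v: "continuous_on GL v" "\<And>t g. t \<in> T \<Longrightarrow> g \<in> GL \<Longrightarrow> v (t ** g) = v g"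
    "\<And>g. g \<in> GL \<Longrightarrow> v g \<noteq> 0 \<Longrightarrow> meets a b g" "\<And>g. g \<in> GL \<Longrightarrow> norm (v g) \<le> B"
  shows "integrable Q (\<lambda>c. v (coset_rep c))"
proof (rule integrableI_bounded_set)
  show "{c \<in> cosets T. meets a b (coset_rep c)} \<in> sets Q" by (rule meets_sets)
  obtain C N where C: "\<And>a. a \<ge> 1 \<Longrightarrow> emeasure Q {c \<in> cosets T. meets a b (coset_rep c)} \<le> ennreal (C * a ^ N)"
    using quotient_growth[of b] by blast
  have "emeasure Q {c \<in> cosets T. meets a b (coset_rep c)}
      \<le> emeasure Q {c \<in> cosets T. meets (max 1 a) b (coset_rep c)}"
    by (rule emeasure_mono[OF _ meets_sets]) (auto simp: meets_def less_max_iff_disj)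
  also have "\<dots> \<le> ennreal (C * max 1 a ^ N)" by (rule C) simp
  finally have "emeasure Q {c \<in> cosets T. meets a b (coset_rep c)} \<le> ennreal (C * max 1 a ^ N)" .
  then show "emeasure Q {c \<in> cosets T. meets a b (coset_rep c)} < \<infinity>"
    by (rule le_less_trans) simp
  show "(\<lambda>c. v (coset_rep c)) \<in> borel_measurable Q"
    by (rule quotient_measurable[OF T_subgroup quot v(1,2)])
  show "AE c in Q. c \<in> {c \<in> cosets T. meets a b (coset_rep c)} \<longrightarrow> norm (v (coset_rep c)) \<le> B"
    by (intro AE_I2) (auto simp: v(4) coset_rep[OF T_subgroup])
  show "AE c in Q. c \<notin> {c \<in> cosets T. meets a b (coset_rep c)} \<longrightarrow> v (coset_rep c) = 0"
    using v(3) coset_rep(2)[OF T_subgroup] by (intro AE_I2) (auto simp: quotient_space[OF quot])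
qed

text \<open>Reduction to nonnegative functions by composing with \<open>w\<close>: the norm gives
  integrability on \<open>Q'\<close>, and real and imaginary parts with both signs give the value.
  The condition \<open>w 0 = 0\<close> keeps the support.\<close>

lemma integral_conjugate_quotient:
  fixes v :: "real^'n^'n \<Rightarrow> complex"
  assumes ab: "a > 0" "b > 0" and v: "continuous_on GL v" "\<And>t g. t \<in> T \<Longrightarrow> g \<in> GL \<Longrightarrow> v (t ** g) = v g"
    "\<And>g. g \<in> GL \<Longrightarrow> v g \<noteq> 0 \<Longrightarrow> meets a b g" "\<And>g. g \<in> GL \<Longrightarrow> norm (v g) \<le> B"
    and y: "y \<in> GL" and T': "matrix_subgroup T'" "T' = conjugate y ` T"
    and Q': "quotient_measure \<mu> (distr \<nu> (restrict_space borel T') (conjugate y)) T' Q'"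
  shows "(\<integral>c. v (coset_rep c) \<partial>Q) = (\<integral>c. v (y ** coset_rep c) \<partial>Q')"
proof -
  have int: "integrable Q (\<lambda>c. v (coset_rep c))" by (rule quotient_integrable[OF v])
  have vy: "continuous_on GL (\<lambda>g. v (y ** g))"
    by (rule continuous_on_compose2[OF v(1)]) (use y in \<open>auto intro!: continuous_intros GL_mult\<close>)
  have meas: "(\<lambda>c. v (y ** coset_rep c)) \<in> borel_measurable Q'"
  proof (rule quotient_measurable[OF T'(1) Q' vy])
    fix t g :: "real^'n^'n" assume "t \<in> T'" and g: "g \<in> GL"
    then obtain s where s: "s \<in> T" "t = conjugate y s" using T'(2) by blast
    have "y ** (t ** g) = (y ** matrix_inv y) ** s ** (y ** g)"
      unfolding s(2) conjugate_def by (simp only: matrix_mul_assoc)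
    then have "y ** (t ** g) = s ** (y ** g)" by (simp add: GL_inv[OF y])
    then show "v (y ** (t ** g)) = v (y ** g)" using v(2)[OF s(1) GL_mult[OF y g]] by simp
  qed
  have nn: "(\<integral>\<^sup>+c. ennreal (w (v (coset_rep c))) \<partial>Q) = (\<integral>\<^sup>+c. ennreal (w (v (y ** coset_rep c))) \<partial>Q')"
    if w: "continuous_on UNIV w" "w 0 = (0::real)" for w
  proof -
    have "(\<integral>\<^sup>+c. ennreal (max 0 (w (v (coset_rep c)))) \<partial>Q) = (\<integral>\<^sup>+c. ennreal (max 0 (w (v (y ** coset_rep c)))) \<partial>Q')"
    proof (rule nn_integral_conjugate_quotient[OF ab _ _ _ _ y T' Q'])
      show "continuous_on GL (\<lambda>g. max 0 (w (v g)))"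
        by (intro continuous_on_max continuous_on_const continuous_on_compose2[OF w(1) v(1)]) auto
      show "meets a b g" if "g \<in> GL" "max 0 (w (v g)) \<noteq> 0" for g
        using that w(2) by (intro v(3)) auto
    qed (use v w in auto)
    moreover have "ennreal (max 0 x) = ennreal x" for x by (auto simp: max_def ennreal_neg)
    ultimately show ?thesis by simp
  qed
  have int': "integrable Q' (\<lambda>c. v (y ** coset_rep c))"
    unfolding integrable_iff_bounded
    using meas int nn[of norm] by (auto simp: integrable_iff_bounded continuous_on_norm_id)
  have real: "(\<integral>c. w (v (coset_rep c)) \<partial>Q) = (\<integral>c. w (v (y ** coset_rep c)) \<partial>Q')"
    if w: "bounded_linear w" for w :: "complex \<Rightarrow> real"
  proof -
    have c: "continuous_on UNIV w" "continuous_on UNIV (\<lambda>z. - w z)" and 0: "w 0 = 0"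
      using linear_continuous_on[OF w, of UNIV] linear_0[OF bounded_linear.linear[OF w]]
      by (auto intro: continuous_on_minus)
    show ?thesis
      unfolding real_lebesgue_integral_def[OF integrable_bounded_linear[OF w int]]
        real_lebesgue_integral_def[OF integrable_bounded_linear[OF w int']]
      using nn[OF c(1) 0] nn[OF c(2)] 0 by simp
  qed
  show ?thesis
    by (rule complex_eqI)
      (simp_all add: integral_bounded_linear[OF bounded_linear_Re int, symmetric] integral_bounded_linear[OF bounded_linear_Im int, symmetric]
        integral_bounded_linear[OF bounded_linear_Re int', symmetric] integral_bounded_linear[OF bounded_linear_Im int', symmetric]
        real bounded_linear_Re bounded_linear_Im)
qed

end

section \<open>Test functions and their derivatives along powers\<close>

text \<open>A stand-in for compact support modulo scalars: both sides of the inequality scale by the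
  same power, and the condition survives differentiation without changing \<open>R\<close>. With the
  determinant fixed up to sign it bounds the matrix.\<close>

definition orbit_class :: "real \<Rightarrow> (real^'n^'n \<Rightarrow> complex) set" where
  "orbit_class R = {F. smooth_on GL F \<and> (\<forall>A\<in>GL. F A \<noteq> 0 \<longrightarrow> norm A ^ CARD('n) \<le> R * \<bar>det A\<bar>)}"

definition power_deriv :: "nat \<Rightarrow> (real^'n^'n \<Rightarrow> complex) \<Rightarrow> real^'n^'n \<Rightarrow> complex" where
  "power_deriv k F A = frechet_derivative F (at A) (mpow A k)"

lemma det_scaleR: "det (c *\<^sub>R A) = c ^ CARD('n) * det (A :: real^'n^'n)"
  unfolding det_def by (simp add: prod.distrib sum_distrib_left mult_ac)

lemma test_function_orbit_class:
  fixes f :: "real^'n^'n \<Rightarrow> complex"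
  assumes "test_function f"
  shows "\<exists>R. f \<in> orbit_class R"
proof -
  obtain K where K: "compact K" "K \<subseteq> GL" "\<And>g. g \<in> GL \<Longrightarrow> f g \<noteq> 0 \<Longrightarrow> \<exists>c>0. c *\<^sub>R g \<in> K"
    using assms unfolding test_function_def by blast
  have "continuous_on K (\<lambda>B. norm B ^ CARD('n) / \<bar>det B\<bar>)"
    using K(2) by (intro continuous_intros continuous_on_det) (auto simp: GL_det)
  then have "bounded ((\<lambda>B. norm B ^ CARD('n) / \<bar>det B\<bar>) ` K)"
    by (intro compact_imp_bounded compact_continuous_image K(1))
  then obtain R where R: "\<And>B. B \<in> K \<Longrightarrow> norm (norm B ^ CARD('n) / \<bar>det B\<bar>) \<le> R"
    unfolding bounded_iff by blast
  have "norm A ^ CARD('n) \<le> R * \<bar>det A\<bar>" if "A \<in> GL" "f A \<noteq> 0" for A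
  proof -
    have "\<exists>c>0. c *\<^sub>R A \<in> K" by (rule K(3)[OF that])
    then obtain c where c: "c > 0" "c *\<^sub>R A \<in> K" by blast
    have "norm (c *\<^sub>R A) ^ CARD('n) / \<bar>det (c *\<^sub>R A)\<bar> \<le> R" using R[OF c(2)] by simp
    then show ?thesis
      using c(1) that(1) by (simp add: det_scaleR power_mult_distrib abs_mult GL_det divide_le_eq)
  qed
  then show ?thesis using assms unfolding orbit_class_def test_function_def by blast
qed

text \<open>The inequality fails on an open set, where \<open>F\<close> vanishes identically, so its
  derivatives vanish there too. Smoothness holds because the entries of \<open>A^k\<close> are
  polynomials.\<close>

lemma power_deriv_orbit_class:
  fixes F :: "real^'n^'n \<Rightarrow> complex"
  assumes "F \<in> orbit_class R"
  shows "power_deriv k F \<in> orbit_class R"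
proof -
  have sm: "smooth_on GL F" and supp: "\<And>A. A \<in> GL \<Longrightarrow> F A \<noteq> 0 \<Longrightarrow> norm A ^ CARD('n) \<le> R * \<bar>det A\<bar>"
    using assms by (auto simp: orbit_class_def)
  have "smooth_on GL (power_deriv k F)"
    unfolding power_deriv_def[abs_def]
  proof (rule smooth_on_polynomial_field_derivative[OF open_GL sm])
    fix b :: "real^'n^'n" assume "b \<in> Basis"
    then obtain i j where "b = axis i (axis j 1)" by (auto simp: Basis_vec_def)
    then have "(\<lambda>A. mpow A k \<bullet> b) = (\<lambda>A. mpow A k $ i $ j)" by (simp add: inner_axis)
    then show "real_polynomial_function (\<lambda>A. mpow A k \<bullet> b)"
      using real_polynomial_function_mpow[OF real_polynomial_function_entry] by metis
  qed
  moreover have "norm A ^ CARD('n) \<le> R * \<bar>det A\<bar>" if A: "A \<in> GL" "power_deriv k F A \<noteq> 0" for A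
  proof (rule ccontr)
    assume n: "\<not> norm A ^ CARD('n) \<le> R * \<bar>det A\<bar>"
    define U where "U = GL \<inter> {B :: real^'n^'n. R * \<bar>det B\<bar> < norm B ^ CARD('n)}"
    have "open U" unfolding U_def
      by (intro open_Int open_GL open_Collect_less continuous_intros continuous_on_det)
    moreover have "A \<in> U" using A n by (simp add: U_def)
    moreover have "F B = 0" if "B \<in> U" for B using that supp by (force simp: U_def)
    ultimately have "(F has_derivative (\<lambda>_. 0)) (at A)"
      by (intro has_derivative_transform_within_open[OF has_derivative_const[of 0], of U A F]) auto
    then have "frechet_derivative F (at A) = (\<lambda>_. 0)" by (metis frechet_derivative_at)
    then show False using A by (simp add: power_deriv_def)
  qed
  ultimately show ?thesis by (simp add: orbit_class_def)
qed

text \<open>The maximum with 1 avoids extracting a root: a norm above 1 is at most its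
  \<open>n\<close>-th power.\<close>

lemma orbit_class_norm_le:
  fixes F :: "real^'n^'n \<Rightarrow> complex"
  assumes "F \<in> orbit_class R" "F A \<noteq> 0" "\<bar>det A\<bar> = \<delta>" "\<delta> > 0"
  shows "norm A \<le> max 1 (R * \<delta>)"
proof (rule ccontr)
  assume "\<not> norm A \<le> max 1 (R * \<delta>)"
  then have 1: "norm A > 1" "norm A > R * \<delta>" by auto
  have "norm A ^ 1 \<le> norm A ^ CARD('n)" using 1 by (intro power_increasing) (auto simp: Suc_le_eq)
  moreover have "norm A ^ CARD('n) \<le> R * \<delta>" using assms by (auto simp: orbit_class_def GL_det)
  ultimately show False using 1 by simp
qed

lemma orbit_class_bounded:
  fixes F :: "real^'n^'n \<Rightarrow> complex"
  assumes "F \<in> orbit_class R" "\<delta> > 0"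
  shows "\<exists>B\<ge>0. \<forall>A. \<bar>det A\<bar> = \<delta> \<longrightarrow> norm (F A) \<le> B"
proof -
  let ?S = "cball 0 (max 1 (R * \<delta>)) \<inter> {A :: real^'n^'n. \<bar>det A\<bar> = \<delta>}"
  have "closed {A :: real^'n^'n. \<bar>det A\<bar> = \<delta>}"
    by (intro closed_Collect_eq continuous_intros continuous_on_det)
  then have "compact ?S" by (intro compact_Int_closed) auto
  moreover have "continuous_on ?S F"
    by (rule continuous_on_subset[OF smooth_onD_continuous[of GL F]]) (use assms in \<open>auto simp: orbit_class_def GL_det\<close>)
  ultimately have "bounded (F ` ?S)" by (intro compact_imp_bounded compact_continuous_image)
  then obtain B where B: "\<And>A. A \<in> ?S \<Longrightarrow> norm (F A) \<le> B" unfolding bounded_iff by blast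
  have "norm (F A) \<le> max 0 B" if "\<bar>det A\<bar> = \<delta>" for A
  proof (cases "F A = 0")
    case False
    then show ?thesis using orbit_class_norm_le[OF assms(1) False that assms(2)] B[of A] that by simp
  qed simp
  then show ?thesis by (intro exI[of _ "max 0 B"]) auto
qed

lemma conjugate_matrix_mult: "g \<in> GL \<Longrightarrow> conjugate g (A ** B) = conjugate g A ** conjugate g B"
proof -
  assume g: "g \<in> GL"
  have "conjugate g A ** conjugate g B = matrix_inv g ** A ** (g ** matrix_inv g) ** B ** g"
    unfolding conjugate_def by (simp only: matrix_mul_assoc)
  then show ?thesis by (simp add: GL_inv[OF g]) (simp add: conjugate_def matrix_mul_assoc)
qed

lemma conjugate_mpow: "g \<in> GL \<Longrightarrow> conjugate g (mpow A k) = mpow (conjugate g A) k"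
  by (induction k) (simp_all add: conjugate_matrix_mult, simp add: conjugate_def GL_inv)

lemma bounded_linear_conjugate: "bounded_linear (conjugate g)"
  unfolding conjugate_def[abs_def]
  by (rule bounded_linear_compose[OF bounded_bilinear.bounded_linear_left[OF bounded_bilinear_matrix_mult]
      bounded_bilinear.bounded_linear_right[OF bounded_bilinear_matrix_mult]])

text \<open>On a compact thickening \<open>Y\<close> of \<open>Z\<close> the derivative is bounded,
  and the mean value inequality applies on each ball around a point of \<open>Z\<close>, since balls
  are convex. Hence one \<open>\<epsilon>\<close> and one \<open>L\<close> serve all of
  \<open>Z\<close>.\<close>

lemma smooth_lipschitz_near_compact:
  fixes F :: "'a::euclidean_space \<Rightarrow> 'b::real_normed_vector"
  assumes "smooth_on S F" "open S" "compact Z" "Z \<subseteq> S"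
  shows "\<exists>\<epsilon>>0. \<exists>L\<ge>0. \<forall>A\<in>Z. \<forall>B. norm (B - A) \<le> \<epsilon> \<longrightarrow> norm (F B - F A) \<le> L * norm (B - A)"
proof -
  obtain \<epsilon> where \<epsilon>: "\<epsilon> > 0" "(\<Union>A\<in>Z. cball A \<epsilon>) \<subseteq> S"
    using compact_subset_open_imp_cball_epsilon_subset[OF assms(3,2,4)] by blast
  define Y where "Y = {x + y |x y. x \<in> Z \<and> y \<in> cball 0 \<epsilon>}"
  have Y: "compact Y" unfolding Y_def by (intro compact_sums assms compact_cball)
  have cY: "cball A \<epsilon> \<subseteq> Y" if "A \<in> Z" for A
  proof
    fix x assume "x \<in> cball A \<epsilon>"
    then have "x = A + (x - A)" "x - A \<in> cball 0 \<epsilon>" by (auto simp: dist_norm norm_minus_commute)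
    then show "x \<in> Y" using that unfolding Y_def by blast
  qed
  have YS: "Y \<subseteq> S"
  proof
    fix z assume "z \<in> Y"
    then obtain x y where "z = x + y" "x \<in> Z" "norm y \<le> \<epsilon>" by (auto simp: Y_def)
    then have "z \<in> cball x \<epsilon>" by (simp add: dist_norm)
    then show "z \<in> S" using \<epsilon>(2) \<open>x \<in> Z\<close> by blast
  qed
  have "\<exists>M. \<forall>x\<in>Y. norm (frechet_derivative F (at x) b) \<le> M" for b
  proof -
    have "continuous_on Y (\<lambda>x. frechet_derivative F (at x) b)"
      by (rule continuous_on_subset[OF smooth_onD_continuous[OF smooth_on_frechet_derivative[OF assms(1)]] YS])
    then have "bounded ((\<lambda>x. frechet_derivative F (at x) b) ` Y)"
      by (intro compact_imp_bounded compact_continuous_image Y)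
    then show ?thesis unfolding bounded_iff by blast
  qed
  then obtain M where M: "\<And>b x. x \<in> Y \<Longrightarrow> norm (frechet_derivative F (at x) b) \<le> M b" by metis
  define L where "L = (\<Sum>b\<in>(Basis :: 'a set). \<bar>M b\<bar>)"
  have on: "onorm (frechet_derivative F (at x)) \<le> L" if "x \<in> Y" for x
  proof (rule onorm_le)
    fix v
    have "frechet_derivative F (at x) v = (\<Sum>b\<in>Basis. (v \<bullet> b) *\<^sub>R frechet_derivative F (at x) b)"
      by (rule has_derivative_inner_Basis_expansion[OF smooth_onD_has_derivative[OF assms(1)]]) (use YS that in auto)
    also have "norm \<dots> \<le> (\<Sum>b\<in>Basis. norm v * \<bar>M b\<bar>)"
    proof (rule sum_norm_le)
      fix b :: 'a assume "b \<in> Basis"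
      then show "norm ((v \<bullet> b) *\<^sub>R frechet_derivative F (at x) b) \<le> norm v * \<bar>M b\<bar>"
        using M[OF that, of b] by (auto intro!: mult_mono Basis_le_norm order_trans[OF _ abs_ge_self])
    qed
    finally show "norm (frechet_derivative F (at x) v) \<le> L * norm v"
      by (simp add: L_def sum_distrib_left[symmetric] mult.commute)
  qed
  have "norm (F B - F A) \<le> L * norm (B - A)" if A: "A \<in> Z" and B: "norm (B - A) \<le> \<epsilon>" for A B
  proof (rule differentiable_bound[of "cball A \<epsilon>"])
    fix x assume "x \<in> cball A \<epsilon>"
    then have x: "x \<in> Y" using cY A by blast
    show "(F has_derivative frechet_derivative F (at x)) (at x within cball A \<epsilon>)"
      by (rule has_derivative_at_withinI[OF smooth_onD_has_derivative[OF assms(1)]]) (use x YS in auto)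
    show "onorm (frechet_derivative F (at x)) \<le> L" by (rule on[OF x])
  qed (use \<epsilon>(1) B in \<open>auto simp: dist_norm norm_minus_commute\<close>)
  moreover have "L \<ge> 0" by (simp add: L_def sum_nonneg)
  ultimately show ?thesis using \<epsilon>(1) by blast
qed

section \<open>Orbital integrals over one torus\<close>

locale sym_torus = torus_quotient P T \<mu> \<nu> Q
  for P :: "complex^'n^'n" and T \<mu> \<nu> Q +
  fixes \<sigma> :: "'n \<Rightarrow> 'n"
  assumes P_sym: "conj_sym \<sigma> P"
begin

definition orb :: "(real^'n^'n \<Rightarrow> complex) \<Rightarrow> real^'n^'n \<Rightarrow> complex" where
  "orb F \<gamma> = (\<integral>c. F (conjugate (coset_rep c) \<gamma>) \<partial>Q)"

lemma meets_of_bounded_conjugate: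
  "\<exists>C>0. \<forall>\<xi> \<gamma> g. inj \<xi> \<longrightarrow> cmat \<gamma> ** P = P ** diagm \<xi> \<longrightarrow> g \<in> GL \<longrightarrow> norm (conjugate g \<gamma>) \<le> \<rho> \<longrightarrow>
    meets (C / norm (vdisc \<xi>)) C g"
proof -
  obtain C where C: "C > 0" "\<And>\<xi> B g. inj \<xi> \<Longrightarrow> cmat B ** P = P ** diagm \<xi> \<Longrightarrow> g \<in> GL \<Longrightarrow>
      norm (conjugate g B) \<le> \<rho> \<Longrightarrow>
      (\<exists>t\<in>GL. \<exists>d. cmat t ** P = P ** diagm d \<and> norm (t ** g) \<le> C / norm (vdisc \<xi>) \<and>
         norm (matrix_inv (t ** g)) \<le> C)"
    using conjugating_matrix_mod_torus[OF P_inv P_sym, of \<rho>] by blast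
  \<comment> \<open>The factor 2 turns the weak inequalities into the strict ones of
    \<open>meets\<close>.\<close>
  have "meets (2 * C / norm (vdisc \<xi>)) (2 * C) g"
    if "inj \<xi>" "cmat \<gamma> ** P = P ** diagm \<xi>" "g \<in> GL" "norm (conjugate g \<gamma>) \<le> \<rho>" for \<xi> \<gamma> g
  proof -
    note st = that
    obtain t d where t: "t \<in> GL" "cmat t ** P = P ** diagm d" "norm (t ** g) \<le> C / norm (vdisc \<xi>)"
         "norm (matrix_inv (t ** g)) \<le> C" using C(2)[OF st] by blast
    have "norm (vdisc \<xi>) > 0" using that(1) by (simp add: vdisc_eq_0_iff)
    then have "C / norm (vdisc \<xi>) < 2 * C / norm (vdisc \<xi>)" using C(1) by (simp add: divide_strict_right_mono)
    then have "norm (t ** g) < 2 * C / norm (vdisc \<xi>)" "norm (matrix_inv (t ** g)) < 2 * C"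
      using t(3,4) C(1) by linarith+
    moreover have "t \<in> T" using t(1,2) T_eq by blast
    ultimately show ?thesis unfolding meets_def by blast
  qed
  then show ?thesis using C(1) by (intro exI[of _ "2 * C"]) auto
qed

lemma meets_mono: "meets a b g \<Longrightarrow> a \<le> a' \<Longrightarrow> b \<le> b' \<Longrightarrow> meets a' b' g"
  unfolding meets_def by (meson less_le_trans)

lemma orbit_function:
  assumes F: "F \<in> orbit_class R" and \<gamma>: "cmat \<gamma> ** P = P ** diagm \<xi>" "\<gamma> \<in> GL"
  shows "continuous_on GL (\<lambda>g. F (conjugate g \<gamma>))"
    and "\<And>t g. t \<in> T \<Longrightarrow> g \<in> GL \<Longrightarrow> F (conjugate (t ** g) \<gamma>) = F (conjugate g \<gamma>)"
proof -
  have "continuous_on GL (\<lambda>g. conjugate g \<gamma>)"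
    unfolding conjugate_def by (intro continuous_intros) auto
  then show "continuous_on GL (\<lambda>g. F (conjugate g \<gamma>))"
    using F \<gamma>(2) by (intro continuous_on_compose2[OF smooth_onD_continuous[of GL F]])
      (auto simp: orbit_class_def conjugate_in_GL)
  fix t g :: "real^'n^'n" assume t: "t \<in> T" and g: "g \<in> GL"
  have "t ** \<gamma> = \<gamma> ** t" using t \<gamma>(1) diagonal_commute[OF P_inv] by (auto simp: T_eq)
  then show "F (conjugate (t ** g) \<gamma>) = F (conjugate g \<gamma>)"
    using t g T_GL by (simp add: conjugate_mult conjugate_commute)
qed

lemma orbit_function_bounded:
  assumes F: "F \<in> orbit_class R" and \<delta>: "\<delta> > 0"
  shows "\<exists>C>0. \<exists>B\<ge>0. \<forall>\<gamma> \<xi>. cmat \<gamma> ** P = P ** diagm \<xi> \<longrightarrow> inj \<xi> \<longrightarrow> \<bar>det \<gamma>\<bar> = \<delta> \<longrightarrow>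
    (\<forall>g\<in>GL. norm (F (conjugate g \<gamma>)) \<le> B \<and> (F (conjugate g \<gamma>) \<noteq> 0 \<longrightarrow> meets (C / norm (vdisc \<xi>)) C g))"
proof -
  obtain C where C: "C > 0" "\<And>\<xi> \<gamma> g. inj \<xi> \<Longrightarrow> cmat \<gamma> ** P = P ** diagm \<xi> \<Longrightarrow> g \<in> GL \<Longrightarrow>
      norm (conjugate g \<gamma>) \<le> max 1 (R * \<delta>) \<Longrightarrow> meets (C / norm (vdisc \<xi>)) C g"
    using meets_of_bounded_conjugate by blast
  obtain B where B: "B \<ge> 0" "\<And>A. \<bar>det A\<bar> = \<delta> \<Longrightarrow> norm (F A) \<le> B" using orbit_class_bounded[OF F \<delta>] by blast
  show ?thesis
    using C(1) B(1) C(2) orbit_class_norm_le[OF F _ _ \<delta>] B(2)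
    by (intro exI[of _ C] exI[of _ B] conjI allI impI ballI) (auto simp: det_conjugate)
qed

text \<open>The integrand is bounded and supported on cosets meeting a region of size proportional
  to the inverse discriminant, whose measure grows polynomially.\<close>

lemma orb_bound:
  assumes F: "F \<in> orbit_class R" and \<delta>: "\<delta> > 0"
  shows "\<exists>C N. \<forall>\<gamma> \<xi>. cmat \<gamma> ** P = P ** diagm \<xi> \<longrightarrow> inj \<xi> \<longrightarrow> \<bar>det \<gamma>\<bar> = \<delta> \<longrightarrow>
    norm (orb F \<gamma>) \<le> C * (1 + 1 / norm (vdisc \<xi>)) ^ N"
proof -
  obtain C B where C: "C > 0" "B \<ge> 0"
    "\<And>\<gamma> \<xi> g. cmat \<gamma> ** P = P ** diagm \<xi> \<Longrightarrow> inj \<xi> \<Longrightarrow> \<bar>det \<gamma>\<bar> = \<delta> \<Longrightarrow> g \<in> GL \<Longrightarrow> norm (F (conjugate g \<gamma>)) \<le> B"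
    "\<And>\<gamma> \<xi> g. cmat \<gamma> ** P = P ** diagm \<xi> \<Longrightarrow> inj \<xi> \<Longrightarrow> \<bar>det \<gamma>\<bar> = \<delta> \<Longrightarrow> g \<in> GL \<Longrightarrow>
       F (conjugate g \<gamma>) \<noteq> 0 \<Longrightarrow> meets (C / norm (vdisc \<xi>)) C g"
    using orbit_function_bounded[OF F \<delta>] by metis
  obtain D N where D: "D \<ge> 0" "\<And>a. a \<ge> 1 \<Longrightarrow> emeasure Q {c \<in> cosets T. meets a C (coset_rep c)} \<le> ennreal (D * a ^ N)"
    using quotient_growth[of C] by blast
  have "norm (orb F \<gamma>) \<le> (B * D * (1 + C) ^ N) * (1 + 1 / norm (vdisc \<xi>)) ^ N"
    if g: "cmat \<gamma> ** P = P ** diagm \<xi>" "inj \<xi>" "\<bar>det \<gamma>\<bar> = \<delta>" for \<gamma> \<xi>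
  proof -
    \<comment> \<open>A radius that is at least 1, as the growth estimate asks, and at least
      \<open>C / norm (vdisc \<xi>)\<close>.\<close>
    define a where "a = (1 + C) * (1 + 1 / norm (vdisc \<xi>))"
    have vd: "norm (vdisc \<xi>) > 0" using g(2) by (simp add: vdisc_eq_0_iff)
    have a: "a \<ge> 1" "C / norm (vdisc \<xi>) \<le> a" using C(1) vd by (auto simp: a_def field_simps)
    let ?E = "{c \<in> cosets T. meets a C (coset_rep c)}"
    have gG: "\<gamma> \<in> GL" using g(3) \<delta> by (auto simp: GL_det)
    have m: "meets a C x" if "x \<in> GL" "F (conjugate x \<gamma>) \<noteq> 0" for x
      using meets_mono[OF C(4)[OF g that]] a by simp
    have int: "integrable Q (\<lambda>c. F (conjugate (coset_rep c) \<gamma>))"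
      by (rule quotient_integrable[OF orbit_function[OF F g(1) gG] m C(3)[OF g]])
    have "ennreal (norm (orb F \<gamma>)) \<le> (\<integral>\<^sup>+c. ennreal (norm (F (conjugate (coset_rep c) \<gamma>))) \<partial>Q)"
      unfolding orb_def by (rule integral_norm_bound_ennreal[OF int])
    also have "\<dots> \<le> (\<integral>\<^sup>+c. ennreal B * indicator ?E c \<partial>Q)"
    proof (rule nn_integral_mono)
      fix c assume "c \<in> space Q"
      then have c: "c \<in> cosets T" by (simp add: quotient_space[OF quot])
      have r: "coset_rep c \<in> GL" by (rule coset_rep(2)[OF T_subgroup c])
      show "ennreal (norm (F (conjugate (coset_rep c) \<gamma>))) \<le> ennreal B * indicator ?E c"
        using m[OF r] C(3)[OF g r] c by (auto simp: indicator_def ennreal_leI)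
    qed
    also have "\<dots> = ennreal B * emeasure Q ?E" by (rule nn_integral_cmult_indicator[OF meets_sets])
    also have "\<dots> \<le> ennreal B * ennreal (D * a ^ N)" by (rule mult_left_mono[OF D(2)[OF a(1)]]) simp
    also have "\<dots> = ennreal (B * D * a ^ N)" using C(2) D(1) a by (simp add: ennreal_mult[symmetric] mult.assoc)
    finally have "norm (orb F \<gamma>) \<le> B * D * a ^ N"
      using C(2) D(1) a by (subst (asm) ennreal_le_iff) auto
    then show ?thesis by (simp add: a_def power_mult_distrib mult.assoc)
  qed
  then show ?thesis by blast
qed

lemma orb_conjugate:
  assumes F: "F \<in> orbit_class R" and \<gamma>: "cmat \<gamma> ** P = P ** diagm \<xi>" "inj \<xi>" "\<gamma> \<in> GL"
    and y: "y \<in> GL" and T': "matrix_subgroup T'" "T' = conjugate y ` T"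
    and Q': "quotient_measure \<mu> (distr \<nu> (restrict_space borel T') (conjugate y)) T' Q'"
  shows "orb F \<gamma> = (\<integral>c. F (conjugate (coset_rep c) (conjugate y \<gamma>)) \<partial>Q')"
proof -
  have \<delta>: "\<bar>det \<gamma>\<bar> > 0" using \<gamma>(3) by (simp add: GL_det)
  obtain C B where C: "C > 0" "B \<ge> 0"
    "\<And>g. g \<in> GL \<Longrightarrow> norm (F (conjugate g \<gamma>)) \<le> B"
    "\<And>g. g \<in> GL \<Longrightarrow> F (conjugate g \<gamma>) \<noteq> 0 \<Longrightarrow> meets (C / norm (vdisc \<xi>)) C g"
    using orbit_function_bounded[OF F \<delta>] \<gamma>(1,2) by metis
  have vd: "C / norm (vdisc \<xi>) > 0" using \<gamma>(2) C(1) by (simp add: vdisc_eq_0_iff)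
  have "orb F \<gamma> = (\<integral>c. F (conjugate (y ** coset_rep c) \<gamma>) \<partial>Q')"
    unfolding orb_def
    by (rule integral_conjugate_quotient[where v="\<lambda>g. F (conjugate g \<gamma>)", OF vd C(1) orbit_function[OF F \<gamma>(1,3)] C(4,3) y T' Q'])
  also have "\<dots> = (\<integral>c. F (conjugate (coset_rep c) (conjugate y \<gamma>)) \<partial>Q')"
    by (rule Bochner_Integration.integral_cong[OF refl])
      (simp add: quotient_space[OF Q'] conjugate_mult y coset_rep(2)[OF T'(1)])
  finally show ?thesis .
qed

end

section \<open>Differentiation under the orbital integral\<close>

context sym_torus
begin

text \<open>All \<open>G x\<close> are diagonal in the same basis, so the coset space does not move
  with \<open>x\<close>. The lower bound \<open>\<eta>\<close> confines the integrands near
  \<open>x0\<close> to one set of cosets of finite measure, and conjugation commutes with powers, so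
  the pointwise derivative consists of conjugated \<open>power_deriv\<close> terms. Dominated
  convergence does the rest.\<close>

lemma orb_has_derivative:
  fixes G :: "'a::real_normed_vector \<Rightarrow> real^'n^'n" and a :: "nat \<Rightarrow> 'a \<Rightarrow> real"
  assumes F: "F \<in> orbit_class R" and \<delta>: "\<delta> > 0" and \<eta>: "\<eta> > 0" and r: "r > 0"
    and G: "\<And>x. x \<in> ball x0 r \<Longrightarrow> cmat (G x) ** P = P ** diagm (\<xi> x)"
      "\<And>x. x \<in> ball x0 r \<Longrightarrow> inj (\<xi> x)" "\<And>x. x \<in> ball x0 r \<Longrightarrow> \<bar>det (G x)\<bar> = \<delta>"
      "\<And>x. x \<in> ball x0 r \<Longrightarrow> norm (vdisc (\<xi> x)) \<ge> \<eta>"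
    and dG: "(G has_derivative (\<lambda>v. \<Sum>k\<in>K. a k v *\<^sub>R mpow (G x0) k)) (at x0)"
    and K: "finite K" and a: "\<And>k. bounded_linear (a k)"
  shows "((\<lambda>x. orb F (G x)) has_derivative (\<lambda>v. \<Sum>k\<in>K. a k v *\<^sub>R orb (power_deriv k F) (G x0))) (at x0)"
proof -
  define v where "v x g = F (conjugate g (G x))" for x g
  define w where "w k g = power_deriv k F (conjugate g (G x0))" for k g
  have x0: "x0 \<in> ball x0 r" using r by simp
  have GG: "G x \<in> GL" if "x \<in> ball x0 r" for x using G(3)[OF that] \<delta> by (auto simp: GL_det)
  obtain C where C: "C > 0" "\<And>\<xi> \<gamma> g. inj \<xi> \<Longrightarrow> cmat \<gamma> ** P = P ** diagm \<xi> \<Longrightarrow> g \<in> GL \<Longrightarrow>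
      norm (conjugate g \<gamma>) \<le> max 1 (R * \<delta>) \<Longrightarrow> meets (C / norm (vdisc \<xi>)) C g"
    using meets_of_bounded_conjugate by blast
  define p where "p = C / \<eta>"
  have p: "p > 0" using C(1) \<eta> by (simp add: p_def)
  have supp: "meets p C g" if "H \<in> orbit_class R" "x \<in> ball x0 r" "g \<in> GL" "H (conjugate g (G x)) \<noteq> 0" for H x g
  proof -
    have "norm (conjugate g (G x)) \<le> max 1 (R * \<delta>)"
      by (rule orbit_class_norm_le[OF that(1,4) _ \<delta>]) (simp add: det_conjugate[OF that(3)] G(3)[OF that(2)])
    then have "meets (C / norm (vdisc (\<xi> x))) C g" by (rule C(2)[OF G(2,1)[OF that(2)] that(3)])
    moreover have "C / norm (vdisc (\<xi> x)) \<le> p"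
      unfolding p_def using G(4)[OF that(2)] \<eta> C(1) less_le_trans[OF \<eta> G(4)[OF that(2)]]
      by (intro divide_left_mono mult_pos_pos) auto
    ultimately show ?thesis using meets_mono by blast
  qed
  have int: "integrable Q (\<lambda>c. H (conjugate (coset_rep c) (G x)))" if H: "H \<in> orbit_class R" and x: "x \<in> ball x0 r" for H x
  proof -
    obtain B where B: "\<And>A. \<bar>det A\<bar> = \<delta> \<Longrightarrow> norm (H A) \<le> B" using orbit_class_bounded[OF H \<delta>] by blast
    show ?thesis
      by (rule quotient_integrable[OF orbit_function[OF H G(1)[OF x] GG[OF x]] supp[OF H x], of B])
        (auto intro!: B simp: det_conjugate G(3)[OF x])
  qed
  have wF: "power_deriv k F \<in> orbit_class R" for k by (rule power_deriv_orbit_class[OF F])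
  have "\<exists>W\<ge>0. \<forall>g\<in>GL. norm (w k g) \<le> W" for k
    using orbit_class_bounded[OF wF \<delta>, of k] G(3)[OF x0] unfolding w_def by (metis det_conjugate)
  then obtain W where W: "\<And>k. W k \<ge> 0" "\<And>k g. g \<in> GL \<Longrightarrow> norm (w k g) \<le> W k" by metis
  have "\<exists>B\<ge>0. \<forall>h. norm (a k h) \<le> norm h * B" for k using bounded_linear.nonneg_bounded[OF a] by blast
  then obtain Ka where Ka: "\<And>k. Ka k \<ge> 0" "\<And>k h. norm (a k h) \<le> norm h * Ka k" by metis

  \<comment> \<open>Off the cosets meeting a fixed compact set all terms vanish; on them \<open>v\<close> is Lipschitz at \<open>x0\<close>,
    with a constant independent of the coset.\<close>
  have "\<exists>r'>0. r' \<le> r \<and> (\<exists>L\<ge>0. \<forall>x\<in>ball x0 r'. \<forall>g\<in>GL. meets p C g \<longrightarrow> norm (v x g - v x0 g) \<le> L * norm (x - x0))"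
  proof -
    define Z where "Z = (\<lambda>\<omega>. conjugate \<omega> (G x0)) ` Om p C"
    have "continuous_on (Om p C) (\<lambda>\<omega>. conjugate \<omega> (G x0))"
      unfolding conjugate_def using Om_subset_GL by (intro continuous_intros) auto
    then have "compact Z" unfolding Z_def by (intro compact_continuous_image compact_Om)
    moreover have "Z \<subseteq> GL" unfolding Z_def using Om_subset_GL by (auto intro!: conjugate_in_GL GG[OF x0])
    ultimately obtain \<epsilon> L where L: "\<epsilon> > 0" "L \<ge> 0"
      "\<And>A B. A \<in> Z \<Longrightarrow> norm (B - A) \<le> \<epsilon> \<Longrightarrow> norm (F B - F A) \<le> L * norm (B - A)"
      using smooth_lipschitz_near_compact[of GL F Z] F open_GL unfolding orbit_class_def by blast
    obtain K' where K': "K' \<ge> 1" "\<And>(A :: real^'n^'n) (B :: real^'n^'n). norm (A ** B) \<le> K' * norm A * norm B"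
      using matrix_mult_norm_bound by blast
    let ?G' = "\<lambda>v. \<Sum>k\<in>K. a k v *\<^sub>R mpow (G x0) k"
    obtain d where d: "d > 0" "\<And>y. norm (y - x0) < d \<Longrightarrow> norm (G y - G x0 - ?G' (y - x0)) \<le> 1 * norm (y - x0)"
      using dG unfolding has_derivative_at_alt by (meson zero_less_one)
    obtain KG where KG: "KG \<ge> 0" "\<And>h. norm (?G' h) \<le> norm h * KG"
      using bounded_linear.nonneg_bounded[OF has_derivative_bounded_linear[OF dG]] by blast
    \<comment> \<open>\<open>K' * K' * C * p\<close> bounds the distortion by conjugation with an
      element of \<open>Om p C\<close>; \<open>1 + KG\<close> is a Lipschitz constant of
      \<open>G\<close> at \<open>x0\<close>.\<close>
    define q where "q = K' * K' * C * p * (1 + KG)"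
    have q: "q \<ge> 0" using K' C(1) p KG(1) by (simp add: q_def)
    define r' where "r' = min r (min d (\<epsilon> / (q + 1)))"
    have "norm (v x g - v x0 g) \<le> (L * q) * norm (x - x0)"
      if x: "x \<in> ball x0 r'" and g: "g \<in> GL" "meets p C g" for x g
    proof -
      have xr: "x \<in> ball x0 r" "norm (x - x0) < d" "norm (x - x0) \<le> \<epsilon> / (q + 1)"
        using x by (auto simp: r'_def dist_norm norm_minus_commute)
      obtain t where t: "t \<in> T" "norm (t ** g) < p" "norm (matrix_inv (t ** g)) < C"
        using g(2) by (auto simp: meets_def)
      \<comment> \<open>By invariance under the torus, \<open>g\<close> may be replaced by a
        representative in the compact set \<open>Om p C\<close>.\<close>
      define \<omega> where "\<omega> = t ** g"
      have \<omega>: "\<omega> \<in> Om p C" using t g T_GL by (auto simp: \<omega>_def Om_def GL_mult)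
      have v\<omega>: "v y g = F (conjugate \<omega> (G y))" if "y \<in> ball x0 r" for y
        unfolding v_def \<omega>_def by (rule orbit_function(2)[OF F G(1)[OF that] GG[OF that] t(1) g(1), symmetric])
      have "norm (G x - G x0) \<le> norm (G x - G x0 - ?G' (x - x0)) + norm (?G' (x - x0))"
        using norm_triangle_sub[of "G x - G x0" "?G' (x - x0)"] by (simp only: add.commute)
      also have "\<dots> \<le> 1 * norm (x - x0) + norm (x - x0) * KG" by (intro add_mono d(2) KG(2) xr)
      finally have dGx: "norm (G x - G x0) \<le> (1 + KG) * norm (x - x0)" by (simp add: algebra_simps)
      have "norm (conjugate \<omega> (G x) - conjugate \<omega> (G x0)) = norm (matrix_inv \<omega> ** (G x - G x0) ** \<omega>)"
        by (simp only: conjugate_def[of \<omega> "G x - G x0", symmetric]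
            linear_diff[OF bounded_linear.linear[OF bounded_linear_conjugate]])
      also have "\<dots> \<le> K' * norm (matrix_inv \<omega> ** (G x - G x0)) * norm \<omega>" by (rule K')
      also have "\<dots> \<le> K' * (K' * norm (matrix_inv \<omega>) * norm (G x - G x0)) * norm \<omega>"
        using K' by (intro mult_right_mono mult_left_mono) auto
      also have "\<dots> \<le> K' * (K' * C * ((1 + KG) * norm (x - x0))) * p"
        using K'(1) C(1) \<omega> dGx KG(1) by (intro mult_mono) (auto simp: Om_def)
      also have "\<dots> = q * norm (x - x0)" by (simp add: q_def)
      finally have 1: "norm (conjugate \<omega> (G x) - conjugate \<omega> (G x0)) \<le> q * norm (x - x0)" .
      also have "\<dots> \<le> (q + 1) * (\<epsilon> / (q + 1))" using xr(3) q by (intro mult_mono) auto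
      also have "\<dots> = \<epsilon>" using q by simp
      finally have 2: "norm (conjugate \<omega> (G x) - conjugate \<omega> (G x0)) \<le> \<epsilon>" .
      have "norm (v x g - v x0 g) \<le> L * norm (conjugate \<omega> (G x) - conjugate \<omega> (G x0))"
        unfolding v\<omega>[OF xr(1)] v\<omega>[OF x0] by (rule L(3)[OF _ 2]) (use \<omega> in \<open>auto simp: Z_def\<close>)
      also have "\<dots> \<le> L * (q * norm (x - x0))" by (rule mult_left_mono[OF 1 L(2)])
      finally show ?thesis by (simp add: mult.assoc)
    qed
    moreover have "r' > 0" "r' \<le> r" using r d(1) L(1) q by (auto simp: r'_def)
    moreover have "L * q \<ge> 0" using L(2) q by simp
    ultimately show ?thesis by blast
  qed
  then obtain r' L where r': "r' > 0" "r' \<le> r" and L: "L \<ge> 0"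
    "\<And>x g. x \<in> ball x0 r' \<Longrightarrow> g \<in> GL \<Longrightarrow> meets p C g \<Longrightarrow> norm (v x g - v x0 g) \<le> L * norm (x - x0)" by blast
  have dv: "((\<lambda>x. v x g) has_derivative (\<lambda>h. \<Sum>k\<in>K. a k h *\<^sub>R w k g)) (at x0)" if g: "g \<in> GL" for g
  proof -
    let ?A = "conjugate g (G x0)"
    have AG: "?A \<in> GL" by (rule conjugate_in_GL[OF g GG[OF x0]])
    have F': "(F has_derivative frechet_derivative F (at ?A)) (at ?A)"
      by (rule smooth_onD_has_derivative[of GL]) (use F AG in \<open>auto simp: orbit_class_def\<close>)
    have "((\<lambda>x. v x g) has_derivative
        (\<lambda>h. frechet_derivative F (at ?A) (conjugate g (\<Sum>k\<in>K. a k h *\<^sub>R mpow (G x0) k)))) (at x0)"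
      unfolding v_def
      by (rule has_derivative_compose[OF bounded_linear.has_derivative[OF bounded_linear_conjugate dG] F'])
    moreover have "frechet_derivative F (at ?A) (conjugate g (\<Sum>k\<in>K. a k h *\<^sub>R mpow (G x0) k)) = (\<Sum>k\<in>K. a k h *\<^sub>R w k g)" for h
      unfolding w_def power_deriv_def conjugate_mpow[OF g, symmetric]
        linear_sum[OF bounded_linear.linear[OF bounded_linear_conjugate]]
        linear_sum[OF bounded_linear.linear[OF has_derivative_bounded_linear[OF F']]]
      by (simp add: linear_scale[OF bounded_linear.linear[OF bounded_linear_conjugate]]
          linear_scale[OF bounded_linear.linear[OF has_derivative_bounded_linear[OF F']]])
    ultimately show ?thesis by simp
  qed
  let ?E = "{c \<in> cosets T. meets p C (coset_rep c)}"
  have E: "emeasure Q ?E < \<infinity>"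
  proof -
    obtain D N where D: "\<And>a. a \<ge> 1 \<Longrightarrow> emeasure Q {c \<in> cosets T. meets a C (coset_rep c)} \<le> ennreal (D * a ^ N)"
      using quotient_growth[of C] by blast
    have "emeasure Q ?E \<le> emeasure Q {c \<in> cosets T. meets (max 1 p) C (coset_rep c)}"
      by (rule emeasure_mono[OF _ meets_sets]) (auto intro: meets_mono)
    also have "\<dots> \<le> ennreal (D * max 1 p ^ N)" by (rule D) simp
    finally have "emeasure Q ?E \<le> ennreal (D * max 1 p ^ N)" .
    then show ?thesis by (rule le_less_trans) simp
  qed
  \<comment> \<open>\<open>L\<close> bounds the difference quotient of the integrand and the sum
    bounds its linear part.\<close>
  define M where "M = L + (\<Sum>k\<in>K. Ka k * W k)"
  have "((\<lambda>y. norm (orb F (G y) - orb F (G x0) - (\<Sum>k\<in>K. a k (y - x0) *\<^sub>R orb (power_deriv k F) (G x0))) / norm (y - x0))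
      \<longlongrightarrow> 0) (at x0)"
    unfolding tendsto_at_iff_sequentially
  proof (intro allI impI)
    fix X assume X: "\<forall>i. X i \<in> UNIV - {x0}" "X \<longlonglongrightarrow> x0"
    obtain N where N: "\<And>i. i \<ge> N \<Longrightarrow> X i \<in> ball x0 r'"
      using X(2) r'(1) unfolding lim_sequentially by (metis dist_commute mem_ball)
    \<comment> \<open>Dropping finitely many terms puts the whole sequence into the ball, because
      the dominating function must serve every index.\<close>
    define Y where "Y i = X (i + N)" for i
    have Y: "Y i \<in> ball x0 r'" "Y i \<noteq> x0" for i using N X(1) by (auto simp: Y_def)
    have Yr: "Y i \<in> ball x0 r" for i using Y(1)[of i] r'(2) by auto
    have Ylim: "Y \<longlonglongrightarrow> x0" unfolding Y_def by (rule LIMSEQ_ignore_initial_segment[OF X(2)])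
    define s where "s i c = (1 / norm (Y i - x0)) *\<^sub>R
      (v (Y i) (coset_rep c) - v x0 (coset_rep c) - (\<Sum>k\<in>K. a k (Y i - x0) *\<^sub>R w k (coset_rep c)))" for i c
    have intv: "integrable Q (\<lambda>c. v y (coset_rep c))" if "y \<in> ball x0 r" for y
      unfolding v_def by (rule int[OF F that])
    have intw: "integrable Q (\<lambda>c. w k (coset_rep c))" for k
      unfolding w_def by (rule int[OF wF x0])
    have ints: "integrable Q (s i)" for i
      unfolding s_def using intv[OF Yr] intv[OF x0] intw by (intro integrable_scaleR_right) auto
    have ss: "(\<integral>c. s i c \<partial>Q) = (1 / norm (Y i - x0)) *\<^sub>R
      (orb F (G (Y i)) - orb F (G x0) - (\<Sum>k\<in>K. a k (Y i - x0) *\<^sub>R orb (power_deriv k F) (G x0)))" for i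
      unfolding s_def orb_def using intv[OF Yr] intv[OF x0] intw
      by (simp add: v_def w_def)
    have "(\<lambda>i. \<integral>c. s i c \<partial>Q) \<longlonglongrightarrow> (\<integral>c. 0 \<partial>Q)"
    proof (rule integral_dominated_convergence)
      show "integrable Q (\<lambda>c. M * indicator ?E c)"
        using meets_sets E by (intro integrable_mult_right integrable_real_indicator) auto
      show "AE c in Q. (\<lambda>i. s i c) \<longlonglongrightarrow> 0"
      proof (rule AE_I2)
        fix c assume "c \<in> space Q"
        then have r: "coset_rep c \<in> GL" using coset_rep(2)[OF T_subgroup] by (simp add: quotient_space[OF quot])
        have "((\<lambda>y. norm (v y (coset_rep c) - v x0 (coset_rep c) - (\<Sum>k\<in>K. a k (y - x0) *\<^sub>R w k (coset_rep c))) / norm (y - x0)) \<longlongrightarrow> 0) (at x0)"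
          using dv[OF r] unfolding has_derivative_iff_norm by blast
        then have "(\<lambda>i. norm (s i c)) \<longlonglongrightarrow> 0"
          using Y(2) Ylim unfolding tendsto_at_iff_sequentially by (auto simp: s_def o_def)
        then show "(\<lambda>i. s i c) \<longlonglongrightarrow> 0" by (rule tendsto_norm_zero_cancel)
      qed
      show "AE c in Q. norm (s i c) \<le> M * indicator ?E c" for i
      proof (rule AE_I2)
        fix c assume "c \<in> space Q"
        then have c: "c \<in> cosets T" by (simp add: quotient_space[OF quot])
        have r: "coset_rep c \<in> GL" by (rule coset_rep(2)[OF T_subgroup c])
        show "norm (s i c) \<le> M * indicator ?E c"
        proof (cases "meets p C (coset_rep c)")
          case True
          have n: "norm (Y i - x0) > 0" using Y(2) by simp
          have "norm (\<Sum>k\<in>K. a k (Y i - x0) *\<^sub>R w k (coset_rep c)) \<le> (\<Sum>k\<in>K. norm (Y i - x0) * (Ka k * W k))"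
          proof (rule sum_norm_le)
            fix k
            have "norm (a k (Y i - x0) *\<^sub>R w k (coset_rep c)) \<le> (norm (Y i - x0) * Ka k) * W k"
              unfolding norm_scaleR using Ka[of k] Ka(2)[of k "Y i - x0"] W(2)[OF r, of k] by (intro mult_mono) auto
            then show "norm (a k (Y i - x0) *\<^sub>R w k (coset_rep c)) \<le> norm (Y i - x0) * (Ka k * W k)" by (simp add: mult.assoc)
          qed
          moreover have "norm (v (Y i) (coset_rep c) - v x0 (coset_rep c)) \<le> L * norm (Y i - x0)"
            by (rule L(2)[OF Y(1) r True])
          ultimately have "norm (v (Y i) (coset_rep c) - v x0 (coset_rep c) - (\<Sum>k\<in>K. a k (Y i - x0) *\<^sub>R w k (coset_rep c)))
              \<le> L * norm (Y i - x0) + (\<Sum>k\<in>K. norm (Y i - x0) * (Ka k * W k))"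
            by (intro order_trans[OF norm_triangle_ineq4 add_mono])
          also have "\<dots> = M * norm (Y i - x0)" unfolding sum_distrib_left[symmetric] by (simp add: M_def algebra_simps)
          finally show ?thesis using True c n by (simp add: s_def pos_divide_le_eq)
        next
          case False
          then have "v (Y i) (coset_rep c) = 0" "v x0 (coset_rep c) = 0" "\<And>k. w k (coset_rep c) = 0"
            using supp[OF F Yr r] supp[OF F x0 r] supp[OF wF x0 r] unfolding v_def w_def by blast+
          then show ?thesis using False by (simp add: s_def)
        qed
      qed
    qed (use ints in auto)
    then have "(\<lambda>i. norm (\<integral>c. s i c \<partial>Q)) \<longlonglongrightarrow> 0" using tendsto_norm_zero by fastforce
    then have "(\<lambda>i. norm (orb F (G (Y i)) - orb F (G x0) - (\<Sum>k\<in>K. a k (Y i - x0) *\<^sub>R orb (power_deriv k F) (G x0))) / norm (Y i - x0)) \<longlonglongrightarrow> 0"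
      unfolding ss by simp
    then show "((\<lambda>y. norm (orb F (G y) - orb F (G x0) - (\<Sum>k\<in>K. a k (y - x0) *\<^sub>R orb (power_deriv k F) (G x0))) / norm (y - x0)) \<circ> X) \<longlonglongrightarrow> 0"
      unfolding o_def Y_def by (rule LIMSEQ_offset)
  qed
  moreover have "bounded_linear (\<lambda>v. \<Sum>k\<in>K. a k v *\<^sub>R orb (power_deriv k F) (G x0))"
    by (intro bounded_linear_sum bounded_linear_scaleR_left bounded_linear_compose[OF bounded_linear_scaleR_left a])
  ultimately show ?thesis unfolding has_derivative_iff_norm by blast
qed

end

section \<open>Differentiability of simple roots\<close>

lemma monic_eq_prod_roots:
  fixes p :: "complex poly" and \<xi> :: "'n::finite \<Rightarrow> complex"
  assumes "degree p = CARD('n)" "lead_coeff p = 1" "inj \<xi>" "\<And>i. poly p (\<xi> i) = 0"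
  shows "p = (\<Prod>i\<in>UNIV. [:- \<xi> i, 1:])"
proof (rule ccontr)
  define q where "q = (\<Prod>i\<in>UNIV. [:- \<xi> i, 1:])"
  assume "p \<noteq> (\<Prod>i\<in>UNIV. [:- \<xi> i, 1:])"
  then have ne: "p - q \<noteq> 0" by (simp add: q_def)
  have dq: "degree q = CARD('n)" unfolding q_def by (subst degree_prod_eq_sum_degree) auto
  have lq: "lead_coeff q = 1" unfolding q_def by (simp add: lead_coeff_prod)
  have "degree (p - q) \<le> CARD('n)" using assms(1) dq by (intro degree_diff_le) auto
  moreover have "coeff (p - q) CARD('n) = 0" using assms(1,2) dq lq by simp
  ultimately have "degree (p - q) < CARD('n)"
    using ne by (metis le_neq_implies_less leading_coeff_0_iff)
  moreover have "CARD('n) \<le> degree (p - q)"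
  proof -
    have "CARD('n) = card (range \<xi>)" using assms(3) by (simp add: card_image)
    also have "\<dots> \<le> card {z. poly (p - q) z = 0}"
      using assms(4) poly_roots_finite[OF ne] by (intro card_mono) (auto simp: q_def poly_prod)
    also have "\<dots> \<le> degree (p - q)" by (rule card_poly_roots_bound[OF ne])
    finally show ?thesis .
  qed
  ultimately show False by simp
qed

text \<open>If every root were at distance at least \<open>\<epsilon>\<close> from \<open>z\<close>,
  the factorisation would force the modulus of \<open>p\<close> at \<open>z\<close> to be at least
  \<open>\<epsilon>\<close> to the degree.\<close>

lemma monic_root_near:
  fixes p :: "complex poly"
  assumes "lead_coeff p = 1" "\<epsilon> > 0" "norm (poly p z) < \<epsilon> ^ degree p"
  shows "\<exists>w. poly p w = 0 \<and> norm (w - z) < \<epsilon>"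
proof (rule ccontr)
  assume n: "\<nexists>w. poly p w = 0 \<and> norm (w - z) < \<epsilon>"
  obtain root where "smult (lead_coeff p) (\<Prod>i<degree p. [:- root i, 1:]) = p"
    by (rule complex_poly_decompose')
  then have p: "p = (\<Prod>i<degree p. [:- root i, 1:])" using assms(1) by simp
  have pe: "poly p w = (\<Prod>i<degree p. w - root i)" for w by (subst p) (simp add: poly_prod)
  have "\<epsilon> \<le> norm (z - root i)" if "i < degree p" for i
  proof -
    have "poly p (root i) = 0" unfolding pe using that by (auto intro!: prod_zero)
    then show ?thesis using n by (metis norm_minus_commute not_le)
  qed
  then have "(\<Prod>i<degree p. \<epsilon>) \<le> (\<Prod>i<degree p. norm (z - root i))"
    using assms(2) by (intro prod_mono) auto
  then show False using assms(3) by (simp add: pe prod_norm)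
qed

text \<open>When an increment factors exactly as a linear map times a convergent function, the
  derivative can be read off; this takes the place of the implicit function theorem for the
  roots.\<close>

lemma has_derivative_linear_times:
  fixes f :: "'a::real_normed_vector \<Rightarrow> 'b::real_normed_algebra"
  assumes L: "bounded_linear L" and g: "(g \<longlongrightarrow> g0) (at x0)"
    and f: "\<forall>\<^sub>F x in at x0. f x - f x0 = L (x - x0) * g x"
  shows "(f has_derivative (\<lambda>h. L h * g0)) (at x0)"
proof -
  obtain K where K: "K \<ge> 0" "\<And>h. norm (L h) \<le> norm h * K" using bounded_linear.nonneg_bounded[OF L] by blast
  have lim: "((\<lambda>x. K * norm (g x - g0)) \<longlongrightarrow> 0) (at x0)"
    using tendsto_mult_right_zero[OF tendsto_norm_zero[OF LIM_zero[OF g]]] .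
  have "((\<lambda>y. norm (f y - f x0 - L (y - x0) * g0) / norm (y - x0)) \<longlongrightarrow> 0) (at x0)"
  proof (rule Lim_null_comparison[OF _ lim])
    have "\<forall>\<^sub>F x in at x0. x \<noteq> x0" by (simp add: eventually_at_filter)
    then show "\<forall>\<^sub>F x in at x0. norm (norm (f x - f x0 - L (x - x0) * g0) / norm (x - x0)) \<le> K * norm (g x - g0)"
      using f
    proof eventually_elim
      case (elim x)
      have "norm (f x - f x0 - L (x - x0) * g0) = norm (L (x - x0) * (g x - g0))"
        by (simp add: elim algebra_simps)
      also have "\<dots> \<le> norm (L (x - x0)) * norm (g x - g0)" by (rule norm_mult_ineq)
      also have "\<dots> \<le> (norm (x - x0) * K) * norm (g x - g0)" by (intro mult_right_mono K) auto
      finally show ?case using elim(1) by (simp add: divide_le_eq mult_ac)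
    qed
  qed
  moreover have "bounded_linear (\<lambda>h. L h * g0)" by (rule bounded_linear_compose[OF bounded_linear_mult_left L])
  ultimately show ?thesis unfolding has_derivative_iff_norm by simp
qed

text \<open>The polynomial is affine in \<open>x\<close>, so \<open>V (\<xi> i) (x - x0)\<close> is
  its value at the old root \<open>\<xi> i\<close>, which is also the product of the differences to
  the new roots. Solving for the factor \<open>\<xi> i - l x i\<close> gives an exact formula whose
  other factors converge.\<close>

lemma simple_roots_differentiable:
  fixes c :: "'a::real_normed_vector \<Rightarrow> complex poly" and \<xi> :: "'n::finite \<Rightarrow> complex"
  assumes c: "\<And>x. degree (c x) = CARD('n)" "\<And>x. lead_coeff (c x) = 1"
    and V: "\<And>x z. poly (c x) z = poly (c x0) z + V z (x - x0)" "\<And>z. bounded_linear (V z)"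
    and \<xi>: "c x0 = (\<Prod>i\<in>UNIV. [:- \<xi> i, 1:])" "inj \<xi>"
    and \<sigma>: "\<And>i. cnj (\<xi> i) = \<xi> (\<sigma> i)" and real: "\<And>x z. poly (c x) (cnj z) = cnj (poly (c x) z)"
  obtains r l where "r > 0" "l x0 = \<xi>" "\<And>x. x \<in> ball x0 r \<Longrightarrow> c x = (\<Prod>i\<in>UNIV. [:- l x i, 1:])"
    "\<And>x. x \<in> ball x0 r \<Longrightarrow> inj (l x)" "\<And>x i. x \<in> ball x0 r \<Longrightarrow> cnj (l x i) = l x (\<sigma> i)"
    "\<And>i. ((\<lambda>x. l x i) has_derivative (\<lambda>h. - V (\<xi> i) h / (\<Prod>j\<in>-{i}. \<xi> i - \<xi> j))) (at x0)"
proof -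
  have "\<exists>\<rho>>0. \<forall>i j. i \<noteq> j \<longrightarrow> 2 * \<rho> \<le> norm (\<xi> i - \<xi> j)"
  proof -
    \<comment> \<open>Half the minimal distance of the roots is used as radius; the extra 1 keeps
      the set nonempty when there is a single root.\<close>
    let ?S = "insert 1 ((\<lambda>(i, j). norm (\<xi> i - \<xi> j)) ` {(i, j). i \<noteq> j})"
    have "finite ?S" by simp
    moreover have "\<forall>s\<in>?S. s > 0" using \<xi>(2) by (auto simp: inj_eq)
    ultimately have "Min ?S > 0" by (subst Min_gr_iff) auto
    moreover have "Min ?S \<le> norm (\<xi> i - \<xi> j)" if "i \<noteq> j" for i j
      by (rule Min_le) (use that in auto)
    ultimately show ?thesis by (intro exI[of _ "Min ?S / 2"]) auto
  qed
  then obtain \<rho> where \<rho>: "\<rho> > 0" "\<And>i j. i \<noteq> j \<Longrightarrow> 2 * \<rho> \<le> norm (\<xi> i - \<xi> j)" by blast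
  have root0: "poly (c x0) (\<xi> i) = 0" for i unfolding \<xi>(1) by (auto simp: poly_prod)
  have key: "\<forall>\<^sub>F x in nhds x0. \<forall>i. \<exists>z. poly (c x) z = 0 \<and> norm (z - \<xi> i) < \<epsilon>" if "\<epsilon> > 0" for \<epsilon>
  proof -
    have "\<forall>\<^sub>F x in nhds x0. norm (V (\<xi> i) (x - x0)) < \<epsilon> ^ CARD('n)" for i
    proof -
      have "((\<lambda>x. V (\<xi> i) (x - x0)) \<longlongrightarrow> V (\<xi> i) (x0 - x0)) (nhds x0)"
        by (intro bounded_linear.tendsto[OF V(2)] tendsto_intros filterlim_ident)
      then have "((\<lambda>x. norm (V (\<xi> i) (x - x0))) \<longlongrightarrow> 0) (nhds x0)"
        using tendsto_norm_zero by (simp add: linear_0[OF bounded_linear.linear[OF V(2)]])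
      then show ?thesis by (rule order_tendstoD) (use that in simp)
    qed
    then have "\<forall>\<^sub>F x in nhds x0. \<forall>i. norm (V (\<xi> i) (x - x0)) < \<epsilon> ^ CARD('n)"
      by (simp add: eventually_all_finite)
    then show ?thesis
    proof eventually_elim
      case (elim x)
      then show ?case
        using monic_root_near[OF c(2) that, of x] V(1)[of x] by (simp add: c(1) root0)
    qed
  qed
  define l where "l x i = (SOME z. poly (c x) z = 0 \<and> norm (z - \<xi> i) < \<rho>)" for x i
  obtain r where r: "r > 0" "\<And>x. x \<in> ball x0 r \<Longrightarrow> \<forall>i. \<exists>z. poly (c x) z = 0 \<and> norm (z - \<xi> i) < \<rho>"
    using key[OF \<rho>(1)] unfolding eventually_nhds_metric by (auto simp: dist_commute)
  have l: "poly (c x) (l x i) = 0 \<and> norm (l x i - \<xi> i) < \<rho>" if "x \<in> ball x0 r" for x i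
  proof -
    have "\<exists>z. poly (c x) z = 0 \<and> norm (z - \<xi> i) < \<rho>" using r(2)[OF that] by blast
    then show ?thesis unfolding l_def by (rule someI_ex)
  qed
  have sep: "i = j" if "norm (z - \<xi> i) < \<rho>" "norm (z - \<xi> j) < \<rho>" for z i j
  proof (rule ccontr)
    assume "i \<noteq> j"
    have "norm (\<xi> i - \<xi> j) \<le> norm (z - \<xi> i) + norm (z - \<xi> j)"
      using norm_triangle_ineq4[of "z - \<xi> j" "z - \<xi> i"] by simp
    then show False using that \<rho>(2)[OF \<open>i \<noteq> j\<close>] by simp
  qed
  have inj: "inj (l x)" if "x \<in> ball x0 r" for x
    using l[OF that] sep by (metis injI)
  have prod: "c x = (\<Prod>i\<in>UNIV. [:- l x i, 1:])" if "x \<in> ball x0 r" for x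
    by (rule monic_eq_prod_roots[OF c inj[OF that]]) (use l[OF that] in blast)
  have uniq: "z = l x i" if x: "x \<in> ball x0 r" and z: "poly (c x) z = 0" "norm (z - \<xi> i) < \<rho>" for x z i
  proof -
    have "poly (\<Prod>i\<in>UNIV. [:- l x i, 1:]) z = 0" using z(1) prod[OF x] by simp
    then obtain j where j: "z = l x j" by (auto simp: poly_prod)
    then have "i = j" using sep[OF z(2), of j] l[OF x, of j] by simp
    then show ?thesis using j by simp
  qed
  have x0: "x0 \<in> ball x0 r" using r(1) by simp
  have lx0: "l x0 = \<xi>"
    using uniq[OF x0 root0] \<rho>(1) by (intro ext) (metis diff_self norm_zero)
  have lim: "((\<lambda>x. l x i) \<longlongrightarrow> \<xi> i) (at x0)" for i
  proof (rule tendstoI)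
    fix \<epsilon> :: real assume "\<epsilon> > 0"
    then have "\<forall>\<^sub>F x in nhds x0. \<forall>i. \<exists>z. poly (c x) z = 0 \<and> norm (z - \<xi> i) < min \<epsilon> \<rho>"
      using key[of "min \<epsilon> \<rho>"] \<rho>(1) by simp
    moreover have "\<forall>\<^sub>F x in nhds x0. x \<in> ball x0 r" using r(1) by (intro eventually_nhds_in_open) auto
    ultimately have "\<forall>\<^sub>F x in nhds x0. dist (l x i) (\<xi> i) < \<epsilon>"
    proof eventually_elim
      case (elim x)
      then obtain z where "poly (c x) z = 0" "norm (z - \<xi> i) < \<epsilon>" "norm (z - \<xi> i) < \<rho>" by force
      then show ?case using uniq[OF elim(2), of z i] by (simp add: dist_norm)
    qed
    then show "\<forall>\<^sub>F x in at x0. dist (l x i) (\<xi> i) < \<epsilon>" by (simp add: eventually_at_filter eventually_mono)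
  qed
  have der: "((\<lambda>x. l x i) has_derivative (\<lambda>h. - V (\<xi> i) h / (\<Prod>j\<in>-{i}. \<xi> i - \<xi> j))) (at x0)" for i
  proof -
    define g where "g x = - 1 / (\<Prod>j\<in>-{i}. \<xi> i - l x j)" for x
    have ne: "(\<Prod>j\<in>-{i}. \<xi> i - \<xi> j) \<noteq> 0" using \<xi>(2) by (auto simp: inj_eq)
    have g: "(g \<longlongrightarrow> - 1 / (\<Prod>j\<in>-{i}. \<xi> i - \<xi> j)) (at x0)"
      unfolding g_def by (intro tendsto_intros lim ne)
    have "((\<lambda>x. l x i) has_derivative (\<lambda>h. V (\<xi> i) h * (- 1 / (\<Prod>j\<in>-{i}. \<xi> i - \<xi> j)))) (at x0)"
    proof (rule has_derivative_linear_times[OF V(2) g])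
      have "\<forall>\<^sub>F x in at x0. x \<in> ball x0 r" using r(1) eventually_at_ball[of r x0 UNIV] by simp
      then show "\<forall>\<^sub>F x in at x0. l x i - l x0 i = V (\<xi> i) (x - x0) * g x"
      proof eventually_elim
        case (elim x)
        have "(\<Prod>j\<in>-{i}. \<xi> i - l x j) \<noteq> 0"
        proof
          assume "(\<Prod>j\<in>-{i}. \<xi> i - l x j) = 0"
          then obtain j where j: "j \<noteq> i" "\<xi> i = l x j" by auto
          then have "norm (l x j - \<xi> i) < \<rho>" using \<rho>(1) by simp
          then show False using sep[of "l x j" i j] l[OF elim, of j] j by simp
        qed
        moreover have "V (\<xi> i) (x - x0) = (\<xi> i - l x i) * (\<Prod>j\<in>-{i}. \<xi> i - l x j)"
        proof -
          have "V (\<xi> i) (x - x0) = poly (c x) (\<xi> i)" using V(1)[of x "\<xi> i"] by (simp add: root0)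
          also have "\<dots> = (\<Prod>j\<in>UNIV. \<xi> i - l x j)" using prod[OF elim] by (simp add: poly_prod)
          finally show ?thesis by (simp add: prod.remove[of UNIV i] Compl_eq_Diff_UNIV)
        qed
        ultimately show ?case by (simp add: g_def lx0)
      qed
    qed
    then show ?thesis by simp
  qed
  \<comment> \<open>The conjugate of the root near \<open>\<xi> i\<close> is a root near
    \<open>\<xi> (\<sigma> i)\<close>, and only one root is that close.\<close>
  have cs: "cnj (l x i) = l x (\<sigma> i)" if "x \<in> ball x0 r" for x i
  proof (rule uniq[OF that])
    show "poly (c x) (cnj (l x i)) = 0" using real l[OF that] by simp
    have "norm (cnj (l x i) - \<xi> (\<sigma> i)) = norm (cnj (l x i - \<xi> i))" by (simp add: \<sigma>)
    then show "norm (cnj (l x i) - \<xi> (\<sigma> i)) < \<rho>" using l[OF that, of i] by (simp only: complex_mod_cnj)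
  qed
  show ?thesis by (rule that[OF r(1) lx0 prod inj cs der])
qed

section \<open>Orbital integrals as functions of the characteristic polynomial\<close>

lemma centralizer_conjugate:
  assumes "y \<in> GL"
  shows "centralizer (conjugate y \<gamma>) = conjugate y ` centralizer \<gamma>"
proof (intro equalityI subsetI)
  fix g assume "g \<in> conjugate y ` centralizer \<gamma>"
  then obtain t where t: "t \<in> GL" "t ** \<gamma> = \<gamma> ** t" "g = conjugate y t" by (auto simp: centralizer_def)
  then show "g \<in> centralizer (conjugate y \<gamma>)"
    using assms by (simp add: centralizer_def conjugate_in_GL conjugate_matrix_mult[symmetric])
next
  fix g assume g: "g \<in> centralizer (conjugate y \<gamma>)"
  let ?z = "matrix_inv y"
  have z: "?z \<in> GL" "conjugate y (conjugate ?z A) = A" "conjugate ?z (conjugate y A) = A" for A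
    using assms GL_inv[OF assms] by (simp_all add: conjugate_mult[symmetric]) (simp_all add: conjugate_def, simp_all add: GL_inv[OF mat1_in_GL] matrix_inv_unique[of "mat 1" "mat 1"])
  have "conjugate ?z g ** conjugate ?z (conjugate y \<gamma>) = conjugate ?z (conjugate y \<gamma>) ** conjugate ?z g"
    using g by (simp add: conjugate_matrix_mult[OF z(1), symmetric] centralizer_def)
  then have "conjugate ?z g \<in> centralizer \<gamma>"
    using g z by (simp add: centralizer_def conjugate_in_GL)
  then show "g \<in> conjugate y ` centralizer \<gamma>" using z(2)[of g] by (metis imageI)
qed

lemma charpoly_conjugate:
  assumes "y \<in> GL"
  shows "charpoly (conjugate y A) = charpoly A"
proof -
  have "poly (charpoly (conjugate y A)) z = poly (charpoly A) z" for z
  proof -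
    have "mat z ** y = y ** mat z"
      by (simp add: vec_eq_iff matrix_matrix_mult_def mat_def if_distrib if_distribR mult.commute cong: if_cong)
    then have "conjugate y (mat z) = mat z"
      unfolding conjugate_def matrix_mul_assoc[symmetric] by (simp add: matrix_mul_assoc GL_inv[OF assms])
    then have "mat z - conjugate y A = conjugate y (mat z - A)"
      by (simp add: linear_diff[OF bounded_linear.linear[OF bounded_linear_conjugate]])
    then show ?thesis by (simp add: poly_charpoly det_conjugate[OF assms])
  qed
  then show ?thesis using poly_eq_poly_eq_iff by blast
qed

lemma det_charpoly: "det (A :: real^'n^'n) = (-1) ^ CARD('n) * coeff (charpoly A) 0"
proof -
  have "poly (charpoly A) 0 = det ((-1) *\<^sub>R A)" by (simp add: poly_charpoly)
  also have "\<dots> = (-1) ^ CARD('n) * det A" by (rule det_scaleR)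
  finally show ?thesis by (simp add: poly_0_coeff_0 power_mult_distrib[symmetric] mult.assoc[symmetric])
qed

lemma coeff_coeff_poly:
  "coeff (coeff_poly n e d x) l = (if l = n then 1 else 0)
    + (\<Sum>j\<in>UNIV. if n - e j = l then (-1) ^ e j * x $ j else 0) + (if l = 0 then (-1) ^ n * d else 0)"
  unfolding coeff_poly_def by (simp add: coeff_sum coeff_pCons split: nat.split)

text \<open>\<open>\<gamma>\<close> is any choice of matrices with the prescribed polynomials,
  without continuity. \<open>h\<close> numbers the coordinates from 0, so that they can label the
  powers of \<open>X\<close>.\<close>

locale charpoly_family =
  fixes e :: "'m::finite \<Rightarrow> nat" and d :: real
    and \<mu> :: "(real^'n^'n) measure"
    and \<tau> :: "(real^'n^'n) set \<Rightarrow> (real^'n^'n) measure"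
    and Q :: "(real^'n^'n) set \<Rightarrow> (real^'n^'n) set measure"
    and \<gamma> :: "real^'m \<Rightarrow> real^'n^'n" and h :: "'n \<Rightarrow> nat"
  assumes e: "bij_betw e UNIV {1..CARD('n) - 1}" and d: "d \<noteq> 0"
    and haar: "haar_measure_on GL \<mu>" and tori: "torus_haar_measures \<tau>"
    and quot: "\<And>\<delta>. regular \<delta> \<Longrightarrow>
           quotient_measure \<mu> (\<tau> (centralizer \<delta>)) (centralizer \<delta>) (Q (centralizer \<delta>))"
    and charpoly_\<gamma>: "\<And>x. charpoly (\<gamma> x) = coeff_poly CARD('n) e d x"
    and h: "bij_betw h UNIV {..<CARD('n)}"
begin

abbreviation q :: "real^'m \<Rightarrow> real poly" where
  "q x \<equiv> charpoly (\<gamma> x)"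

text \<open>The linear part of the \<open>l\<close>-th coefficient. Subtracting the value at 0
  removes the fixed leading and constant terms.\<close>

definition b :: "nat \<Rightarrow> real^'m \<Rightarrow> real" where
  "b l v = coeff (q v) l - coeff (q 0) l"

lemma b_sum: "b l v = (\<Sum>j\<in>UNIV. if CARD('n) - e j = l then (-1) ^ e j * v $ j else 0)"
  by (simp add: b_def charpoly_\<gamma> coeff_coeff_poly if_distrib cong: if_cong)

lemma e_bounds: "0 < e j" "e j < CARD('n)"
proof -
  have "1 \<le> e j" "e j \<le> CARD('n) - 1" using bij_betwE[OF e] by auto
  moreover have "CARD('n) > 0" by simp
  ultimately show "0 < e j" "e j < CARD('n)" by linarith+
qed

lemma coeff_q: "coeff (q x) l = (if l = CARD('n) then 1 else 0) + b l x + (if l = 0 then (-1) ^ CARD('n) * d else 0)"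
  by (simp add: charpoly_\<gamma> coeff_coeff_poly b_sum)

lemma b_eq_0: "l \<ge> CARD('n) \<Longrightarrow> b l v = 0" "b 0 v = 0"
proof -
  have "CARD('n) - e j \<noteq> l" if "l \<ge> CARD('n)" for j using e_bounds[of j] that by linarith
  then show "l \<ge> CARD('n) \<Longrightarrow> b l v = 0" by (simp add: b_sum)
  have "CARD('n) - e j \<noteq> 0" for j using e_bounds[of j] by linarith
  then show "b 0 v = 0" unfolding b_sum by (intro sum.neutral ballI if_not_P)
qed

lemma b_linear: "bounded_linear (b l)"
  unfolding b_sum[abs_def]
proof (rule bounded_linear_sum)
  fix j
  show "bounded_linear (\<lambda>v :: real^'m. if CARD('n) - e j = l then (-1) ^ e j * v $ j else 0)"
  proof (cases "CARD('n) - e j = l")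
    case True
    have "bounded_linear (\<lambda>v :: real^'m. (-1) ^ e j * v $ j)"
      by (rule bounded_linear_const_mult[OF bounded_linear_vec_nth])
    then show ?thesis using True by (simp only: simp_thms if_True)
  qed (simp add: bounded_linear_zero)
qed

lemma b_polynomial: "real_polynomial_function (b l)"
  by (rule real_polynomial_function.intros(1)[OF b_linear])

lemma q_polynomial: "real_polynomial_function (\<lambda>x. coeff (q x) l)"
  unfolding coeff_q
  by (intro real_polynomial_function.intros(3) real_polynomial_function.intros(2) b_polynomial)

lemma q_monic: "degree (q x) = CARD('n)" "lead_coeff (q x) = 1"
proof -
  have "degree (q x) \<le> CARD('n)" by (rule degree_le) (auto simp: coeff_q b_eq_0)
  moreover have c: "coeff (q x) CARD('n) = 1" by (simp add: coeff_q b_eq_0)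
  ultimately show "degree (q x) = CARD('n)" using le_degree[of "q x" "CARD('n)"] by simp
  then show "lead_coeff (q x) = 1" using c by simp
qed

lemma det_of_charpoly: "charpoly A = q x \<Longrightarrow> det (A :: real^'n^'n) = d"
proof -
  assume "charpoly A = q x"
  then have "coeff (charpoly A) 0 = (-1) ^ CARD('n) * d" using coeff_q[of x 0] b_eq_0(2) by simp
  then show ?thesis unfolding det_charpoly by (simp add: mult.assoc[symmetric] power_mult_distrib[symmetric])
qed

text \<open>As a determinant this is visibly a polynomial in \<open>x\<close>; by
  \<open>\<Delta>_roots\<close> it is also the discriminant up to sign.\<close>

definition \<Delta> :: "real^'m \<Rightarrow> real" where
  "\<Delta> x = det (deriv_mult h (q x))"

lemma \<Delta>_polynomial: "real_polynomial_function \<Delta>"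
  unfolding \<Delta>_def[abs_def]
  by (intro real_polynomial_function_det real_polynomial_function_deriv_mult q_polynomial)

lemma continuous_on_\<Delta>: "continuous_on S \<Delta>"
  using real_polynomial_function_has_derivative[OF \<Delta>_polynomial]
  by (meson has_derivative_continuous continuous_at_imp_continuous_on)

lemma \<Delta>_roots: "map_poly complex_of_real (q x) = (\<Prod>i\<in>UNIV. [:- \<xi> i, 1:]) \<Longrightarrow> complex_of_real (\<Delta> x) = vdisc \<xi>"
  for \<xi> :: "'n \<Rightarrow> complex"
  unfolding \<Delta>_def by (rule det_deriv_mult[OF h q_monic])

lemma spectrum_ex: "charpoly (A :: real^'n^'n) = q x \<Longrightarrow> \<exists>\<xi>. spectrum A \<xi>"
  by (rule spectrum_exists) (use q_monic[of x] in simp_all)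

lemma spectrum_\<Delta>:
  assumes "charpoly (A :: real^'n^'n) = q x" "spectrum A \<xi>"
  shows "complex_of_real (\<Delta> x) = vdisc \<xi>" "norm (vdisc \<xi>) = \<bar>\<Delta> x\<bar>" "inj \<xi> \<longleftrightarrow> \<Delta> x \<noteq> 0"
proof -
  show 1: "complex_of_real (\<Delta> x) = vdisc \<xi>" using \<Delta>_roots assms by (simp add: spectrum_def)
  show "norm (vdisc \<xi>) = \<bar>\<Delta> x\<bar>" by (simp add: 1[symmetric])
  show "inj \<xi> \<longleftrightarrow> \<Delta> x \<noteq> 0" using vdisc_eq_0_iff[of \<xi>] by (simp add: 1[symmetric])
qed

lemma cmod_discriminant: "charpoly (A :: real^'n^'n) = q x \<Longrightarrow> cmod (discriminant A) = \<bar>\<Delta> x\<bar>"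
  using spectrum_ex norm_discriminant spectrum_\<Delta>(2) by metis

lemma in_GL: "charpoly (A :: real^'n^'n) = q x \<Longrightarrow> A \<in> GL"
  using det_of_charpoly d by (auto simp: GL_det)

lemma regular_iff: "charpoly (A :: real^'n^'n) = q x \<Longrightarrow> regular A \<longleftrightarrow> \<Delta> x \<noteq> 0"
  using cmod_discriminant[of A x] in_GL[of A x] by (auto simp: regular_def)

lemma sym_torus_centralizer:
  assumes "charpoly A = q x" "\<Delta> x \<noteq> 0" "inj \<xi>"
    and "invertible P" "conj_sym \<sigma> P" "cmat A ** P = P ** diagm \<xi>"
  shows "sym_torus P (centralizer A) \<mu> (\<tau> (centralizer A)) (Q (centralizer A)) \<sigma>"
proof
  have r: "regular A" using assms(1,2) regular_iff by blast
  show "invertible P" "conj_sym \<sigma> P" by fact+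
  show "centralizer A = {g \<in> GL. \<exists>d. cmat g ** P = P ** diagm d}"
    by (rule centralizer_eq_diagonal[OF assms(4,6,3)])
  show "haar_measure_on GL \<mu>" by (rule haar)
  show "haar_measure_on (centralizer A) (\<tau> (centralizer A))"
    using tori r unfolding torus_haar_measures_def by blast
  show "quotient_measure \<mu> (\<tau> (centralizer A)) (centralizer A) (Q (centralizer A))" by (rule quot[OF r])
qed

lemma eigenbasis:
  assumes "charpoly (A :: real^'n^'n) = q x" "\<Delta> x \<noteq> 0"
  obtains \<xi> \<sigma> P where "spectrum A \<xi>" "inj \<xi>" "\<And>i. cnj (\<xi> i) = \<xi> (\<sigma> i)"
    "invertible P" "conj_sym \<sigma> P" "cmat A ** P = P ** diagm \<xi>"
proof -
  obtain \<xi> where \<xi>: "spectrum A \<xi>" using spectrum_ex[OF assms(1)] by blast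
  have inj: "inj \<xi>" using spectrum_\<Delta>(3)[OF assms(1) \<xi>] assms(2) by simp
  obtain \<sigma> where \<sigma>: "\<And>i. cnj (\<xi> i) = \<xi> (\<sigma> i)" using spectrum_conj_index[OF \<xi>] by blast
  obtain P where "invertible P" "conj_sym \<sigma> P" "cmat A ** P = P ** diagm \<xi>"
    by (rule eigenbasis_exists[OF \<xi> inj \<sigma>])
  then show ?thesis using that \<xi> inj \<sigma> by blast
qed

text \<open>The assumption on \<open>\<tau>\<close> identifies the measure on the conjugate torus
  with the image measure, the form in which \<open>orb_conjugate\<close> compares the two
  quotients.\<close>

lemma orbital_integral_conjugate:
  assumes A: "charpoly A = q x" "\<Delta> x \<noteq> 0" and F: "F \<in> orbit_class R" and y: "y \<in> GL"
  shows "orbital_integral Q F (conjugate y A) = orbital_integral Q F A"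
proof -
  obtain \<xi> \<sigma> P where P: "spectrum A \<xi>" "inj \<xi>" "\<And>i. cnj (\<xi> i) = \<xi> (\<sigma> i)"
    "invertible P" "conj_sym \<sigma> P" "cmat A ** P = P ** diagm \<xi>"
    by (rule eigenbasis[OF A]) blast
  interpret S: sym_torus P "centralizer A" \<mu> "\<tau> (centralizer A)" "Q (centralizer A)" \<sigma>
    by (rule sym_torus_centralizer[OF A P(2,4,5,6)])
  let ?A = "conjugate y A"
  have r: "regular A" "regular ?A" using regular_iff A charpoly_conjugate[OF y, of A] by auto
  have "\<tau> (centralizer ?A) = distr (\<tau> (centralizer A)) (restrict_space borel (centralizer ?A)) (conjugate y)"
    using tori r(1) y unfolding torus_haar_measures_def by blast
  then have Q': "quotient_measure \<mu> (distr (\<tau> (centralizer A)) (restrict_space borel (centralizer ?A)) (conjugate y))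
      (centralizer ?A) (Q (centralizer ?A))"
    using quot[OF r(2)] by simp
  show ?thesis
    using S.orb_conjugate[OF F P(6,2) in_GL[OF A(1)] y matrix_subgroup_centralizer centralizer_conjugate[OF y] Q']
    by (simp add: orbital_integral_def S.orb_def)
qed

text \<open>Regular real matrices with equal characteristic polynomial are conjugate over the reals:
  their eigenbases can be chosen with the same \<open>\<sigma>\<close>.\<close>

lemma orbital_integral_charpoly:
  assumes A: "charpoly A = q x" and B: "charpoly B = q x" and x: "\<Delta> x \<noteq> 0" and F: "F \<in> orbit_class R"
  shows "orbital_integral Q F A = orbital_integral Q F B"
proof -
  obtain \<xi> \<sigma> P where P: "spectrum A \<xi>" "inj \<xi>" "\<And>i. cnj (\<xi> i) = \<xi> (\<sigma> i)"
    "invertible P" "conj_sym \<sigma> P" "cmat A ** P = P ** diagm \<xi>"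
    by (rule eigenbasis[OF A x]) blast
  have "spectrum B \<xi>" using charpoly_cong_spectrum[of A B] A B P(1) by simp
  then obtain P' where P': "invertible P'" "conj_sym \<sigma> P'" "cmat B ** P' = P' ** diagm \<xi>"
    by (rule eigenbasis_exists[OF _ P(2,3)])
  obtain y where y: "y \<in> GL" "cmat (conjugate y B) ** P = P ** diagm \<xi>"
    by (rule eigenbasis_same_involution_conjugate[OF P(4,5) P'])
  have "conjugate y B = A"
    using matrix_mult_right_cancel[OF P(4)] y(2) P(6) cmat_inject by metis
  then show ?thesis using orbital_integral_conjugate[OF B x F y(1)] by simp
qed

definition Th :: "(real^'n^'n \<Rightarrow> complex) \<Rightarrow> real^'m \<Rightarrow> complex" where
  "Th F x = orbital_integral Q F (\<gamma> x)"

text \<open>The tori are grouped by the involution \<open>\<sigma>\<close> that complex conjugation induces on the indices of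
  the eigenvalues: all regular elements with the same \<open>\<sigma>\<close> have conjugates in one torus.\<close>

lemma Th_bound_involution:
  assumes F: "F \<in> orbit_class R"
  shows "\<exists>C N. \<forall>x \<xi>. \<Delta> x \<noteq> 0 \<longrightarrow> spectrum (\<gamma> x) \<xi> \<longrightarrow> (\<forall>i. cnj (\<xi> i) = \<xi> (\<sigma> i)) \<longrightarrow>
    norm (Th F x) \<le> C * (1 + 1 / \<bar>\<Delta> x\<bar>) ^ N"
proof (cases "\<exists>x \<xi>. \<Delta> x \<noteq> 0 \<and> spectrum (\<gamma> x) \<xi> \<and> (\<forall>i. cnj (\<xi> i) = \<xi> (\<sigma> i))")
  case True
  then obtain x1 \<xi>1 where 1: "\<Delta> x1 \<noteq> 0" "spectrum (\<gamma> x1) \<xi>1" "\<And>i. cnj (\<xi>1 i) = \<xi>1 (\<sigma> i)" by blast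
  have inj1: "inj \<xi>1" using spectrum_\<Delta>(3)[OF refl 1(2)] 1(1) by simp
  obtain P where P: "invertible P" "conj_sym \<sigma> P" "cmat (\<gamma> x1) ** P = P ** diagm \<xi>1"
    by (rule eigenbasis_exists[OF 1(2) inj1 1(3)])
  let ?T = "centralizer (\<gamma> x1)"
  interpret S: sym_torus P ?T \<mu> "\<tau> ?T" "Q ?T" \<sigma>
    by (rule sym_torus_centralizer[OF refl 1(1) inj1 P])
  obtain C N where CN: "\<And>A \<xi>. cmat A ** P = P ** diagm \<xi> \<Longrightarrow> inj \<xi> \<Longrightarrow> \<bar>det A\<bar> = \<bar>d\<bar> \<Longrightarrow>
    norm (S.orb F A) \<le> C * (1 + 1 / norm (vdisc \<xi>)) ^ N"
    using S.orb_bound[OF F, of "\<bar>d\<bar>"] d by auto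
  have "norm (Th F x) \<le> C * (1 + 1 / \<bar>\<Delta> x\<bar>) ^ N"
    if x: "\<Delta> x \<noteq> 0" "spectrum (\<gamma> x) \<xi>" "\<And>i. cnj (\<xi> i) = \<xi> (\<sigma> i)" for x \<xi>
  proof -
    have inj: "inj \<xi>" using spectrum_\<Delta>(3)[OF refl x(2)] x(1) by simp
    obtain P' where P': "invertible P'" "conj_sym \<sigma> P'" "cmat (\<gamma> x) ** P' = P' ** diagm \<xi>"
      by (rule eigenbasis_exists[OF x(2) inj x(3)])
    obtain y where y: "y \<in> GL" "cmat (conjugate y (\<gamma> x)) ** P = P ** diagm \<xi>"
      by (rule eigenbasis_same_involution_conjugate[OF P(1,2) P'])
    let ?A = "conjugate y (\<gamma> x)"
    have A: "charpoly ?A = q x" by (rule charpoly_conjugate[OF y(1)])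
    have "centralizer ?A = ?T"
      unfolding S.T_eq by (rule centralizer_eq_diagonal[OF P(1) y(2) inj])
    then have "Th F x = S.orb F ?A"
      unfolding Th_def orbital_integral_charpoly[OF refl A x(1) F] by (simp add: orbital_integral_def S.orb_def)
    then show ?thesis
      using CN[OF y(2) inj] det_of_charpoly[OF A] spectrum_\<Delta>(2)[OF refl x(2)] by simp
  qed
  then show ?thesis by blast
qed blast

text \<open>There are finitely many maps \<open>\<sigma>\<close> on the indices, so summing the
  constants and the exponents over them gives a bound uniform in \<open>x\<close>.\<close>

lemma Th_bound:
  assumes F: "F \<in> orbit_class R"
  shows "\<exists>C N. \<forall>x. \<Delta> x \<noteq> 0 \<longrightarrow> norm (Th F x) \<le> C * (1 + 1 / \<bar>\<Delta> x\<bar>) ^ N"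
proof -
  have "\<forall>\<sigma>. \<exists>p. \<forall>x \<xi>. \<Delta> x \<noteq> 0 \<longrightarrow> spectrum (\<gamma> x) \<xi> \<longrightarrow> (\<forall>i. cnj (\<xi> i) = \<xi> (\<sigma> i)) \<longrightarrow>
    norm (Th F x) \<le> fst p * (1 + 1 / \<bar>\<Delta> x\<bar>) ^ snd p"
    using Th_bound_involution[OF F] by simp
  from choice[OF this] obtain p where p: "\<And>\<sigma> x \<xi>. \<Delta> x \<noteq> 0 \<Longrightarrow> spectrum (\<gamma> x) \<xi> \<Longrightarrow> (\<And>i. cnj (\<xi> i) = \<xi> (\<sigma> i)) \<Longrightarrow>
    norm (Th F x) \<le> fst (p \<sigma>) * (1 + 1 / \<bar>\<Delta> x\<bar>) ^ snd (p \<sigma>)" by blast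
  define C where "C = (\<Sum>\<sigma>\<in>UNIV. \<bar>fst (p \<sigma>)\<bar>)"
  define N where "N = (\<Sum>\<sigma>\<in>UNIV. snd (p \<sigma>))"
  have "norm (Th F x) \<le> C * (1 + 1 / \<bar>\<Delta> x\<bar>) ^ N" if x: "\<Delta> x \<noteq> 0" for x
  proof -
    obtain \<xi> \<sigma> P where P: "spectrum (\<gamma> x) \<xi>" "\<And>i. cnj (\<xi> i) = \<xi> (\<sigma> i)"
      by (rule eigenbasis[OF refl x]) blast
    have "norm (Th F x) \<le> fst (p \<sigma>) * (1 + 1 / \<bar>\<Delta> x\<bar>) ^ snd (p \<sigma>)" by (rule p[OF x P])
    also have "\<dots> \<le> C * (1 + 1 / \<bar>\<Delta> x\<bar>) ^ N"
    proof (rule mult_mono)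
      have "\<bar>fst (p \<sigma>)\<bar> \<le> C" unfolding C_def by (rule member_le_sum) auto
      then show "fst (p \<sigma>) \<le> C" by linarith
      show "(1 + 1 / \<bar>\<Delta> x\<bar>) ^ snd (p \<sigma>) \<le> (1 + 1 / \<bar>\<Delta> x\<bar>) ^ N"
        unfolding N_def by (intro power_increasing member_le_sum) auto
    qed (auto simp: C_def sum_nonneg)
    finally show ?thesis .
  qed
  then show ?thesis by blast
qed

text \<open>The Cramer numerators of the system \<open>r * q' = - \<delta>q\<close> modulo
  \<open>q\<close>, where \<open>\<delta>q\<close> has coefficients \<open>b l v\<close>. Leaving
  out the division by \<open>\<Delta>\<close> keeps them polynomial in \<open>x\<close>.\<close>

definition a :: "'n \<Rightarrow> real^'m \<Rightarrow> real^'m \<Rightarrow> real" where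
  "a k v x = det (\<chi> i j. if j = k then - b (h i) v else deriv_mult h (q x) $ i $ j)"

lemma a_polynomial: "real_polynomial_function (a k v)"
proof -
  have "real_polynomial_function (\<lambda>x. (\<chi> i j. if j = k then - b (h i) v else deriv_mult h (q x) $ i $ j) $ i $ j)" for i j
    using real_polynomial_function_deriv_mult[OF q_polynomial]
    by (cases "j = k") (simp_all add: real_polynomial_function.intros(2))
  then show ?thesis unfolding a_def[abs_def] by (rule real_polynomial_function_det)
qed

lemma a_solves:
  assumes "\<Delta> x \<noteq> 0"
  shows "deriv_mult h (q x) *v (\<chi> k. a k v x / \<Delta> x) = (\<chi> i. - b (h i) v)"
  using cramer[of "deriv_mult h (q x)" "\<chi> k. a k v x / \<Delta> x" "\<chi> i. - b (h i) v"] assms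
  by (simp add: \<Delta>_def a_def cong: if_cong)

lemma a_linear: "\<Delta> x \<noteq> 0 \<Longrightarrow> bounded_linear (\<lambda>v. a k v x / \<Delta> x)"
proof -
  assume x: "\<Delta> x \<noteq> 0"
  let ?N = "deriv_mult h (q x)"
  have N: "?N \<in> GL" using x by (simp add: GL_det \<Delta>_def)
  have "(\<chi> k. a k v x / \<Delta> x) = matrix_inv ?N *v (\<chi> i. - b (h i) v)" for v
    unfolding a_solves[OF x, symmetric] by (simp add: matrix_vector_mul_assoc GL_inv[OF N])
  then have "a k v x / \<Delta> x = (\<Sum>i\<in>UNIV. matrix_inv ?N $ k $ i * - b (h i) v)" for v
    by (simp add: vec_eq_iff matrix_vector_mult_def)
  then show ?thesis
    by (simp only:) (intro bounded_linear_sum bounded_linear_const_mult bounded_linear_minus b_linear)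
qed

text \<open>The value at \<open>z\<close> of the variation of \<open>q\<close> in direction
  \<open>v\<close>; the powers below \<open>n\<close> suffice because the leading coefficient is
  fixed.\<close>

definition V :: "complex \<Rightarrow> real^'m \<Rightarrow> complex" where
  "V z v = (\<Sum>i\<in>UNIV. z ^ h i * of_real (b (h i) v))"

lemma V_linear: "bounded_linear (V z)"
  unfolding V_def[abs_def]
  by (intro bounded_linear_sum bounded_linear_const_mult bounded_linear_compose[OF bounded_linear_of_real b_linear])

lemma poly_q_diff:
  "poly (map_poly complex_of_real (q x)) z = poly (map_poly complex_of_real (q x0)) z + V z (x - x0)"
proof -
  have p: "poly (map_poly complex_of_real (q x)) z = (\<Sum>l\<le>CARD('n). of_real (coeff (q x) l) * z ^ l)" for x
    using poly_as_sum_upto[of "map_poly complex_of_real (q x)" "CARD('n)" z] q_monic(1)[of x]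
    by (simp add: degree_map_poly coeff_map_poly)
  have "V z (x - x0) = (\<Sum>l<CARD('n). z ^ l * of_real (b l (x - x0)))"
    unfolding V_def by (rule sum.reindex_bij_betw[OF h])
  also have "\<dots> = (\<Sum>l\<le>CARD('n). z ^ l * of_real (b l (x - x0)))"
    by (simp add: lessThan_Suc_atMost[symmetric] b_eq_0)
  also have "\<dots> = (\<Sum>l\<le>CARD('n). of_real (coeff (q x) l) * z ^ l - of_real (coeff (q x0) l) * z ^ l)"
    by (intro sum.cong refl) (simp add: coeff_q linear_diff[OF bounded_linear.linear[OF b_linear]] algebra_simps)
  finally show ?thesis by (simp add: p sum_subtractf)
qed

text \<open>Evaluating the system at \<open>\<xi> i\<close> turns multiplication by
  \<open>q'\<close> into the factor \<open>q'(\<xi> i)\<close>, so the solution takes there the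
  velocity of the moving root.\<close>

lemma a_roots:
  fixes \<xi> :: "'n \<Rightarrow> complex"
  assumes x: "\<Delta> x \<noteq> 0" and \<xi>: "map_poly complex_of_real (q x) = (\<Prod>i\<in>UNIV. [:- \<xi> i, 1:])" "inj \<xi>"
  shows "(\<Sum>k\<in>UNIV. of_real (a k v x / \<Delta> x) * \<xi> i ^ h k) = - V (\<xi> i) v / (\<Prod>j\<in>-{i}. \<xi> i - \<xi> j)"
proof -
  have "(\<Prod>j\<in>-{i}. \<xi> i - \<xi> j) * (\<Sum>k\<in>UNIV. \<xi> i ^ h k * of_real ((\<chi> k. a k v x / \<Delta> x) $ k))
     = (\<Sum>j\<in>UNIV. \<xi> i ^ h j * of_real ((deriv_mult h (q x) *v (\<chi> k. a k v x / \<Delta> x)) $ j))"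
    by (rule row_eigen_mult_vec[OF row_eigen_deriv_mult[OF h q_monic \<xi>(1)], symmetric])
  also have "\<dots> = - V (\<xi> i) v" unfolding a_solves[OF x] by (simp add: V_def sum_negf)
  finally have eq: "(\<Prod>j\<in>-{i}. \<xi> i - \<xi> j) * (\<Sum>k\<in>UNIV. of_real (a k v x / \<Delta> x) * \<xi> i ^ h k) = - V (\<xi> i) v"
    by (simp add: mult.commute)
  have ne: "(\<Prod>j\<in>-{i}. \<xi> i - \<xi> j) \<noteq> 0" using \<xi>(2) by (auto simp: inj_eq)
  show ?thesis using eq by (subst nonzero_eq_divide_eq[OF ne], subst mult.commute)
qed

text \<open>Near \<open>x0\<close> the matrices \<open>\<gamma> x\<close> are replaced by
  \<open>G x\<close>, which has the moving roots as eigenvalues in the fixed eigenbasis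
  \<open>P\<close> of \<open>\<gamma> x0\<close>. This leaves \<open>Th F\<close> unchanged, keeps
  the torus fixed and makes the family differentiable at \<open>x0\<close>.\<close>

lemma Th_has_derivative:
  assumes F: "F \<in> orbit_class R" and x0: "\<Delta> x0 \<noteq> 0"
  shows "(Th F has_derivative (\<lambda>v. \<Sum>k\<in>UNIV. (a k v x0 / \<Delta> x0) *\<^sub>R Th (power_deriv (h k) F) x0)) (at x0)"
proof -
  obtain \<xi> \<sigma> P where P: "spectrum (\<gamma> x0) \<xi>" "inj \<xi>" "\<And>i. cnj (\<xi> i) = \<xi> (\<sigma> i)"
    "invertible P" "conj_sym \<sigma> P" "cmat (\<gamma> x0) ** P = P ** diagm \<xi>"
    by (rule eigenbasis[OF refl x0]) blast
  let ?T = "centralizer (\<gamma> x0)"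
  interpret S: sym_torus P ?T \<mu> "\<tau> ?T" "Q ?T" \<sigma>
    by (rule sym_torus_centralizer[OF refl x0 P(2,4,5,6)])
  let ?c = "\<lambda>x. map_poly complex_of_real (q x)"
  have \<xi>: "?c x0 = (\<Prod>i\<in>UNIV. [:- \<xi> i, 1:])" using P(1) by (simp add: spectrum_def)
  have real: "poly (?c x) (cnj z) = cnj (poly (?c x) z)" for x z
    unfolding poly_cnj by (simp add: map_poly_map_poly o_def)
  have cm: "degree (?c x) = CARD('n)" "lead_coeff (?c x) = 1" for x
    using q_monic[of x] by (simp_all add: degree_map_poly coeff_map_poly)
  obtain r1 l where l: "r1 > 0" "l x0 = \<xi>" "\<And>x. x \<in> ball x0 r1 \<Longrightarrow> ?c x = (\<Prod>i\<in>UNIV. [:- l x i, 1:])"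
    "\<And>x. x \<in> ball x0 r1 \<Longrightarrow> inj (l x)" "\<And>x i. x \<in> ball x0 r1 \<Longrightarrow> cnj (l x i) = l x (\<sigma> i)"
    "\<And>i. ((\<lambda>x. l x i) has_derivative (\<lambda>h. - V (\<xi> i) h / (\<Prod>j\<in>-{i}. \<xi> i - \<xi> j))) (at x0)"
    by (rule simple_roots_differentiable[OF cm poly_q_diff V_linear \<xi> P(2,3) real], rule that)
  have "\<forall>\<^sub>F x in nhds x0. \<bar>\<Delta> x0\<bar> / 2 < \<bar>\<Delta> x\<bar>"
  proof -
    have "((\<lambda>x. \<bar>\<Delta> x\<bar>) \<longlongrightarrow> \<bar>\<Delta> x0\<bar>) (nhds x0)"
      using continuous_on_\<Delta>[of UNIV] by (intro tendsto_rabs) (simp add: continuous_on_eq_continuous_at isCont_def tendsto_at_iff_tendsto_nhds)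
    then show ?thesis by (rule order_tendstoD) (use x0 in simp)
  qed
  then obtain r2 where r2: "r2 > 0" "\<And>x. x \<in> ball x0 r2 \<Longrightarrow> \<bar>\<Delta> x0\<bar> / 2 < \<bar>\<Delta> x\<bar>"
    unfolding eventually_nhds_metric by (auto simp: dist_commute)
  define r where "r = min r1 r2"
  have r: "r > 0" using l(1) r2(1) by (simp add: r_def)
  have r12: "x \<in> ball x0 r1" "x \<in> ball x0 r2" if "x \<in> ball x0 r" for x using that by (auto simp: r_def)
  \<comment> \<open>The real part of \<open>z\<close> times the \<open>i\<close>-th spectral
    projector. Summed over the eigenvalues these parts recover any real matrix diagonal in
    \<open>P\<close>, linearly in its eigenvalues.\<close>
  define E where "E i z = (\<chi> s t. Re (P $ s $ i * z * matrix_inv P $ i $ t))" for i z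
  have E_linear: "bounded_linear (E i)" for i
    unfolding E_def[abs_def] linear_conv_bounded_linear[symmetric]
    by (rule linearI) (simp_all add: vec_eq_iff algebra_simps)
  have E: "B = (\<Sum>i\<in>UNIV. E i (u i))" if "cmat B ** P = P ** diagm u" for B u
  proof -
    have "cmat B = (P ** diagm u) ** matrix_inv P"
      by (metis that matrix_inv_eq(1)[OF P(4)] matrix_mul_assoc matrix_mul_rid)
    then have "complex_of_real (B $ s $ t) = (\<Sum>i\<in>UNIV. P $ s $ i * u i * matrix_inv P $ i $ t)" for s t
      by (simp add: vec_eq_iff matrix_matrix_mult_def[of "P ** diagm u"] mult_diagm_nth)
    then have "B $ s $ t = Re (\<Sum>i\<in>UNIV. P $ s $ i * u i * matrix_inv P $ i $ t)" for s t
      by (metis Re_complex_of_real)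
    then show ?thesis by (simp add: vec_eq_iff E_def sum_component Re_sum)
  qed
  define G where "G x = (\<Sum>i\<in>UNIV. E i (l x i))" for x
  have G: "cmat (G x) ** P = P ** diagm (l x)" if x: "x \<in> ball x0 r1" for x
  proof -
    have "conj_sym \<sigma> (P ** diagm (l x))"
      using P(5) l(5)[OF x] by (simp add: conj_sym_def mult_diagm_nth)
    then obtain B :: "real^'n^'n" where B: "cmat B ** P = P ** diagm (l x)"
      using conj_sym_real_matrix[OF P(5) _ P(4)] by blast
    then show ?thesis using E[OF B] by (simp add: G_def)
  qed
  have Gq: "charpoly (G x) = q x" if x: "x \<in> ball x0 r1" for x
    by (rule spectrum_charpoly_eq[OF diagonalized_spectrum[OF P(4) G[OF x]] l(3)[OF x]])
  have x0r: "x0 \<in> ball x0 r1" "x0 \<in> ball x0 r" using l(1) r by auto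
  have G0: "G x0 = \<gamma> x0"
    using G[OF x0r(1)] P(6) matrix_mult_right_cancel[OF P(4)] cmat_inject unfolding l(2) by metis
  have dG: "(G has_derivative (\<lambda>v. \<Sum>i\<in>UNIV. E i (- V (\<xi> i) v / (\<Prod>j\<in>-{i}. \<xi> i - \<xi> j)))) (at x0)"
    unfolding G_def[abs_def] by (intro has_derivative_sum bounded_linear.has_derivative[OF E_linear] l(6))
  have mpow_diag: "cmat (mpow (\<gamma> x0) k) ** P = P ** diagm (\<lambda>i. \<xi> i ^ k)" for k
  proof (induction k)
    case 0
    have "diagm (\<lambda>i. 1) = (mat 1 :: complex^'n^'n)" by (simp add: diagm_def mat_def)
    then show ?case by (simp add: cmat_one)
  next
    case (Suc k)
    have "cmat (mpow (\<gamma> x0) (Suc k)) ** P = cmat (\<gamma> x0) ** (cmat (mpow (\<gamma> x0) k) ** P)"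
      by (simp add: cmat_mult matrix_mul_assoc)
    also have "\<dots> = (cmat (\<gamma> x0) ** P) ** diagm (\<lambda>i. \<xi> i ^ k)" by (simp add: Suc matrix_mul_assoc)
    also have "\<dots> = P ** (diagm \<xi> ** diagm (\<lambda>i. \<xi> i ^ k))" by (simp add: P(6) matrix_mul_assoc)
    finally show ?case by (simp add: diagm_mult)
  qed
  \<comment> \<open>Both sides are diagonal in \<open>P\<close>; \<open>a_roots\<close> says that
    their eigenvalues agree.\<close>
  have Eeq: "(\<Sum>i\<in>UNIV. E i (- V (\<xi> i) v / (\<Prod>j\<in>-{i}. \<xi> i - \<xi> j)))
      = (\<Sum>k\<in>UNIV. (a k v x0 / \<Delta> x0) *\<^sub>R mpow (\<gamma> x0) (h k))" for v
  proof (rule E[symmetric])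
    let ?M = "\<Sum>k\<in>UNIV. (a k v x0 / \<Delta> x0) *\<^sub>R mpow (\<gamma> x0) (h k)"
    have "(cmat ?M ** P) $ s $ i = (\<Sum>k\<in>UNIV. of_real (a k v x0 / \<Delta> x0) * (cmat (mpow (\<gamma> x0) (h k)) ** P) $ s $ i)" for s i
    proof -
      have "(cmat ?M ** P) $ s $ i = (\<Sum>j\<in>UNIV. \<Sum>k\<in>UNIV. of_real (a k v x0 / \<Delta> x0) * (of_real (mpow (\<gamma> x0) (h k) $ s $ j) * P $ j $ i))"
        by (simp add: matrix_matrix_mult_def[of _ P] sum_component sum_distrib_right mult.assoc)
      also have "\<dots> = (\<Sum>k\<in>UNIV. of_real (a k v x0 / \<Delta> x0) * (cmat (mpow (\<gamma> x0) (h k)) ** P) $ s $ i)"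
        by (subst sum.swap) (simp add: matrix_matrix_mult_def[of _ P] sum_distrib_left)
      finally show ?thesis .
    qed
    also have "(\<Sum>k\<in>UNIV. of_real (a k v x0 / \<Delta> x0) * (cmat (mpow (\<gamma> x0) (h k)) ** P) $ s $ i)
        = P $ s $ i * (- V (\<xi> i) v / (\<Prod>j\<in>-{i}. \<xi> i - \<xi> j))" for s i
      unfolding mpow_diag mult_diagm_nth a_roots[OF x0 \<xi> P(2), symmetric]
      by (simp add: sum_distrib_left mult_ac)
    finally show "cmat ?M ** P = P ** diagm (\<lambda>i. - V (\<xi> i) v / (\<Prod>j\<in>-{i}. \<xi> i - \<xi> j))"
      by (simp add: vec_eq_iff mult_diagm_nth)
  qed
  define g where "g = inv_into UNIV h"
  have gh: "g (h k) = k" for k unfolding g_def using h by (simp add: bij_betw_def)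
  have reindex: "(\<Sum>k<CARD('n). (a (g k) v x0 / \<Delta> x0) *\<^sub>R f k) = (\<Sum>k\<in>UNIV. (a k v x0 / \<Delta> x0) *\<^sub>R f (h k))"
    for f :: "nat \<Rightarrow> 'z::real_vector" and v
    using sum.reindex_bij_betw[OF h, of "\<lambda>k. (a (g k) v x0 / \<Delta> x0) *\<^sub>R f k"] by (simp add: gh)
  have "((\<lambda>x. S.orb F (G x)) has_derivative
      (\<lambda>v. \<Sum>k<CARD('n). (a (g k) v x0 / \<Delta> x0) *\<^sub>R S.orb (power_deriv k F) (G x0))) (at x0)"
  proof (rule S.orb_has_derivative[OF F _ _ r, of "\<bar>d\<bar>" "\<bar>\<Delta> x0\<bar> / 2"])
    fix x assume "x \<in> ball x0 r"
    note x = r12[OF this]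
    show "cmat (G x) ** P = P ** diagm (l x)" "inj (l x)" by (rule G[OF x(1)] l(4)[OF x(1)])+
    show "\<bar>det (G x)\<bar> = \<bar>d\<bar>" using det_of_charpoly[OF Gq[OF x(1)]] by simp
    have "norm (vdisc (l x)) = \<bar>\<Delta> x\<bar>" using \<Delta>_roots[OF l(3)[OF x(1)]] by (metis norm_of_real)
    then show "\<bar>\<Delta> x0\<bar> / 2 \<le> norm (vdisc (l x))" using r2(2)[OF x(2)] by simp
  next
    show "(G has_derivative (\<lambda>v. \<Sum>k<CARD('n). (a (g k) v x0 / \<Delta> x0) *\<^sub>R mpow (G x0) k)) (at x0)"
      using dG unfolding Eeq reindex G0 .
  qed (use d x0 a_linear[OF x0] in auto)
  then have D: "((\<lambda>x. S.orb F (G x)) has_derivative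
      (\<lambda>v. \<Sum>k\<in>UNIV. (a k v x0 / \<Delta> x0) *\<^sub>R Th (power_deriv (h k) F) x0)) (at x0)"
    unfolding reindex G0 by (simp add: Th_def orbital_integral_def S.orb_def)
  show ?thesis
  proof (rule has_derivative_transform_within_open[OF D open_ball x0r(2)])
    fix x assume "x \<in> ball x0 r"
    note x = r12[OF this]
    have x': "\<Delta> x \<noteq> 0" using r2(2)[OF x(2)] x0 by auto
    have "centralizer (G x) = ?T"
      unfolding S.T_eq by (rule centralizer_eq_diagonal[OF P(4) G[OF x(1)] l(4)[OF x(1)]])
    then have "S.orb F (G x) = orbital_integral Q F (G x)"
      by (simp add: orbital_integral_def S.orb_def)
    also have "\<dots> = Th F x"
      unfolding Th_def by (rule orbital_integral_charpoly[OF Gq[OF x(1)] refl x' F])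
    finally show "S.orb F (G x) = Th F x" .
  qed
qed

text \<open>At \<open>x = 0\<close> the polynomial is \<open>X^n\<close> plus a nonzero constant;
  its derivative vanishes only at 0, which is not a root.\<close>

lemma \<Delta>_0: "\<Delta> 0 \<noteq> 0"
proof
  assume "\<Delta> 0 = 0"
  obtain \<xi> where \<xi>: "spectrum (\<gamma> 0) \<xi>" using spectrum_ex[OF refl] by blast
  have c: "map_poly complex_of_real (q 0) = (\<Prod>i\<in>UNIV. [:- \<xi> i, 1:])" using \<xi> by (simp add: spectrum_def)
  have "\<not> inj \<xi>" using spectrum_\<Delta>(3)[OF refl \<xi>] \<open>\<Delta> 0 = 0\<close> by simp
  then obtain i j where ij: "i \<noteq> j" "\<xi> i = \<xi> j" by (auto simp: inj_def)
  have q0: "map_poly complex_of_real (q 0) = monom 1 CARD('n) + [:(-1) ^ CARD('n) * of_real d:]"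
    by (rule poly_eqI) (auto simp: coeff_map_poly coeff_q linear_0[OF bounded_linear.linear[OF b_linear]] coeff_pCons split: nat.split)
  have "(\<Prod>j\<in>-{i}. \<xi> i - \<xi> j) = 0" using ij by (intro prod_zero) auto
  then have "poly (pderiv (map_poly complex_of_real (q 0))) (\<xi> i) = 0"
    unfolding c poly_pderiv_prod_roots .
  then have "of_nat CARD('n) * \<xi> i ^ (CARD('n) - 1) = 0"
    unfolding q0 by (simp add: pderiv_add pderiv_monom poly_monom pderiv_pCons)
  then have z: "\<xi> i = 0" by (simp split: if_splits)
  have "poly (map_poly complex_of_real (q 0)) (\<xi> i) = 0" unfolding c by (auto simp: poly_prod)
  then show False unfolding q0 z using d by (simp add: poly_monom power_0_left)
qed

text \<open>On the line through 0 and \<open>x\<close> the discriminant is a polynomial in one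
  variable, nonzero at 0, so it has finitely many zeros and regular points approach
  \<open>x\<close>. Otherwise the limit in \<open>extend_by_limits\<close> would not be
  determined.\<close>

lemma islimpt_regular:
  assumes "\<Delta> x = 0"
  shows "x islimpt {y. \<Delta> y \<noteq> 0}"
proof -
  have "polynomial_function (\<lambda>t::real. t *\<^sub>R x)"
    by (intro polynomial_function_bounded_linear bounded_linear_scaleR_left)
  from real_polynomial_function_compose[OF this \<Delta>_polynomial]
  have "real_polynomial_function (\<lambda>t. \<Delta> (t *\<^sub>R x))" by (simp add: o_def)
  then obtain c n where cn: "(\<lambda>t. \<Delta> (t *\<^sub>R x)) = (\<lambda>t. \<Sum>i\<le>n. c i * t ^ i)"
    using real_polynomial_function_imp_sum by blast
  have "c 0 \<noteq> 0" using fun_cong[OF cn, of 0] \<Delta>_0 by (simp add: power_0_left if_distrib cong: if_cong)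
  then have "finite {t. (\<Sum>i\<le>n. c i * t ^ i) = 0}" by (subst polyfun_finite_roots) auto
  then have fin: "finite {t. \<Delta> (t *\<^sub>R x) = 0}" using cn by (metis (mono_tags, lifting) Collect_cong)
  have x: "x \<noteq> 0" using assms \<Delta>_0 by auto
  show ?thesis
    unfolding islimpt_approachable
  proof (intro allI impI)
    fix \<epsilon> :: real assume \<epsilon>: "\<epsilon> > 0"
    define \<delta> where "\<delta> = \<epsilon> / norm x"
    have \<delta>: "\<delta> > 0" using \<epsilon> x by (simp add: \<delta>_def)
    have "infinite {1 - \<delta><..<1}" using \<delta> by (simp add: infinite_Ioo)
    then obtain t where t: "t \<in> {1 - \<delta><..<1}" "\<Delta> (t *\<^sub>R x) \<noteq> 0"
      using fin by (metis (mono_tags, lifting) finite_subset mem_Collect_eq subsetI)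
    have "dist (t *\<^sub>R x) x = (1 - t) * norm x"
    proof -
      have "t *\<^sub>R x - x = (t - 1) *\<^sub>R x" by (simp add: algebra_simps)
      then show ?thesis using t(1) by (simp add: dist_norm)
    qed
    also have "\<dots> < \<delta> * norm x" using t(1) x by (intro mult_strict_right_mono) auto
    also have "\<dots> = \<epsilon>" using x by (simp add: \<delta>_def)
    finally have "dist (t *\<^sub>R x) x < \<epsilon>" .
    moreover have "t *\<^sub>R x \<noteq> x" using t(1) x by (simp add: scaleR_right_imp_eq)  (metis greaterThanLessThan_iff less_irrefl scaleR_cancel_right scaleR_one)
    ultimately show "\<exists>x'\<in>{y. \<Delta> y \<noteq> 0}. x' \<noteq> x \<and> dist x' x < \<epsilon>" using t(2) by blast
  qed
qed

lemma smooth_damped_orbital_integral: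
  assumes f: "f \<in> orbit_class R" and \<phi>: "schwartz \<phi>" "\<alpha> > 0"
  shows "smooth_on UNIV (extend_by_limits {x. discriminant (\<gamma> x) \<noteq> 0}
      (\<lambda>x. normalized_orbital_integral Q f (\<gamma> x) * \<phi> (cmod (discriminant (\<gamma> x)) powr (- \<alpha>))))"
proof -
  interpret D: damped_family \<Delta> Th "orbit_class R" "\<lambda>F k. power_deriv (h k) F" a \<phi> \<alpha>
    by unfold_locales
      (use \<phi> in \<open>auto intro: \<Delta>_polynomial a_polynomial power_deriv_orbit_class Th_has_derivative Th_bound\<close>)
  let ?F = "\<lambda>x. normalized_orbital_integral Q f (\<gamma> x) * \<phi> (cmod (discriminant (\<gamma> x)) powr (- \<alpha>))"
  \<comment> \<open>The exponent 1/2 is the normalising factor of the orbital integral.\<close>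
  let ?t = "D.damped_term (\<lambda>_. 1) (1/2) f 0"
  have disc: "cmod (discriminant (\<gamma> x)) = \<bar>\<Delta> x\<bar>" for x by (rule cmod_discriminant[OF refl])
  have reg: "{x. discriminant (\<gamma> x) \<noteq> 0} = {x. \<Delta> x \<noteq> 0}" using disc by (metis abs_eq_0_iff norm_eq_zero)
  have eq: "?t x = ?F x" if "\<Delta> x \<noteq> 0" for x
    using that by (simp add: D.damped_term_def normalized_orbital_integral_def disc Th_def scaleR_conv_of_real)
  have one: "real_polynomial_function (\<lambda>_. 1)" by (rule real_polynomial_function.intros(2))
  have "extend_by_limits {x. discriminant (\<gamma> x) \<noteq> 0} ?F = ?t"
  proof
    fix x
    show "extend_by_limits {x. discriminant (\<gamma> x) \<noteq> 0} ?F x = ?t x"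
    proof (cases "\<Delta> x = 0")
      case True
      have "(?t \<longlongrightarrow> 0) (at x within {x. \<Delta> x \<noteq> 0})"
        using D.damped_term_tendsto(2)[OF one f True] by (rule tendsto_within_subset) simp
      moreover have "\<forall>\<^sub>F y in at x within {x. \<Delta> x \<noteq> 0}. ?t y = ?F y"
        by (simp add: eventually_at_filter eq)
      ultimately have "(?F \<longlongrightarrow> 0) (at x within {x. \<Delta> x \<noteq> 0})"
        by (rule Lim_transform_eventually)
      then have "Lim (at x within {x. \<Delta> x \<noteq> 0}) ?F = 0"
        using islimpt_regular[OF True] by (intro tendsto_Lim) (simp add: trivial_limit_within)
      then show ?thesis using True unfolding extend_by_limits_def reg by (simp add: D.damped_term_def)
    next
      case False
      then show ?thesis unfolding extend_by_limits_def reg using eq by simp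
    qed
  qed
  then show ?thesis using D.damped_sum_smooth[OF D.damped_sum.damped_termI[OF one f]] by simp
qed

end

theorem theorem4p1:
  fixes e :: "'m::finite \<Rightarrow> nat"
    and p k :: nat and s \<alpha> :: real
    and \<mu> :: "(real^'n^'n) measure"
    and \<tau> :: "(real^'n^'n) set \<Rightarrow> (real^'n^'n) measure"
    and Q :: "(real^'n^'n) set \<Rightarrow> (real^'n^'n) set measure"
    and f :: "real^'n^'n \<Rightarrow> complex"
    and \<gamma> :: "real^'m \<Rightarrow> real^'n^'n"
    and \<phi> :: "real \<Rightarrow> complex"
  assumes "CARD('n) \<ge> 2"
    and "bij_betw e UNIV {1..CARD('n) - 1}"
    and "prime p" and "k \<ge> 1" and "s \<in> {1, -1}"
    and "haar_measure_on GL \<mu>"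
    and "torus_haar_measures \<tau>"
    and "\<And>\<delta>. regular \<delta> \<Longrightarrow>
           quotient_measure \<mu> (\<tau> (centralizer \<delta>)) (centralizer \<delta>) (Q (centralizer \<delta>))"
    and "test_function f"
    and "compactly_supported_orbital_integrals Q f"
    and "\<And>x. charpoly (\<gamma> x) = coeff_poly CARD('n) e (s * real p ^ k) x"
    and "schwartz \<phi>" and "\<alpha> > 0"
  shows "smooth_on UNIV
           (extend_by_limits {x. discriminant (\<gamma> x) \<noteq> 0}
             (\<lambda>x. normalized_orbital_integral Q f (\<gamma> x)
                    * \<phi> (cmod (discriminant (\<gamma> x)) powr (- \<alpha>))))"
proof -
  obtain h :: "'n \<Rightarrow> nat" where h: "bij_betw h UNIV {..<CARD('n)}"
    using ex_bij_betw_finite_nat[OF finite[of "UNIV :: 'n set"]] by (auto simp: atLeast0LessThan)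
  have "s * real p ^ k \<noteq> 0" using assms(3,5) by (auto dest: prime_gt_0_nat)
  then interpret charpoly_family e "s * real p ^ k" \<mu> \<tau> Q \<gamma> h
    using assms h by unfold_locales
  obtain R where "f \<in> orbit_class R" using test_function_orbit_class[OF assms(9)] by blast
  then show ?thesis using assms(12,13) by (rule smooth_damped_orbital_integral)
qed

end
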